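(* Let $q_0>0$, $d_0>0$, $\sigma>0$ and $0<b\leqslant 1$ be constants and let $(B_t)_{t\geqslant 0}$ be a standard Brownian motion. The solution of the stochastic differential equation $$\mathrm{d}Q_t = -\frac{d_0Q_t}{1+bd_0t}\,\mathrm{d}t + \sigma Q_t\,\mathrm{d}B_t,\qquad Q_0=q_0,$$ is $$\forall t\geqslant 0,\quad Q_t = q_0(1+bd_0t)^{-1/b}\exp\left(-\frac{1}{2}\sigma^2t+\sigma B_t\right).$$
   Context: "The solution" means the unique strong solution of the stochastic differential equation (in the Itô sense) driven by the given Brownian motion $(B_t)$. *)

theory Defs
  imports "HOL-Probability.Probability"
begin

text \<open>
  Processes are indexed by real numbers, but only their values at times \<open>t \<ge> 0\<close> matter.
\<close>

definition continuous_paths :: "'a measure \<Rightarrow> (real \<Rightarrow> 'a \<Rightarrow> real) \<Rightarrow> bool" where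
  "continuous_paths M X \<longleftrightarrow> (\<forall>\<omega>\<in>space M. continuous_on {0..} (\<lambda>t. X t \<omega>))"

definition adapted :: "(real \<Rightarrow> 'a measure) \<Rightarrow> (real \<Rightarrow> 'a \<Rightarrow> real) \<Rightarrow> bool" where
  "adapted F X \<longleftrightarrow> (\<forall>t\<ge>0. X t \<in> borel_measurable (F t))"

definition progressively_measurable ::
  "(real \<Rightarrow> 'a measure) \<Rightarrow> (real \<Rightarrow> 'a \<Rightarrow> real) \<Rightarrow> bool" where
  "progressively_measurable F X \<longleftrightarrow>
     (\<forall>t\<ge>0. (\<lambda>(s, \<omega>). X s \<omega>) \<in> borel_measurable (restrict_space borel {0..t} \<Otimes>\<^sub>M F t))"

definition natural_filtration ::
  "'a measure \<Rightarrow> (real \<Rightarrow> 'a \<Rightarrow> real) \<Rightarrow> real \<Rightarrow> 'a measure" where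
  "natural_filtration M X t =
     sigma (space M) {X s -` A \<inter> space M | s A. 0 \<le> s \<and> s \<le> t \<and> A \<in> sets borel}"

text \<open>
  The null sets added here are the measurable ones. If \<open>M\<close> is complete, this is the usual
  augmentation; otherwise it keeps every \<open>\<sigma>\<close>-algebra of the filtration inside that of \<open>M\<close>.
\<close>

definition augmented_filtration ::
  "'a measure \<Rightarrow> (real \<Rightarrow> 'a \<Rightarrow> real) \<Rightarrow> real \<Rightarrow> 'a measure" where
  "augmented_filtration M X t =
     sigma (space M) (sets (natural_filtration M X t) \<union> null_sets M)"

lemma filtration_augmented_filtration: "filtration (space M) (augmented_filtration M X)"
proof
  have sp: "space (natural_filtration M X t) = space M" for t
    unfolding natural_filtration_def by (rule space_measure_of) auto
  have Pow: "sets (natural_filtration M X t) \<union> null_sets M \<subseteq> Pow (space M)" for t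
    using sets.space_closed[of "natural_filtration M X t"] sets.space_closed[of M]
    by (auto simp: sp)
  show "space (augmented_filtration M X t) = space M" for t
    unfolding augmented_filtration_def by (rule space_measure_of[OF Pow])
  fix s t :: real
  assume "s \<le> t"
  then have "{X u -` A \<inter> space M | u A. 0 \<le> u \<and> u \<le> s \<and> A \<in> sets borel}
      \<subseteq> {X u -` A \<inter> space M | u A. 0 \<le> u \<and> u \<le> t \<and> A \<in> sets borel}"
    by (blast intro: order_trans)
  then have "sets (natural_filtration M X s) \<subseteq> sets (natural_filtration M X t)"
    unfolding natural_filtration_def
    by (subst (1 2) sets_measure_of) (auto intro!: sigma_sets_mono')
  then have "sets (natural_filtration M X s) \<union> null_sets M
      \<subseteq> sets (natural_filtration M X t) \<union> null_sets M"
    by blast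
  then show "sets (augmented_filtration M X s) \<subseteq> sets (augmented_filtration M X t)"
    unfolding augmented_filtration_def sets_measure_of[OF Pow] by (rule sigma_sets_mono')
qed

definition standard_brownian_motion :: "'a measure \<Rightarrow> (real \<Rightarrow> 'a \<Rightarrow> real) \<Rightarrow> bool" where
  "standard_brownian_motion M B \<longleftrightarrow>
     prob_space M \<and>
     (\<forall>t\<ge>0. B t \<in> borel_measurable M) \<and>
     (AE \<omega> in M. B 0 \<omega> = 0) \<and>
     (\<forall>s t. 0 \<le> s \<and> s < t \<longrightarrow>
        prob_space.indep_set M (sets (natural_filtration M B s))
          {(\<lambda>\<omega>. B t \<omega> - B s \<omega>) -` A \<inter> space M | A. A \<in> sets borel}) \<and>
     (\<forall>s t. 0 \<le> s \<and> s < t \<longrightarrow>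
        distributed M lborel (\<lambda>\<omega>. B t \<omega> - B s \<omega>) (normal_density 0 (sqrt (t - s)))) \<and>
     continuous_paths M B"

definition null_in_probability :: "'a measure \<Rightarrow> (nat \<Rightarrow> 'a \<Rightarrow> ennreal) \<Rightarrow> bool" where
  "null_in_probability M Y \<longleftrightarrow>
     (\<forall>k. Y k \<in> borel_measurable M) \<and>
     (\<forall>\<epsilon>::real. 0 < \<epsilon> \<longrightarrow>
        (\<lambda>k. measure M {\<omega> \<in> space M. ennreal \<epsilon> < Y k \<omega>}) \<longlonglongrightarrow> 0)"

text \<open>
  A simple process is given by times \<open>\<tau> 0 \<le> \<dots> \<le> \<tau> n\<close> and bounded variables
  \<open>\<xi> 0, \<dots>, \<xi> (n - 1)\<close>; it takes the value \<open>\<xi> i\<close>, known at time \<open>\<tau> i\<close>, on the interval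
  from \<open>\<tau> i\<close> (excluded) to \<open>\<tau> (i + 1)\<close> (included).
\<close>

definition simple_process ::
  "(real \<Rightarrow> 'a measure) \<Rightarrow> nat \<Rightarrow> (nat \<Rightarrow> real) \<Rightarrow> (nat \<Rightarrow> 'a \<Rightarrow> real) \<Rightarrow> bool" where
  "simple_process F n \<tau> \<xi> \<longleftrightarrow>
     0 \<le> \<tau> 0 \<and>
     (\<forall>i<n. \<tau> i \<le> \<tau> (Suc i) \<and> \<xi> i \<in> borel_measurable (F (\<tau> i)) \<and>
        (\<exists>C. \<forall>\<omega>\<in>space (F (\<tau> i)). \<bar>\<xi> i \<omega>\<bar> \<le> C))"

definition simple_value ::
  "nat \<Rightarrow> (nat \<Rightarrow> real) \<Rightarrow> (nat \<Rightarrow> 'a \<Rightarrow> real) \<Rightarrow> real \<Rightarrow> 'a \<Rightarrow> real" where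
  "simple_value n \<tau> \<xi> s \<omega> = (\<Sum>i<n. \<xi> i \<omega> * indicator {\<tau> i<..\<tau> (Suc i)} s)"

definition simple_integral ::
  "(real \<Rightarrow> 'a \<Rightarrow> real) \<Rightarrow> nat \<Rightarrow> (nat \<Rightarrow> real) \<Rightarrow> (nat \<Rightarrow> 'a \<Rightarrow> real) \<Rightarrow> real \<Rightarrow> 'a \<Rightarrow> real" where
  "simple_integral B n \<tau> \<xi> t \<omega> =
     (\<Sum>i<n. \<xi> i \<omega> * (B (min (\<tau> (Suc i)) t) \<omega> - B (min (\<tau> i) t) \<omega>))"

text \<open>
  \<open>has_ito_integral M F B H I\<close> says that the continuous adapted process \<open>I\<close> is the Ito
  integral process of \<open>H\<close> with respect to \<open>B\<close>, for \<open>B\<close> a Brownian motion whose increments after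
  time \<open>t\<close> are independent of \<open>F t\<close>. The integrand need not be square-integrable over
  \<open>M\<close>: its paths are almost surely locally square-integrable, and the integral is the limit in
  probability of integrals of approximating simple processes.
\<close>

definition has_ito_integral ::
  "'a measure \<Rightarrow> (real \<Rightarrow> 'a measure) \<Rightarrow> (real \<Rightarrow> 'a \<Rightarrow> real) \<Rightarrow> (real \<Rightarrow> 'a \<Rightarrow> real) \<Rightarrow>
   (real \<Rightarrow> 'a \<Rightarrow> real) \<Rightarrow> bool" where
  "has_ito_integral M F B H I \<longleftrightarrow>
     progressively_measurable F H \<and>
     (\<forall>T\<ge>0. AE \<omega> in M. (\<integral>\<^sup>+s\<in>{0..T}. ennreal ((H s \<omega>)\<^sup>2) \<partial>lborel) < \<infinity>) \<and>
     adapted F I \<and> continuous_paths M I \<and>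
     (\<forall>T\<ge>0. \<exists>n \<tau> \<xi>.
        (\<forall>k. simple_process F (n k) (\<tau> k) (\<xi> k)) \<and>
        null_in_probability M
          (\<lambda>k \<omega>. \<integral>\<^sup>+s\<in>{0..T}. ennreal ((simple_value (n k) (\<tau> k) (\<xi> k) s \<omega> - H s \<omega>)\<^sup>2) \<partial>lborel) \<and>
        (\<forall>t\<in>{0..T}. null_in_probability M
          (\<lambda>k \<omega>. ennreal \<bar>simple_integral B (n k) (\<tau> k) (\<xi> k) t \<omega> - I t \<omega>\<bar>)))"

text \<open>
  Strong solutions of \<open>dX\<^sub>t = \<mu> t X\<^sub>t dt + s t X\<^sub>t dB\<^sub>t\<close>, \<open>X\<^sub>0 = x0\<close>, with deterministic initial value:
  the solution is adapted to the augmented filtration of the driving Brownian motion.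
\<close>

definition strong_solution ::
  "'a measure \<Rightarrow> (real \<Rightarrow> 'a \<Rightarrow> real) \<Rightarrow> (real \<Rightarrow> real \<Rightarrow> real) \<Rightarrow> (real \<Rightarrow> real \<Rightarrow> real) \<Rightarrow> real \<Rightarrow>
   (real \<Rightarrow> 'a \<Rightarrow> real) \<Rightarrow> bool" where
  "strong_solution M B \<mu> s x0 X \<longleftrightarrow>
     adapted (augmented_filtration M B) X \<and> continuous_paths M X \<and>
     (AE \<omega> in M. X 0 \<omega> = x0) \<and>
     (\<forall>t\<ge>0. AE \<omega> in M. set_integrable lborel {0..t} (\<lambda>u. \<mu> u (X u \<omega>))) \<and>
     (\<exists>I. has_ito_integral M (augmented_filtration M B) B (\<lambda>u \<omega>. s u (X u \<omega>)) I \<and>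
        (AE \<omega> in M. \<forall>t\<ge>0. X t \<omega> = x0 + (LINT u:{0..t}|lborel. \<mu> u (X u \<omega>)) + I t \<omega>))"

text \<open>Uniqueness is up to indistinguishability.\<close>

definition unique_strong_solution ::
  "'a measure \<Rightarrow> (real \<Rightarrow> 'a \<Rightarrow> real) \<Rightarrow> (real \<Rightarrow> real \<Rightarrow> real) \<Rightarrow> (real \<Rightarrow> real \<Rightarrow> real) \<Rightarrow> real \<Rightarrow>
   (real \<Rightarrow> 'a \<Rightarrow> real) \<Rightarrow> bool" where
  "unique_strong_solution M B \<mu> s x0 X \<longleftrightarrow>
     strong_solution M B \<mu> s x0 X \<and>
     (\<forall>Y. strong_solution M B \<mu> s x0 Y \<longrightarrow> (AE \<omega> in M. \<forall>t\<ge>0. Y t \<omega> = X t \<omega>))"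

end

theory Submission
  imports Defs
begin

text \<open>
  Existence and uniqueness rest on one estimate for sums \<open>\<Sum> \<xi>\<^sub>j \<eta>\<^sub>j\<close> of centred steps \<open>\<eta>\<^sub>j\<close> with variance at most
  \<open>v\<^sub>j\<close>, independent of the past that determines \<open>\<xi>\<^sub>j\<close>: such a sum is small in probability
  as soon as \<open>\<Sum> \<xi>\<^sub>j\<^sup>2 v\<^sub>j\<close> is. It replaces Ito's formula. Let \<open>g' = m g\<close> and
  \<open>E\<^sub>t = exp (\<sigma> B\<^sub>t - \<sigma>\<^sup>2 t / 2)\<close>. On a fine grid, with \<open>a\<close> the increment of \<open>\<sigma> B\<close> and \<open>q\<close> its variance,
  \<open>E\<^sub>i\<^sub>+\<^sub>1 - E\<^sub>i = E\<^sub>i a + E\<^sub>i (exp (a - q / 2) - 1 - a)\<close>; the last factor is centred with variance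
  \<open>O (q\<^sup>2)\<close>, so the Ito sums of \<open>\<sigma> X\<close> with \<open>X = x\<^sub>0 g E\<close> converge to \<open>X - x\<^sub>0 - \<integral> m X\<close>. For any solution
  \<open>Y\<close>, the quotient \<open>Z = Y / (g E)\<close> changes in one step by \<open>Z\<^sub>i ((1 + a) exp (- a + q / 2) - 1)\<close>,
  which has mean and variance \<open>O (q\<^sup>2)\<close> relative to \<open>Z\<^sub>i\<close>, plus terms controlled by
  \<open>\<integral> (Y\<^sub>s - Y\<^sub>i) dB\<^sub>s\<close> over the step. All sums vanish in the limit, hence \<open>Z\<close> is constant.
\<close>

section \<open>Convergence to zero in probability\<close>

text \<open>Neither the integrands nor an arbitrary solution \<open>Y\<close> need have moments, and
  the Ito integral is known only as a limit in probability; hence weights are cut off before second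
  moments are taken, and all limits are limits in probability.

  The obstacle in the uniqueness half is the remainder over a step, the integral of
  \<open>Y_s - Y_i\<close>. It is multiplied by the new value of \<open>1 / E\<close>, which depends
  on the same increment of \<open>B\<close>, so the product is not adapted. Writing the new value as
  the old one times \<open>1 + \<zeta>\<close> leaves a sum with known weights and a sum of products
  of weighted remainders with \<open>\<zeta>\<close>. By Cauchy-Schwarz the latter is at most a
  product of two Euclidean norms: that of the weighted remainders tends to 0, that of the
  \<open>\<zeta>\<close> merely stays bounded in probability, like a quadratic variation. For this
  reason the estimates concern the Euclidean norm of sums over blocks of indices: one block gives
  the absolute value of the whole sum, singleton blocks give the norm of the individual
  terms.\<close>

context finite_measure
begin

lemma measure_pred_mono:
  assumes "\<And>\<omega>. \<omega> \<in> space M \<Longrightarrow> P \<omega> \<Longrightarrow> Q \<omega>" and "Measurable.pred M Q"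
  shows "\<P>(\<omega> in M. P \<omega>) \<le> \<P>(\<omega> in M. Q \<omega>)"
  using assms by (intro finite_measure_mono) auto

lemma measure_pred_disj_le:
  assumes "\<And>\<omega>. \<omega> \<in> space M \<Longrightarrow> P \<omega> \<Longrightarrow> \<not> Q \<omega> \<Longrightarrow> R \<omega>"
    and [measurable]: "Measurable.pred M Q" "Measurable.pred M R"
  shows "\<P>(\<omega> in M. P \<omega>) \<le> \<P>(\<omega> in M. Q \<omega>) + \<P>(\<omega> in M. R \<omega>)"
proof -
  have "\<P>(\<omega> in M. P \<omega>) \<le> measure M ({\<omega> \<in> space M. Q \<omega>} \<union> {\<omega> \<in> space M. R \<omega>})"
    using assms(1) by (intro finite_measure_mono) auto
  also have "\<dots> \<le> \<P>(\<omega> in M. Q \<omega>) + \<P>(\<omega> in M. R \<omega>)"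
    by (intro measure_Un_le) measurable
  finally show ?thesis .
qed

text \<open>Dominated convergence for the indicators of the events \<open>\<epsilon> < Y k\<close>,
  which at almost every point are eventually 0; the constant 1 dominates because the measure is
  finite.\<close>

lemma null_in_probability_AE:
  assumes meas: "\<And>k. Y k \<in> borel_measurable M"
    and lim: "AE \<omega> in M. (\<lambda>k. Y k \<omega>) \<longlonglongrightarrow> 0"
  shows "null_in_probability M Y"
  unfolding null_in_probability_def
proof (intro conjI allI impI meas)
  note meas[measurable]
  fix \<epsilon> :: real assume "0 < \<epsilon>"
  have "(\<lambda>k. \<integral>\<omega>. indicator {\<omega> \<in> space M. ennreal \<epsilon> < Y k \<omega>} \<omega> \<partial>M) \<longlonglongrightarrow> (\<integral>\<omega>. (0::real) \<partial>M)"
  proof (rule integral_dominated_convergence[where w = "\<lambda>_. 1"])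
    show "AE \<omega> in M. (\<lambda>k. indicator {\<omega> \<in> space M. ennreal \<epsilon> < Y k \<omega>} \<omega>) \<longlonglongrightarrow> (0::real)"
      using lim
    proof eventually_elim
      fix \<omega> assume "(\<lambda>k. Y k \<omega>) \<longlonglongrightarrow> 0"
      then have "\<forall>\<^sub>F k in sequentially. Y k \<omega> < ennreal \<epsilon>"
        using \<open>0 < \<epsilon>\<close> by (simp add: order_tendsto_iff)
      then have "\<forall>\<^sub>F k in sequentially. indicator {\<omega> \<in> space M. ennreal \<epsilon> < Y k \<omega>} \<omega> = (0::real)"
        by eventually_elim (auto simp: indicator_def)
      then show "(\<lambda>k. indicator {\<omega> \<in> space M. ennreal \<epsilon> < Y k \<omega>} \<omega>) \<longlonglongrightarrow> (0::real)"
        by (rule tendsto_eventually)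
    qed
  qed auto
  then show "(\<lambda>k. \<P>(\<omega> in M. ennreal \<epsilon> < Y k \<omega>)) \<longlonglongrightarrow> 0"
    by simp
qed

lemma null_in_probability_real_AE:
  assumes "\<And>k. Y k \<in> borel_measurable M"
    and "AE \<omega> in M. (\<lambda>k. Y k \<omega>) \<longlonglongrightarrow> (0::real)"
  shows "null_in_probability M (\<lambda>k \<omega>. ennreal \<bar>Y k \<omega>\<bar>)"
proof (rule null_in_probability_AE)
  show "AE \<omega> in M. (\<lambda>k. ennreal \<bar>Y k \<omega>\<bar>) \<longlonglongrightarrow> 0"
    using assms(2)
  proof eventually_elim
    case (elim \<omega>)
    then have "(\<lambda>k. ennreal \<bar>Y k \<omega>\<bar>) \<longlonglongrightarrow> ennreal \<bar>0\<bar>" by (intro tendsto_intros)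
    then show ?case by simp
  qed
qed (use assms in auto)

lemma null_in_probability_mono:
  assumes Z: "null_in_probability M Z"
    and meas: "\<And>k. Y k \<in> borel_measurable M"
    and le: "\<And>k. AE \<omega> in M. Y k \<omega> \<le> Z k \<omega>"
  shows "null_in_probability M Y"
  unfolding null_in_probability_def
proof (intro conjI allI impI meas)
  have [measurable]: "Z k \<in> borel_measurable M" for k
    using Z by (simp add: null_in_probability_def)
  note meas[measurable]
  fix \<epsilon> :: real assume "0 < \<epsilon>"
  show "(\<lambda>k. \<P>(\<omega> in M. ennreal \<epsilon> < Y k \<omega>)) \<longlonglongrightarrow> 0"
  proof (rule tendsto_sandwich[OF always_eventually always_eventually tendsto_const])
    show "(\<lambda>k. \<P>(\<omega> in M. ennreal \<epsilon> < Z k \<omega>)) \<longlonglongrightarrow> 0"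
      using Z \<open>0 < \<epsilon>\<close> by (simp add: null_in_probability_def)
    show "\<forall>k. \<P>(\<omega> in M. ennreal \<epsilon> < Y k \<omega>)
        \<le> \<P>(\<omega> in M. ennreal \<epsilon> < Z k \<omega>)"
    proof
      fix k
      show "\<P>(\<omega> in M. ennreal \<epsilon> < Y k \<omega>)
          \<le> \<P>(\<omega> in M. ennreal \<epsilon> < Z k \<omega>)"
      proof (rule finite_measure_mono_AE)
        show "AE \<omega> in M. \<omega> \<in> {\<omega> \<in> space M. ennreal \<epsilon> < Y k \<omega>} \<longrightarrow> \<omega> \<in> {\<omega> \<in> space M. ennreal \<epsilon> < Z k \<omega>}"
          using le[of k] by eventually_elim auto
      qed measurable
    qed
  qed simp
qed

lemma measure_sum_gt_le:
  fixes Y Z :: "'a \<Rightarrow> ennreal"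
  assumes [measurable]: "Y \<in> borel_measurable M" "Z \<in> borel_measurable M" and "0 < \<epsilon>"
  shows "\<P>(\<omega> in M. ennreal (2 * \<epsilon>) < Y \<omega> + Z \<omega>)
    \<le> \<P>(\<omega> in M. ennreal \<epsilon> < Y \<omega>) + \<P>(\<omega> in M. ennreal \<epsilon> < Z \<omega>)"
proof (rule measure_pred_disj_le)
  fix \<omega> assume *: "ennreal (2 * \<epsilon>) < Y \<omega> + Z \<omega>" "\<not> ennreal \<epsilon> < Y \<omega>"
  show "ennreal \<epsilon> < Z \<omega>"
  proof (rule ccontr)
    assume "\<not> ennreal \<epsilon> < Z \<omega>"
    with * have "Y \<omega> + Z \<omega> \<le> ennreal \<epsilon> + ennreal \<epsilon>"
      by (intro add_mono) (auto simp: not_less)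
    also have "\<dots> = ennreal (2 * \<epsilon>)"
      using \<open>0 < \<epsilon>\<close> by (simp flip: ennreal_plus)
    finally show False using * by (auto simp: not_less)
  qed
qed measurable

lemma null_in_probability_add:
  assumes Y: "null_in_probability M Y" and Z: "null_in_probability M Z"
  shows "null_in_probability M (\<lambda>k \<omega>. Y k \<omega> + Z k \<omega>)"
proof -
  have meas: "Y k \<in> borel_measurable M" "Z k \<in> borel_measurable M" for k
    using Y Z by (simp_all add: null_in_probability_def)
  show ?thesis
    unfolding null_in_probability_def
  proof (intro conjI allI impI)
    show "(\<lambda>\<omega>. Y k \<omega> + Z k \<omega>) \<in> borel_measurable M" for k
      using meas by measurable
    fix \<epsilon> :: real assume "0 < \<epsilon>"
    define \<delta> where "\<delta> = \<epsilon> / 2"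
    have "0 < \<delta>" "\<epsilon> = 2 * \<delta>" using \<open>0 < \<epsilon>\<close> by (simp_all add: \<delta>_def)
    have "(\<lambda>k. \<P>(\<omega> in M. ennreal \<delta> < Y k \<omega>) + \<P>(\<omega> in M. ennreal \<delta> < Z k \<omega>)) \<longlonglongrightarrow> 0 + 0"
      using Y Z \<open>0 < \<delta>\<close> by (intro tendsto_add) (simp_all add: null_in_probability_def)
    then show "(\<lambda>k. \<P>(\<omega> in M. ennreal \<epsilon> < Y k \<omega> + Z k \<omega>)) \<longlonglongrightarrow> 0"
      unfolding \<open>\<epsilon> = 2 * \<delta>\<close> add_0
      by (rule tendsto_sandwich[OF always_eventually always_eventually tendsto_const, rotated 2])
         (simp_all add: measure_sum_gt_le[OF meas \<open>0 < \<delta>\<close>])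
  qed
qed

lemma null_in_probability_zero: "null_in_probability M (\<lambda>k \<omega>. 0)"
  by (simp add: null_in_probability_def)

lemma null_in_probability_sum:
  assumes "\<And>i. i \<in> A \<Longrightarrow> null_in_probability M (Y i)"
  shows "null_in_probability M (\<lambda>k \<omega>. \<Sum>i\<in>A. Y i k \<omega>)"
  using assms
proof (induction A rule: infinite_finite_induct)
  case (insert x A)
  then show ?case using null_in_probability_add[of "Y x"] by simp
qed (simp_all add: null_in_probability_zero)

text \<open>Tightness bounds \<open>Z k\<close> by one \<open>C\<close> for all \<open>k\<close>,
  off events of probability at most \<open>e / 2\<close>; off these events the product exceeds
  \<open>\<epsilon>\<close> only if \<open>Y k\<close> exceeds \<open>\<epsilon> / C\<close>. A
  one-sided bound on \<open>Z\<close> is enough because \<open>ennreal\<close> sends negative values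
  to 0.\<close>

lemma null_in_probability_mult_tight:
  assumes Y: "null_in_probability M Y"
    and meas: "\<And>k. Z k \<in> borel_measurable M"
    and tight: "\<And>e::real. 0 < e \<Longrightarrow> \<exists>C>0. \<forall>k. \<P>(\<omega> in M. C < Z k \<omega>) \<le> e"
  shows "null_in_probability M (\<lambda>k \<omega>. ennreal (Z k \<omega>) * Y k \<omega>)"
proof -
  have [measurable]: "Y k \<in> borel_measurable M" for k
    using Y by (simp_all add: null_in_probability_def)
  note meas[measurable]
  show ?thesis
    unfolding null_in_probability_def
  proof (intro conjI allI impI)
    show "(\<lambda>\<omega>. ennreal (Z k \<omega>) * Y k \<omega>) \<in> borel_measurable M" for k
      by measurable
    fix \<epsilon> :: real assume "0 < \<epsilon>"
    show "(\<lambda>k. \<P>(\<omega> in M. ennreal \<epsilon> < ennreal (Z k \<omega>) * Y k \<omega>)) \<longlonglongrightarrow> 0"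
    proof (rule LIMSEQ_I)
      fix e :: real assume "0 < e"
      then obtain C where "C > 0" and C: "\<And>k. \<P>(\<omega> in M. C < Z k \<omega>) \<le> e / 2"
        using tight[of "e / 2"] by auto
      have "(\<lambda>k. \<P>(\<omega> in M. ennreal (\<epsilon> / C) < Y k \<omega>)) \<longlonglongrightarrow> 0"
        using Y \<open>0 < \<epsilon>\<close> \<open>C > 0\<close> by (simp add: null_in_probability_def)
      then obtain N where N: "\<And>k. k \<ge> N \<Longrightarrow> \<P>(\<omega> in M. ennreal (\<epsilon> / C) < Y k \<omega>) < e / 2"
        using LIMSEQ_D[of _ 0 "e / 2"] \<open>0 < e\<close> by fastforce
      show "\<exists>N. \<forall>k\<ge>N. norm (\<P>(\<omega> in M. ennreal \<epsilon> < ennreal (Z k \<omega>) * Y k \<omega>) - 0) < e"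
      proof (intro exI allI impI)
        fix k assume "k \<ge> N"
        have "\<P>(\<omega> in M. ennreal \<epsilon> < ennreal (Z k \<omega>) * Y k \<omega>)
          \<le> \<P>(\<omega> in M. C < Z k \<omega>) + \<P>(\<omega> in M. ennreal (\<epsilon> / C) < Y k \<omega>)"
        proof (rule measure_pred_disj_le)
          fix \<omega> assume *: "ennreal \<epsilon> < ennreal (Z k \<omega>) * Y k \<omega>" "\<not> C < Z k \<omega>"
          show "ennreal (\<epsilon> / C) < Y k \<omega>"
          proof (rule ccontr)
            assume "\<not> ennreal (\<epsilon> / C) < Y k \<omega>"
            with * have "ennreal (Z k \<omega>) * Y k \<omega> \<le> ennreal C * ennreal (\<epsilon> / C)"
              by (intro mult_mono ennreal_leI) (auto simp: not_less)
            also have "\<dots> = ennreal \<epsilon>"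
              using \<open>0 < \<epsilon>\<close> \<open>0 < C\<close> by (simp flip: ennreal_mult)
            finally show False using * by (auto simp: not_less)
          qed
        qed measurable
        also have "\<dots> < e" using C[of k] N[OF \<open>k \<ge> N\<close>] by simp
        finally show "norm (\<P>(\<omega> in M. ennreal \<epsilon> < ennreal (Z k \<omega>) * Y k \<omega>) - 0) < e"
          by simp
      qed
    qed
  qed
qed

text \<open>A single real variable is tight: \<open>Z / k\<close> tends to 0 pointwise, hence in
  probability, and any positive \<open>k\<close> for which \<open>1 < \<bar>Z / k\<bar>\<close> is
  unlikely enough serves as the bound \<open>C\<close>.\<close>

lemma null_in_probability_mult_fixed:
  assumes "null_in_probability M Y" and Z [measurable]: "Z \<in> borel_measurable M"
  shows "null_in_probability M (\<lambda>k \<omega>. ennreal (Z \<omega>) * Y k \<omega>)"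
proof (rule null_in_probability_mult_tight[OF assms(1)])
  fix e :: real assume "0 < e"
  have "null_in_probability M (\<lambda>k \<omega>. ennreal \<bar>Z \<omega> / real k\<bar>)"
  proof (rule null_in_probability_real_AE)
    show "AE \<omega> in M. (\<lambda>k. Z \<omega> / real k) \<longlonglongrightarrow> 0"
      by (simp add: lim_const_over_n)
  qed measurable
  then have "(\<lambda>k. \<P>(\<omega> in M. ennreal 1 < ennreal \<bar>Z \<omega> / real k\<bar>)) \<longlonglongrightarrow> 0"
    unfolding null_in_probability_def using zero_less_one by blast
  then have "\<forall>\<^sub>F k in sequentially. \<P>(\<omega> in M. ennreal 1 < ennreal \<bar>Z \<omega> / real k\<bar>) < e"
    using \<open>0 < e\<close> by (rule order_tendstoD)
  \<comment> \<open>Positivity is carried along because at \<open>k = 0\<close> the quotient is 0 by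
    convention, and the estimate would then say nothing about \<open>Z\<close>.\<close>
  then have "\<forall>\<^sub>F k in sequentially. \<P>(\<omega> in M. ennreal 1 < ennreal \<bar>Z \<omega> / real k\<bar>) < e \<and> 0 < k"
    using eventually_gt_at_top[of "0::nat"] by eventually_elim simp
  then obtain k where k: "\<P>(\<omega> in M. ennreal 1 < ennreal \<bar>Z \<omega> / real k\<bar>) < e" "0 < k"
    using eventually_happens trivial_limit_sequentially by blast
  have "\<P>(\<omega> in M. real k < Z \<omega>) \<le> \<P>(\<omega> in M. ennreal 1 < ennreal \<bar>Z \<omega> / real k\<bar>)"
    using \<open>0 < k\<close> by (intro finite_measure_mono) (auto simp: ennreal_less_iff less_divide_eq)
  with k show "\<exists>C>0. \<forall>k. \<P>(\<omega> in M. C < Z \<omega>) \<le> e"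
    by (intro exI[of _ "real k"]) auto
qed measurable

text \<open>Probabilities that tend to 0 without depending on \<open>k\<close> are 0, and the
  thresholds \<open>1 / (n + 1)\<close> exhaust the event \<open>Y > 0\<close>. This turns smallness
  along ever finer grids into an almost sure equality.\<close>

lemma null_in_probability_const_AE_0:
  assumes null: "null_in_probability M (\<lambda>k. Y)"
  shows "AE \<omega> in M. Y \<omega> = 0"
proof -
  have [measurable]: "Y \<in> borel_measurable M"
    using null by (simp add: null_in_probability_def)
  have *: "AE \<omega> in M. Y \<omega> \<le> ennreal (inverse (real (Suc n)))" for n
  proof -
    have "\<P>(\<omega> in M. ennreal (inverse (real (Suc n))) < Y \<omega>) = 0"
      using null by (simp add: null_in_probability_def LIMSEQ_const_iff)
    then show ?thesis
      by (subst AE_iff_measurable[OF _ refl]) (auto simp: not_le emeasure_eq_measure)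
  qed
  have "AE \<omega> in M. \<forall>n. Y \<omega> \<le> ennreal (inverse (real (Suc n)))"
    using * by (simp add: AE_all_countable)
  then show ?thesis
  proof eventually_elim
    case (elim \<omega>)
    have "(\<lambda>n. ennreal (inverse (real (Suc n)))) \<longlonglongrightarrow> ennreal 0"
      by (intro tendsto_ennrealI LIMSEQ_inverse_real_of_nat)
    then have "Y \<omega> \<le> ennreal 0"
      using elim by (intro LIMSEQ_le_const) auto
    then show ?case by simp
  qed
qed

end

section \<open>Transforms of independent steps\<close>

locale independent_steps = prob_space M for M :: "'a measure" +
  fixes J :: "nat set" and G :: "nat \<Rightarrow> 'a measure" and \<eta> :: "nat \<Rightarrow> 'a \<Rightarrow> real" and v :: "nat \<Rightarrow> real"
  assumes finite_J: "finite J"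
    and subalgebra_G: "\<And>j. j \<in> J \<Longrightarrow> subalgebra M (G j)"
    and mono_G: "\<And>i j. i \<in> J \<Longrightarrow> j \<in> J \<Longrightarrow> i < j \<Longrightarrow> sets (G i) \<subseteq> sets (G j)"
    and measurable_step: "\<And>j. j \<in> J \<Longrightarrow> \<eta> j \<in> borel_measurable M"
    and known_step: "\<And>i j. i \<in> J \<Longrightarrow> j \<in> J \<Longrightarrow> i < j \<Longrightarrow> \<eta> i \<in> borel_measurable (G j)"
    and indep_step: "\<And>j. j \<in> J \<Longrightarrow> indep_set (sets (G j)) {\<eta> j -` A \<inter> space M | A. A \<in> sets borel}"
    and integrable_step_square: "\<And>j. j \<in> J \<Longrightarrow> integrable M (\<lambda>\<omega>. (\<eta> j \<omega>)\<^sup>2)"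
    and expectation_step: "\<And>j. j \<in> J \<Longrightarrow> expectation (\<eta> j) = 0"
    and expectation_step_square: "\<And>j. j \<in> J \<Longrightarrow> expectation (\<lambda>\<omega>. (\<eta> j \<omega>)\<^sup>2) \<le> v j"
    and zero_step: "\<And>j \<omega>. j \<in> J \<Longrightarrow> v j = 0 \<Longrightarrow> \<omega> \<in> space M \<Longrightarrow> \<eta> j \<omega> = 0"
begin

lemma v_nonneg:
  assumes "j \<in> J"
  shows "0 \<le> v j"
proof -
  have "0 \<le> expectation (\<lambda>\<omega>. (\<eta> j \<omega>)\<^sup>2)" by simp
  then show ?thesis using expectation_step_square[OF assms] by linarith
qed

lemma space_G: "j \<in> J \<Longrightarrow> space (G j) = space M"
  using subalgebra_G[of j] by (simp add: subalgebra_def)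

lemma integrable_step: "j \<in> J \<Longrightarrow> integrable M (\<eta> j)"
  using square_integrable_imp_integrable[OF measurable_step integrable_step_square] by simp

lemma measurable_G_mono:
  assumes "i \<in> J" "j \<in> J" "i \<le> j" and f: "f \<in> borel_measurable (G i)"
  shows "f \<in> borel_measurable (G j)"
proof (cases "i = j")
  case False
  then have "subalgebra (G j) (G i)"
    using assms mono_G[of i j] by (simp add: subalgebra_def space_G)
  then show ?thesis using f by (rule measurable_from_subalg)
qed (use f in simp)

text \<open>The preimages under \<open>f\<close> generate a subset of \<open>G j\<close>, and those
  under \<open>h\<close> of the step lie among the preimages under the step itself, which already
  form a \<sigma>-algebra. So independence of the two given families passes to the
  variables.\<close>

lemma indep_var_step:
  assumes j: "j \<in> J" and f: "f \<in> borel_measurable (G j)" and h: "h \<in> borel_measurable borel"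
  shows "indep_var borel f borel (\<lambda>\<omega>. h (\<eta> j \<omega>))"
proof -
  have f': "f \<in> borel_measurable M"
    by (rule measurable_from_subalg[OF subalgebra_G[OF j] f])
  have "{f -` A \<inter> space M |A. A \<in> sets borel} \<subseteq> sets (G j)"
    using measurable_sets[OF f] by (auto simp: space_G[OF j])
  then have 1: "sigma_sets (space M) {f -` A \<inter> space M |A. A \<in> sets borel} \<subseteq> sets (G j)"
    using sets.sigma_sets_subset[of _ "G j"] by (simp add: space_G[OF j])
  have eq: "{\<eta> j -` A \<inter> space M | A. A \<in> sets borel} = sets (vimage_algebra (space M) (\<eta> j) borel)"
    by (rule sets_vimage_algebra2[symmetric]) simp
  have "(\<lambda>\<omega>. h (\<eta> j \<omega>)) -` A \<inter> space M = \<eta> j -` (h -` A) \<inter> space M" for A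
    by auto
  moreover have "h -` A \<in> sets borel" if "A \<in> sets borel" for A
    using measurable_sets[OF h that] by simp
  ultimately have "{(\<lambda>\<omega>. h (\<eta> j \<omega>)) -` A \<inter> space M |A. A \<in> sets borel}
      \<subseteq> {\<eta> j -` A \<inter> space M | A. A \<in> sets borel}"
    by blast
  then have 2: "sigma_sets (space M) {(\<lambda>\<omega>. h (\<eta> j \<omega>)) -` A \<inter> space M |A. A \<in> sets borel}
      \<subseteq> {\<eta> j -` A \<inter> space M | A. A \<in> sets borel}"
    using sets.sigma_sets_subset[of _ "vimage_algebra (space M) (\<eta> j) borel"] by (simp add: eq)
  show ?thesis
    unfolding indep_var_eq
  proof (intro conjI f' measurable_compose[OF measurable_step[OF j] h])
    show "indep_set (sigma_sets (space M) {f -` A \<inter> space M |A. A \<in> sets borel})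
       (sigma_sets (space M) {(\<lambda>\<omega>. h (\<eta> j \<omega>)) -` A \<inter> space M |A. A \<in> sets borel})"
    proof (rule indep_setI)
      have ev: "sets (G j) \<subseteq> events" "{\<eta> j -` A \<inter> space M | A. A \<in> sets borel} \<subseteq> events"
        using indep_step[OF j] unfolding indep_sets2_eq by auto
      show "sigma_sets (space M) {f -` A \<inter> space M |A. A \<in> sets borel} \<subseteq> events"
        by (rule order_trans[OF 1 ev(1)])
      show "sigma_sets (space M) {(\<lambda>\<omega>. h (\<eta> j \<omega>)) -` A \<inter> space M |A. A \<in> sets borel} \<subseteq> events"
        by (rule order_trans[OF 2 ev(2)])
      show "prob (a \<inter> b) = prob a * prob b"
        if "a \<in> sigma_sets (space M) {f -` A \<inter> space M |A. A \<in> sets borel}"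
          "b \<in> sigma_sets (space M) {(\<lambda>\<omega>. h (\<eta> j \<omega>)) -` A \<inter> space M |A. A \<in> sets borel}" for a b
        by (rule indep_setD[OF indep_step[OF j] subsetD[OF 1 that(1)] subsetD[OF 2 that(2)]])
    qed
  qed
qed

text \<open>Orthogonality of increments: for \<open>i < j\<close> the factor
  \<open>\<xi> i * \<eta> i * \<xi> j\<close> is measurable for \<open>G j\<close>, hence
  independent of the centred \<open>\<eta> j\<close>, and the mixed term has mean 0. On the diagonal
  the expectation of the product of squares factors. Boundedness of the weights provides
  integrability.\<close>

lemma
  assumes K: "K \<subseteq> J"
    and \<xi>: "\<And>j. j \<in> K \<Longrightarrow> \<xi> j \<in> borel_measurable (G j)"
    and bound: "\<And>j \<omega>. j \<in> K \<Longrightarrow> \<omega> \<in> space M \<Longrightarrow> \<bar>\<xi> j \<omega>\<bar> \<le> C j"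
  shows integrable_bounded_transform_square: "integrable M (\<lambda>\<omega>. (\<Sum>j\<in>K. \<xi> j \<omega> * \<eta> j \<omega>)\<^sup>2)"
    and expectation_bounded_transform_square:
      "expectation (\<lambda>\<omega>. (\<Sum>j\<in>K. \<xi> j \<omega> * \<eta> j \<omega>)\<^sup>2) \<le> expectation (\<lambda>\<omega>. \<Sum>j\<in>K. (\<xi> j \<omega>)\<^sup>2 * v j)"
proof -
  have fin: "finite K" using K finite_J by (rule finite_subset)
  have \<xi>M: "\<xi> j \<in> borel_measurable M" if "j \<in> K" for j
    using measurable_from_subalg[OF subalgebra_G \<xi>] that K by blast
  have sq: "integrable M (\<lambda>\<omega>. (\<xi> j \<omega>)\<^sup>2)" if "j \<in> K" for j
  proof (rule integrable_const_bound[where B = "(C j)\<^sup>2"])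
    show "AE \<omega> in M. norm ((\<xi> j \<omega>)\<^sup>2) \<le> (C j)\<^sup>2"
      using bound[OF that] by (intro AE_I2) (simp add: abs_le_square_iff[symmetric] order_trans[OF _ abs_ge_self])
  qed (use \<xi>M[OF that] in measurable)
  have diag: "integrable M (\<lambda>\<omega>. (\<xi> j \<omega> * \<eta> j \<omega>)\<^sup>2)"
    "expectation (\<lambda>\<omega>. (\<xi> j \<omega> * \<eta> j \<omega>)\<^sup>2) \<le> expectation (\<lambda>\<omega>. (\<xi> j \<omega>)\<^sup>2 * v j)" if "j \<in> K" for j
  proof -
    have j: "j \<in> J" using that K by blast
    have ind: "indep_var borel (\<lambda>\<omega>. (\<xi> j \<omega>)\<^sup>2) borel (\<lambda>\<omega>. (\<eta> j \<omega>)\<^sup>2)"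
    proof (rule indep_var_step[OF j])
      show "(\<lambda>x::real. x\<^sup>2) \<in> borel_measurable borel" by measurable
    qed (use \<xi>[OF that] in measurable)
    show "integrable M (\<lambda>\<omega>. (\<xi> j \<omega> * \<eta> j \<omega>)\<^sup>2)"
      unfolding power_mult_distrib
      by (rule indep_var_integrable[OF ind sq[OF that] integrable_step_square[OF j]])
    have "expectation (\<lambda>\<omega>. (\<xi> j \<omega> * \<eta> j \<omega>)\<^sup>2) = expectation (\<lambda>\<omega>. (\<xi> j \<omega>)\<^sup>2) * expectation (\<lambda>\<omega>. (\<eta> j \<omega>)\<^sup>2)"
      unfolding power_mult_distrib
      by (rule indep_var_lebesgue_integral[OF ind sq[OF that] integrable_step_square[OF j]])
    also have "\<dots> \<le> expectation (\<lambda>\<omega>. (\<xi> j \<omega>)\<^sup>2) * v j"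
      by (intro mult_left_mono expectation_step_square[OF j]) simp
    finally show "expectation (\<lambda>\<omega>. (\<xi> j \<omega> * \<eta> j \<omega>)\<^sup>2) \<le> expectation (\<lambda>\<omega>. (\<xi> j \<omega>)\<^sup>2 * v j)"
      by simp
  qed
  have off_diag: "integrable M (\<lambda>\<omega>. (\<xi> i \<omega> * \<eta> i \<omega>) * (\<xi> j \<omega> * \<eta> j \<omega>)) \<and>
      expectation (\<lambda>\<omega>. (\<xi> i \<omega> * \<eta> i \<omega>) * (\<xi> j \<omega> * \<eta> j \<omega>)) = 0"
    if "i \<in> K" "j \<in> K" "i < j" for i j
  proof -
    have J: "i \<in> J" "j \<in> J" using that K by auto
    have "\<xi> i \<in> borel_measurable (G j)"
      by (rule measurable_G_mono[OF J _ \<xi>]) (use that in auto)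
    then have mG: "(\<lambda>\<omega>. \<xi> i \<omega> * \<eta> i \<omega> * \<xi> j \<omega>) \<in> borel_measurable (G j)"
      using known_step[OF J \<open>i < j\<close>] \<xi>[OF \<open>j \<in> K\<close>] by measurable
    have ind: "indep_var borel (\<lambda>\<omega>. \<xi> i \<omega> * \<eta> i \<omega> * \<xi> j \<omega>) borel (\<eta> j)"
      using indep_var_step[OF J(2) mG, of "\<lambda>x. x"] by simp
    have int: "integrable M (\<lambda>\<omega>. \<xi> i \<omega> * \<eta> i \<omega> * \<xi> j \<omega>)"
    proof (rule Bochner_Integration.integrable_bound)
      show "integrable M (\<lambda>\<omega>. (C i * C j) * \<eta> i \<omega>)"
        by (intro integrable_mult_right integrable_step J)
      show "(\<lambda>\<omega>. \<xi> i \<omega> * \<eta> i \<omega> * \<xi> j \<omega>) \<in> borel_measurable M"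
        using \<xi>M that measurable_step[OF J(1)] by measurable
      show "AE \<omega> in M. norm (\<xi> i \<omega> * \<eta> i \<omega> * \<xi> j \<omega>) \<le> norm (C i * C j * \<eta> i \<omega>)"
      proof (rule AE_I2)
        fix \<omega> assume \<omega>: "\<omega> \<in> space M"
        have "\<bar>\<xi> i \<omega>\<bar> * \<bar>\<xi> j \<omega>\<bar> \<le> \<bar>C i\<bar> * \<bar>C j\<bar>"
          using bound[OF \<open>i \<in> K\<close> \<omega>] bound[OF \<open>j \<in> K\<close> \<omega>] by (intro mult_mono) auto
        then have "\<bar>\<xi> i \<omega>\<bar> * \<bar>\<xi> j \<omega>\<bar> * \<bar>\<eta> i \<omega>\<bar> \<le> \<bar>C i\<bar> * \<bar>C j\<bar> * \<bar>\<eta> i \<omega>\<bar>"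
          by (intro mult_right_mono) auto
        then show "norm (\<xi> i \<omega> * \<eta> i \<omega> * \<xi> j \<omega>) \<le> norm (C i * C j * \<eta> i \<omega>)"
          by (simp add: abs_mult ac_simps)
      qed
    qed
    have "integrable M (\<lambda>\<omega>. \<xi> i \<omega> * \<eta> i \<omega> * \<xi> j \<omega> * \<eta> j \<omega>)"
      by (rule indep_var_integrable[OF ind int integrable_step[OF J(2)]])
    moreover have "expectation (\<lambda>\<omega>. \<xi> i \<omega> * \<eta> i \<omega> * \<xi> j \<omega> * \<eta> j \<omega>) = 0"
      using indep_var_lebesgue_integral[OF ind int integrable_step[OF J(2)]] expectation_step[OF J(2)] by simp
    ultimately show ?thesis by (simp add: mult.assoc)
  qed
  have products: "integrable M (\<lambda>\<omega>. (\<xi> i \<omega> * \<eta> i \<omega>) * (\<xi> j \<omega> * \<eta> j \<omega>))"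
    "expectation (\<lambda>\<omega>. (\<xi> i \<omega> * \<eta> i \<omega>) * (\<xi> j \<omega> * \<eta> j \<omega>))
      = (if i = j then expectation (\<lambda>\<omega>. (\<xi> i \<omega> * \<eta> i \<omega>)\<^sup>2) else 0)"
    if "i \<in> K" "j \<in> K" for i j
    using off_diag[of i j] off_diag[of j i] diag(1)[of i] that
    by (cases i j rule: linorder_cases; simp add: power2_eq_square mult.commute)+
  have square: "(\<Sum>j\<in>K. \<xi> j \<omega> * \<eta> j \<omega>)\<^sup>2 = (\<Sum>i\<in>K. \<Sum>j\<in>K. (\<xi> i \<omega> * \<eta> i \<omega>) * (\<xi> j \<omega> * \<eta> j \<omega>))" for \<omega>
    by (simp add: power2_eq_square sum_product)
  show "integrable M (\<lambda>\<omega>. (\<Sum>j\<in>K. \<xi> j \<omega> * \<eta> j \<omega>)\<^sup>2)"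
    unfolding square by (intro Bochner_Integration.integrable_sum products)
  have "expectation (\<lambda>\<omega>. (\<Sum>j\<in>K. \<xi> j \<omega> * \<eta> j \<omega>)\<^sup>2)
      = (\<Sum>i\<in>K. \<Sum>j\<in>K. expectation (\<lambda>\<omega>. (\<xi> i \<omega> * \<eta> i \<omega>) * (\<xi> j \<omega> * \<eta> j \<omega>)))"
    unfolding square using products(1)
    by (subst Bochner_Integration.integral_sum, fastforce intro!: Bochner_Integration.integrable_sum)
       (intro sum.cong refl Bochner_Integration.integral_sum, blast)
  also have "\<dots> = (\<Sum>i\<in>K. expectation (\<lambda>\<omega>. (\<xi> i \<omega> * \<eta> i \<omega>)\<^sup>2))"
    using fin by (intro sum.cong refl) (simp add: products(2) cong: sum.cong)
  also have "\<dots> \<le> (\<Sum>i\<in>K. expectation (\<lambda>\<omega>. (\<xi> i \<omega>)\<^sup>2 * v i))"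
    by (intro sum_mono diag(2))
  also have "\<dots> = expectation (\<lambda>\<omega>. \<Sum>j\<in>K. (\<xi> j \<omega>)\<^sup>2 * v j)"
    by (intro Bochner_Integration.integral_sum[symmetric] integrable_mult_left sq)
  finally show "expectation (\<lambda>\<omega>. (\<Sum>j\<in>K. \<xi> j \<omega> * \<eta> j \<omega>)\<^sup>2) \<le> expectation (\<lambda>\<omega>. \<Sum>j\<in>K. (\<xi> j \<omega>)\<^sup>2 * v j)" .
qed

text \<open>The weights are cut off as soon as their accumulated variance exceeds \<open>\<delta>\<close>. This replaces a
  stopping time and needs no integrability of \<open>\<xi>\<close>.\<close>

lemma transform_estimate:
  fixes \<xi> :: "nat \<Rightarrow> 'a \<Rightarrow> real" and blk :: "nat \<Rightarrow> nat"
  assumes \<xi>: "\<And>j. j \<in> J \<Longrightarrow> \<xi> j \<in> borel_measurable (G j)"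
    and "0 < \<epsilon>" "0 < \<delta>"
  shows "\<P>(\<omega> in M. \<epsilon> < L2_set (\<lambda>b. \<Sum>j\<in>{j\<in>J. blk j = b}. \<xi> j \<omega> * \<eta> j \<omega>) A)
    \<le> \<delta> / \<epsilon>\<^sup>2 + \<P>(\<omega> in M. \<delta> < (\<Sum>j\<in>J. (\<xi> j \<omega>)\<^sup>2 * v j))"
proof (cases "finite A")
  case True
  \<comment> \<open>The accumulated variance includes index \<open>j\<close> itself. Since
    \<open>v\<close> is deterministic, \<open>q j\<close> is still measurable for
    \<open>G j\<close>, so the cut-off is decided before step \<open>j\<close> is seen.\<close>
  define q where "q j \<omega> = (\<Sum>l\<in>{l\<in>J. l \<le> j}. (\<xi> l \<omega>)\<^sup>2 * v l)" for j \<omega>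
  \<comment> \<open>A surviving weight satisfies
    \<open>(\<xi> j)\<^sup>2 * v j \<le> \<delta>\<close> and has \<open>0 < v j\<close>, which
    gives the deterministic bound \<open>sqrt (\<delta> / v j)\<close> demanded by the bounded
    case.\<close>
  define \<xi>' where "\<xi>' j \<omega> = (if q j \<omega> \<le> \<delta> \<and> 0 < v j then \<xi> j \<omega> else 0)" for j \<omega>
  define S where "S b \<omega> = (\<Sum>j\<in>{j\<in>J. blk j = b}. \<xi>' j \<omega> * \<eta> j \<omega>)" for b \<omega>
  have \<xi>M: "\<xi> j \<in> borel_measurable M" if "j \<in> J" for j
    using measurable_from_subalg[OF subalgebra_G \<xi>] that by blast
  have q_G: "q j \<in> borel_measurable (G j)" if "j \<in> J" for j
    unfolding q_def
    using that by (intro borel_measurable_sum borel_measurable_times borel_measurable_power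
        borel_measurable_const) (auto intro: measurable_G_mono \<xi>)
  have \<xi>'_G: "\<xi>' j \<in> borel_measurable (G j)" if "j \<in> J" for j
    unfolding \<xi>'_def using q_G[OF that] \<xi>[OF that] by measurable
  have step_le: "(\<xi> j \<omega>)\<^sup>2 * v j \<le> q j \<omega>" if "j \<in> J" for j \<omega>
    unfolding q_def using that finite_J by (intro member_le_sum) (auto simp: v_nonneg)
  have bounded: "\<bar>\<xi>' j \<omega>\<bar> \<le> sqrt (\<delta> / v j)" if "j \<in> J" for j \<omega>
    using step_le[OF that, of \<omega>] \<open>0 < \<delta>\<close> v_nonneg[OF that]
    by (auto simp: \<xi>'_def real_le_rsqrt le_divide_eq)
  have total: "(\<Sum>j\<in>J. (\<xi>' j \<omega>)\<^sup>2 * v j) \<le> \<delta>" for \<omega>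
  proof (cases "{j\<in>J. q j \<omega> \<le> \<delta>} = {}")
    case True
    then have "\<xi>' j \<omega> = 0" if "j \<in> J" for j
      using that by (auto simp: \<xi>'_def)
    then show ?thesis using \<open>0 < \<delta>\<close> by simp
  next
    case False
    define p where "p = Max {j\<in>J. q j \<omega> \<le> \<delta>}"
    have "p \<in> {j\<in>J. q j \<omega> \<le> \<delta>}"
      unfolding p_def using False finite_J by (intro Max_in) auto
    then have p: "p \<in> J" "q p \<omega> \<le> \<delta>" by auto
    \<comment> \<open>Beyond \<open>p\<close>, the last index whose accumulated variance stays
      within \<open>\<delta>\<close>, every weight is cut off; up to \<open>p\<close> the sum is
      dominated by the one defining \<open>q p\<close>.\<close>
    have "(\<Sum>j\<in>J. (\<xi>' j \<omega>)\<^sup>2 * v j) = (\<Sum>j\<in>{j\<in>J. j \<le> p}. (\<xi>' j \<omega>)\<^sup>2 * v j)"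
      using finite_J by (intro sum.mono_neutral_right) (auto simp: \<xi>'_def p_def)
    also have "\<dots> \<le> q p \<omega>"
      unfolding q_def by (intro sum_mono) (auto simp: \<xi>'_def v_nonneg)
    finally show ?thesis using p by simp
  qed
  have agree: "S b \<omega> = (\<Sum>j\<in>{j\<in>J. blk j = b}. \<xi> j \<omega> * \<eta> j \<omega>)"
    if "(\<Sum>j\<in>J. (\<xi> j \<omega>)\<^sup>2 * v j) \<le> \<delta>" "\<omega> \<in> space M" for b \<omega>
    unfolding S_def
  proof (intro sum.cong refl)
    fix j assume "j \<in> {j \<in> J. blk j = b}"
    then have j: "j \<in> J" by simp
    have "q j \<omega> \<le> (\<Sum>j\<in>J. (\<xi> j \<omega>)\<^sup>2 * v j)"
      unfolding q_def using finite_J by (intro sum_mono2) (auto simp: v_nonneg)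
    \<comment> \<open>The weight may have been replaced by 0 where \<open>v j = 0\<close>; there
      \<open>zero_step\<close> makes the step vanish, and the products agree all the same.\<close>
    then have "\<xi>' j \<omega> = \<xi> j \<omega> \<or> v j = 0"
      using that v_nonneg[OF j] by (auto simp: \<xi>'_def)
    then show "\<xi>' j \<omega> * \<eta> j \<omega> = \<xi> j \<omega> * \<eta> j \<omega>"
      using zero_step[OF j] that by auto
  qed
  have S_M [measurable]: "S b \<in> borel_measurable M" for b
    unfolding S_def
    by (intro borel_measurable_sum borel_measurable_times)
       (auto intro: measurable_from_subalg[OF subalgebra_G \<xi>'_G] measurable_step)
  have S_int: "integrable M (\<lambda>\<omega>. (S b \<omega>)\<^sup>2)" for b
    unfolding S_def by (rule integrable_bounded_transform_square[where C = "\<lambda>j. sqrt (\<delta> / v j)"])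
      (auto intro: \<xi>'_G bounded)
  have S_exp: "expectation (\<lambda>\<omega>. (S b \<omega>)\<^sup>2) \<le> expectation (\<lambda>\<omega>. \<Sum>j\<in>{j\<in>J. blk j = b}. (\<xi>' j \<omega>)\<^sup>2 * v j)" for b
    unfolding S_def by (rule expectation_bounded_transform_square[where C = "\<lambda>j. sqrt (\<delta> / v j)"])
      (auto intro: \<xi>'_G bounded)
  have \<xi>'_int: "integrable M (\<lambda>\<omega>. (\<xi>' j \<omega>)\<^sup>2 * v j)" if "j \<in> J" for j
  proof (rule integrable_const_bound[where B = \<delta>])
    have "(\<xi>' j \<omega>)\<^sup>2 * v j \<le> \<delta>" for \<omega>
      using total[of \<omega>] member_le_sum[OF that, of "\<lambda>j. (\<xi>' j \<omega>)\<^sup>2 * v j"] finite_J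
      by (fastforce simp: v_nonneg)
    then show "AE \<omega> in M. norm ((\<xi>' j \<omega>)\<^sup>2 * v j) \<le> \<delta>"
      using v_nonneg[OF that] by simp
  qed (use measurable_from_subalg[OF subalgebra_G \<xi>'_G] that in measurable)
  have "expectation (\<lambda>\<omega>. \<Sum>b\<in>A. (S b \<omega>)\<^sup>2) = (\<Sum>b\<in>A. expectation (\<lambda>\<omega>. (S b \<omega>)\<^sup>2))"
    using S_int by simp
  also have "\<dots> \<le> (\<Sum>b\<in>A. expectation (\<lambda>\<omega>. \<Sum>j\<in>{j\<in>J. blk j = b}. (\<xi>' j \<omega>)\<^sup>2 * v j))"
    by (intro sum_mono S_exp)
  also have "\<dots> = expectation (\<lambda>\<omega>. \<Sum>b\<in>A. \<Sum>j\<in>{j\<in>J. blk j = b}. (\<xi>' j \<omega>)\<^sup>2 * v j)"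
    by (rule Bochner_Integration.integral_sum[symmetric])
       (auto intro!: Bochner_Integration.integrable_sum \<xi>'_int)
  \<comment> \<open>Blocks with different labels are disjoint, so together they use each index at
    most once and share the single variance budget \<open>\<delta>\<close>.\<close>
  also have "\<dots> \<le> expectation (\<lambda>\<omega>. \<delta>)"
  proof (rule integral_mono)
    fix \<omega>
    have "(\<Sum>b\<in>A. \<Sum>j\<in>{j\<in>J. blk j = b}. (\<xi>' j \<omega>)\<^sup>2 * v j)
      = (\<Sum>b\<in>A. \<Sum>j\<in>{j\<in>{j\<in>J. blk j \<in> A}. blk j = b}. (\<xi>' j \<omega>)\<^sup>2 * v j)"
      by (intro sum.cong) auto
    also have "\<dots> = (\<Sum>j\<in>{j\<in>J. blk j \<in> A}. (\<xi>' j \<omega>)\<^sup>2 * v j)"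
      using finite_J True by (intro sum.group) auto
    also have "\<dots> \<le> (\<Sum>j\<in>J. (\<xi>' j \<omega>)\<^sup>2 * v j)"
      using finite_J by (intro sum_mono2) (auto simp: v_nonneg)
    finally show "(\<Sum>b\<in>A. \<Sum>j\<in>{j\<in>J. blk j = b}. (\<xi>' j \<omega>)\<^sup>2 * v j) \<le> \<delta>"
      using total[of \<omega>] by linarith
  qed (auto intro!: Bochner_Integration.integrable_sum \<xi>'_int)
  finally have exp_le: "expectation (\<lambda>\<omega>. \<Sum>b\<in>A. (S b \<omega>)\<^sup>2) \<le> \<delta>"
    by (simp add: prob_space)
  have sum_M [measurable]: "(\<lambda>\<omega>. \<Sum>j\<in>J. (\<xi> j \<omega>)\<^sup>2 * v j) \<in> borel_measurable M"
    by (intro borel_measurable_sum borel_measurable_times borel_measurable_power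
        borel_measurable_const \<xi>M)
  have "\<P>(\<omega> in M. \<epsilon> < L2_set (\<lambda>b. \<Sum>j\<in>{j\<in>J. blk j = b}. \<xi> j \<omega> * \<eta> j \<omega>) A)
    \<le> \<P>(\<omega> in M. \<epsilon>\<^sup>2 \<le> (\<Sum>b\<in>A. (S b \<omega>)\<^sup>2)) + \<P>(\<omega> in M. \<delta> < (\<Sum>j\<in>J. (\<xi> j \<omega>)\<^sup>2 * v j))"
  proof (rule measure_pred_disj_le)
    fix \<omega> assume *: "\<omega> \<in> space M" "\<epsilon> < L2_set (\<lambda>b. \<Sum>j\<in>{j\<in>J. blk j = b}. \<xi> j \<omega> * \<eta> j \<omega>) A"
      "\<not> \<epsilon>\<^sup>2 \<le> (\<Sum>b\<in>A. (S b \<omega>)\<^sup>2)"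
    have "sqrt (\<Sum>b\<in>A. (S b \<omega>)\<^sup>2) < \<epsilon>"
      using *(3) \<open>0 < \<epsilon>\<close> by (simp add: real_less_lsqrt)
    then show "\<delta> < (\<Sum>j\<in>J. (\<xi> j \<omega>)\<^sup>2 * v j)"
      using agree[OF _ *(1)] *(2) by (force simp: L2_set_def not_less[symmetric])
  qed measurable
  also have "\<P>(\<omega> in M. \<epsilon>\<^sup>2 \<le> (\<Sum>b\<in>A. (S b \<omega>)\<^sup>2))
      \<le> expectation (\<lambda>\<omega>. \<Sum>b\<in>A. (S b \<omega>)\<^sup>2) / \<epsilon>\<^sup>2"
    using S_int \<open>0 < \<epsilon>\<close>
    by (intro integral_Markov_inequality_measure[where A = "{}"]) (auto simp: sum_nonneg)
  also have "\<dots> \<le> \<delta> / \<epsilon>\<^sup>2"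
    by (intro divide_right_mono exp_le) simp
  finally show ?thesis by simp
next
  \<comment> \<open>Over an infinite index set \<open>L2_set\<close> is 0 by convention, so the
    event on the left is empty.\<close>
  case False
  then show ?thesis using assms by (simp add: L2_set_def)
qed

end

lemma null_in_probability_transform:
  fixes \<xi> :: "nat \<Rightarrow> nat \<Rightarrow> 'a \<Rightarrow> real" and blk :: "nat \<Rightarrow> nat \<Rightarrow> nat"
  assumes steps: "\<And>k. independent_steps M (J k) (G k) (\<eta> k) (v k)"
    and \<xi>: "\<And>k j. j \<in> J k \<Longrightarrow> \<xi> k j \<in> borel_measurable (G k j)"
    and null: "null_in_probability M (\<lambda>k \<omega>. ennreal (\<Sum>j\<in>J k. (\<xi> k j \<omega>)\<^sup>2 * v k j))"
  shows "null_in_probability M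
    (\<lambda>k \<omega>. ennreal (L2_set (\<lambda>b. \<Sum>j\<in>{j\<in>J k. blk k j = b}. \<xi> k j \<omega> * \<eta> k j \<omega>) (A k)))"
  unfolding null_in_probability_def
proof (intro conjI allI impI)
  fix k
  interpret independent_steps M "J k" "G k" "\<eta> k" "v k" by fact
  have [measurable]: "(\<lambda>\<omega>. \<Sum>j\<in>{j\<in>J k. blk k j = b}. \<xi> k j \<omega> * \<eta> k j \<omega>) \<in> borel_measurable M" for b
    by (intro borel_measurable_sum borel_measurable_times)
       (auto intro: measurable_from_subalg[OF subalgebra_G \<xi>] measurable_step)
  show "(\<lambda>\<omega>. ennreal (L2_set (\<lambda>b. \<Sum>j\<in>{j\<in>J k. blk k j = b}. \<xi> k j \<omega> * \<eta> k j \<omega>) (A k))) \<in> borel_measurable M"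
    unfolding L2_set_def by measurable
next
  fix \<epsilon> :: real assume \<epsilon>: "0 < \<epsilon>"
  let ?P = "\<lambda>k. \<P>(\<omega> in M. ennreal \<epsilon> <
      ennreal (L2_set (\<lambda>b. \<Sum>j\<in>{j\<in>J k. blk k j = b}. \<xi> k j \<omega> * \<eta> k j \<omega>) (A k)))"
  show "?P \<longlonglongrightarrow> 0"
  proof (rule LIMSEQ_I)
    fix e :: real assume "0 < e"
    \<comment> \<open>Chosen so that the term \<open>\<delta> / \<epsilon>\<^sup>2\<close> of the
      estimate is half of the tolerance; the hypothesis makes the remaining probability smaller than
      the other half.\<close>
    define \<delta> where "\<delta> = e / 2 * \<epsilon>\<^sup>2"
    have \<delta>: "0 < \<delta>" "\<delta> / \<epsilon>\<^sup>2 = e / 2" using \<open>0 < e\<close> \<epsilon> by (simp_all add: \<delta>_def)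
    have "(\<lambda>k. \<P>(\<omega> in M. ennreal \<delta> < ennreal (\<Sum>j\<in>J k. (\<xi> k j \<omega>)\<^sup>2 * v k j))) \<longlonglongrightarrow> 0"
      using null \<delta>(1) by (simp add: null_in_probability_def)
    then obtain N where N: "\<And>k. k \<ge> N \<Longrightarrow>
        \<P>(\<omega> in M. ennreal \<delta> < ennreal (\<Sum>j\<in>J k. (\<xi> k j \<omega>)\<^sup>2 * v k j)) < e / 2"
      using LIMSEQ_D[of _ 0 "e / 2"] \<open>0 < e\<close> by fastforce
    show "\<exists>N. \<forall>k\<ge>N. norm (?P k - 0) < e"
    proof (intro exI allI impI)
      fix k assume "k \<ge> N"
      interpret independent_steps M "J k" "G k" "\<eta> k" "v k" by (rule steps)
      show "norm (?P k - 0) < e"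
        using transform_estimate[OF \<xi>[of _ k] \<epsilon> \<delta>(1), of "blk k" "A k"] N[OF \<open>k \<ge> N\<close>] \<epsilon> \<delta>
        by (simp add: ennreal_less_iff)
    qed
  qed
qed

section \<open>Increments of Brownian motion\<close>

text \<open>Exponential tilting: completing the square shows that the centred density times
  \<open>exp (c * y)\<close> is \<open>exp (c\<^sup>2 * \<tau>\<^sup>2 / 2)\<close> times the normal
  density with mean \<open>c * \<tau>\<^sup>2\<close> and the same deviation. The three integrals
  are then its moments of order 0, 1 and 2.\<close>

lemma has_bochner_integral_normal_exp:
  fixes c \<tau> :: real
  assumes "0 < \<tau>"
  shows "has_bochner_integral lborel (\<lambda>y. normal_density 0 \<tau> y * exp (c * y)) (exp (c\<^sup>2 * \<tau>\<^sup>2 / 2))"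
    and "has_bochner_integral lborel (\<lambda>y. normal_density 0 \<tau> y * (y * exp (c * y)))
      (c * \<tau>\<^sup>2 * exp (c\<^sup>2 * \<tau>\<^sup>2 / 2))"
    and "has_bochner_integral lborel (\<lambda>y. normal_density 0 \<tau> y * (y\<^sup>2 * exp (c * y)))
      ((\<tau>\<^sup>2 + (c * \<tau>\<^sup>2)\<^sup>2) * exp (c\<^sup>2 * \<tau>\<^sup>2 / 2))"
proof -
  define \<mu> where "\<mu> = c * \<tau>\<^sup>2"
  have "- (y\<^sup>2) / (2 * \<tau>\<^sup>2) + c * y = c\<^sup>2 * \<tau>\<^sup>2 / 2 + - ((y - \<mu>)\<^sup>2) / (2 * \<tau>\<^sup>2)" for y
    using assms by (simp add: \<mu>_def divide_simps) (simp add: power2_eq_square power4_eq_xxxx algebra_simps)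
  then have "exp (- (y\<^sup>2) / (2 * \<tau>\<^sup>2)) * exp (c * y)
      = exp (c\<^sup>2 * \<tau>\<^sup>2 / 2) * exp (- ((y - \<mu>)\<^sup>2) / (2 * \<tau>\<^sup>2))" for y
    by (simp only: exp_add[symmetric])
  then have tilt: "normal_density 0 \<tau> y * exp (c * y) = exp (c\<^sup>2 * \<tau>\<^sup>2 / 2) * normal_density \<mu> \<tau> y" for y
    by (simp add: normal_density_def)
  have 0: "has_bochner_integral lborel (\<lambda>y. normal_density \<mu> \<tau> y) 1"
    using normal_moment_even[OF assms, of \<mu> 0] by simp
  have 1: "has_bochner_integral lborel (\<lambda>y. normal_density \<mu> \<tau> y * y) \<mu>"
    by (rule normal_moment_nz_1[OF assms])
  have "has_bochner_integral lborel (\<lambda>y. normal_density \<mu> \<tau> y * (y - \<mu>)\<^sup>2) (\<tau>\<^sup>2)"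
    using normal_moment_even[OF assms, of \<mu> 1] by simp
  then have "has_bochner_integral lborel
      (\<lambda>y. normal_density \<mu> \<tau> y * (y - \<mu>)\<^sup>2 + (2 * \<mu>) * (normal_density \<mu> \<tau> y * y) - \<mu>\<^sup>2 * normal_density \<mu> \<tau> y)
      (\<tau>\<^sup>2 + (2 * \<mu>) * \<mu> - \<mu>\<^sup>2 * 1)"
    by (intro has_bochner_integral_add has_bochner_integral_diff has_bochner_integral_mult_right 0 1)
  moreover have "normal_density \<mu> \<tau> y * (y - \<mu>)\<^sup>2 + (2 * \<mu>) * (normal_density \<mu> \<tau> y * y)
      - \<mu>\<^sup>2 * normal_density \<mu> \<tau> y = normal_density \<mu> \<tau> y * y\<^sup>2" for y
    by (simp add: power2_eq_square algebra_simps)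
  moreover have "\<tau>\<^sup>2 + (2 * \<mu>) * \<mu> - \<mu>\<^sup>2 * 1 = \<tau>\<^sup>2 + \<mu>\<^sup>2"
    by (simp add: power2_eq_square)
  ultimately have 2: "has_bochner_integral lborel (\<lambda>y. normal_density \<mu> \<tau> y * y\<^sup>2) (\<tau>\<^sup>2 + \<mu>\<^sup>2)"
    by (simp only:)
  show "has_bochner_integral lborel (\<lambda>y. normal_density 0 \<tau> y * exp (c * y)) (exp (c\<^sup>2 * \<tau>\<^sup>2 / 2))"
    using has_bochner_integral_mult_right[OF 0, of "exp (c\<^sup>2 * \<tau>\<^sup>2 / 2)"] by (simp add: tilt)
  have "normal_density 0 \<tau> y * (y * exp (c * y)) = normal_density \<mu> \<tau> y * y * exp (c\<^sup>2 * \<tau>\<^sup>2 / 2)" for y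
    using tilt[of y] by (metis mult.assoc mult.commute)
  then show "has_bochner_integral lborel (\<lambda>y. normal_density 0 \<tau> y * (y * exp (c * y)))
      (c * \<tau>\<^sup>2 * exp (c\<^sup>2 * \<tau>\<^sup>2 / 2))"
    using has_bochner_integral_mult_left[OF 1, of "exp (c\<^sup>2 * \<tau>\<^sup>2 / 2)"] by (simp only: \<mu>_def)
  have "normal_density 0 \<tau> y * (y\<^sup>2 * exp (c * y)) = normal_density \<mu> \<tau> y * y\<^sup>2 * exp (c\<^sup>2 * \<tau>\<^sup>2 / 2)" for y
    using tilt[of y] by (metis mult.assoc mult.commute)
  then show "has_bochner_integral lborel (\<lambda>y. normal_density 0 \<tau> y * (y\<^sup>2 * exp (c * y)))
      ((\<tau>\<^sup>2 + (c * \<tau>\<^sup>2)\<^sup>2) * exp (c\<^sup>2 * \<tau>\<^sup>2 / 2))"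
    using has_bochner_integral_mult_left[OF 2, of "exp (c\<^sup>2 * \<tau>\<^sup>2 / 2)"] by (simp only: \<mu>_def)
qed

section \<open>Brownian motion and its augmented filtration\<close>

locale brownian = prob_space M for M :: "'a measure" +
  fixes B :: "real \<Rightarrow> 'a \<Rightarrow> real"
  assumes brownian: "standard_brownian_motion M B"
begin

abbreviation F :: "real \<Rightarrow> 'a measure" where
  "F \<equiv> augmented_filtration M B"

sublocale filtration "space M" F
  by (rule filtration_augmented_filtration)

lemma measurable_brownian: "0 \<le> t \<Longrightarrow> B t \<in> borel_measurable M"
  using brownian by (simp add: standard_brownian_motion_def)

lemma brownian_0: "AE \<omega> in M. B 0 \<omega> = 0"
  using brownian by (simp add: standard_brownian_motion_def)

lemma continuous_brownian: "\<omega> \<in> space M \<Longrightarrow> continuous_on {0..} (\<lambda>t. B t \<omega>)"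
  using brownian by (simp add: standard_brownian_motion_def continuous_paths_def)

lemma space_natural_filtration: "space (natural_filtration M B t) = space M"
  unfolding natural_filtration_def by (rule space_measure_of) auto

lemma sets_natural_filtration:
  "sets (natural_filtration M B t)
    = sigma_sets (space M) {B s -` A \<inter> space M | s A. 0 \<le> s \<and> s \<le> t \<and> A \<in> sets borel}"
  unfolding natural_filtration_def by (rule sets_measure_of) auto

lemma sets_F: "sets (F t) = sigma_sets (space M) (sets (natural_filtration M B t) \<union> null_sets M)"
  unfolding augmented_filtration_def
  using sets.space_closed[of "natural_filtration M B t"] sets.space_closed[of M]
  by (intro sets_measure_of) (auto simp: space_natural_filtration)

lemma natural_filtration_le: "sets (natural_filtration M B t) \<subseteq> events"
  unfolding sets_natural_filtration
  using measurable_sets[OF measurable_brownian] by (intro sets.sigma_sets_subset) auto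

lemma subalgebra_F: "subalgebra M (F t)"
  unfolding subalgebra_def sets_F
  using natural_filtration_le[of t] by (intro conjI space_F sets.sigma_sets_subset) auto

lemma measurable_F_M: "f \<in> borel_measurable (F t) \<Longrightarrow> f \<in> borel_measurable M"
  by (rule measurable_from_subalg[OF subalgebra_F])

lemma measurable_F_mono: "f \<in> borel_measurable (F s) \<Longrightarrow> s \<le> t \<Longrightarrow> f \<in> borel_measurable (F t)"
  by (rule measurable_from_subalg[of "F t" "F s"]) (simp_all add: subalgebra_def space_F sets_F_mono)

lemma measurable_brownian_F: "0 \<le> s \<Longrightarrow> s \<le> t \<Longrightarrow> B s \<in> borel_measurable (F t)"
proof (rule measurableI)
  fix A :: "real set" assume "0 \<le> s" "s \<le> t" "A \<in> sets borel"
  then have "B s -` A \<inter> space M \<in> sets (natural_filtration M B t)"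
    unfolding sets_natural_filtration by (intro sigma_sets.Basic) blast
  then show "B s -` A \<inter> space (F t) \<in> sets (F t)"
    unfolding sets_F space_F by (intro sigma_sets.Basic) blast
qed simp

text \<open>Independence of increments is given for the natural filtration only, while integrands
  are adapted to the augmented one. The sets that agree almost everywhere with a set of the natural
  filtration form a \<sigma>-algebra containing the null sets, which bridges the gap.\<close>

lemma F_modulo_null:
  assumes "A \<in> sets (F t)"
  shows "\<exists>A'\<in>sets (natural_filtration M B t). AE \<omega> in M. \<omega> \<in> A \<longleftrightarrow> \<omega> \<in> A'"
  using assms unfolding sets_F
proof (induction rule: sigma_sets.induct)
  case (Basic A)
  then show ?case
  proof
    assume "A \<in> null_sets M"
    then have "AE \<omega> in M. \<omega> \<in> A \<longleftrightarrow> \<omega> \<in> {}" using AE_not_in by simp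
    then show ?thesis by (intro bexI[of _ "{}"]) simp_all
  qed auto
next
  case (Compl A)
  then obtain A' where A': "A' \<in> sets (natural_filtration M B t)" "AE \<omega> in M. \<omega> \<in> A \<longleftrightarrow> \<omega> \<in> A'" by blast
  show ?case
  proof (rule bexI)
    show "AE \<omega> in M. \<omega> \<in> space M - A \<longleftrightarrow> \<omega> \<in> space M - A'"
      using A'(2) by eventually_elim simp
    show "space M - A' \<in> sets (natural_filtration M B t)"
      using sets.compl_sets[OF A'(1)] by (simp add: space_natural_filtration)
  qed
next
  case (Union A)
  then have "\<forall>i. \<exists>A'. A' \<in> sets (natural_filtration M B t) \<and> (AE \<omega> in M. \<omega> \<in> A i \<longleftrightarrow> \<omega> \<in> A')" by blast
  then obtain A' where A': "\<And>i. A' i \<in> sets (natural_filtration M B t)"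
    "\<And>i::nat. AE \<omega> in M. \<omega> \<in> A i \<longleftrightarrow> \<omega> \<in> A' i"
    by metis
  have "AE \<omega> in M. \<forall>i. \<omega> \<in> A i \<longleftrightarrow> \<omega> \<in> A' i" using A'(2) by (simp add: AE_all_countable)
  then have "AE \<omega> in M. \<omega> \<in> (\<Union>i. A i) \<longleftrightarrow> \<omega> \<in> (\<Union>i. A' i)" by eventually_elim simp
  moreover have "(\<Union>i. A' i) \<in> sets (natural_filtration M B t)" using A'(1) by blast
  ultimately show ?case by blast
qed auto

text \<open>Exchanging the event of \<open>F s\<close> for an almost everywhere equal one of the
  natural filtration changes neither its probability nor that of its intersection with
  \<open>b\<close>.\<close>

lemma indep_increment:
  assumes "0 \<le> s" "s \<le> t" and h: "h \<in> borel_measurable borel"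
  shows "indep_set (sets (F s)) {(\<lambda>\<omega>. h (B t \<omega> - B s \<omega>)) -` A \<inter> space M | A. A \<in> sets borel}"
proof (rule indep_setI)
  have meas [measurable]: "(\<lambda>\<omega>. h (B t \<omega> - B s \<omega>)) \<in> borel_measurable M"
    using measurable_brownian[of s] measurable_brownian[of t] assms(1,2)
    by (intro measurable_compose[OF _ h] borel_measurable_diff) auto
  show "sets (F s) \<subseteq> events" using subalgebra_F by (simp add: subalgebra_def)
  show "{(\<lambda>\<omega>. h (B t \<omega> - B s \<omega>)) -` A \<inter> space M | A. A \<in> sets borel} \<subseteq> events"
    using measurable_sets[OF meas] by auto
  fix a b assume a: "a \<in> sets (F s)"
    and "b \<in> {(\<lambda>\<omega>. h (B t \<omega> - B s \<omega>)) -` A \<inter> space M | A. A \<in> sets borel}"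
  then obtain A where A: "A \<in> sets borel" "b = (\<lambda>\<omega>. h (B t \<omega> - B s \<omega>)) -` A \<inter> space M" by blast
  have b: "b \<in> events" using A measurable_sets[OF meas] by simp
  have a_M: "a \<in> events" using a subalgebra_F by (auto simp: subalgebra_def)
  obtain a' where a': "a' \<in> sets (natural_filtration M B s)" "AE \<omega> in M. \<omega> \<in> a \<longleftrightarrow> \<omega> \<in> a'"
    using F_modulo_null[OF a] by blast
  have a'_M: "a' \<in> events" using a'(1) natural_filtration_le by blast
  have eq: "prob a = prob a'" "prob (a \<inter> b) = prob (a' \<inter> b)"
    using a'(2) a_M a'_M b by (intro finite_measure_eq_AE; auto)+
  show "prob (a \<inter> b) = prob a * prob b"
  proof (cases "s = t")
    \<comment> \<open>The definition of Brownian motion speaks of \<open>s < t\<close> only. For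
      \<open>s = t\<close> the increment is 0, so \<open>b\<close> is empty or the whole space.
      Stopped grids do produce such steps.\<close>
    case True
    then have "b = (if h 0 \<in> A then space M else {})" using A by auto
    then show ?thesis using a_M prob_space by (auto simp: sets.Int_space_eq2)
  next
    case False
    have "b = (\<lambda>\<omega>. B t \<omega> - B s \<omega>) -` (h -` A) \<inter> space M" using A by auto
    moreover have "h -` A \<in> sets borel" using measurable_sets[OF h A(1)] by simp
    ultimately have "b \<in> {(\<lambda>\<omega>. B t \<omega> - B s \<omega>) -` A \<inter> space M | A. A \<in> sets borel}" by blast
    moreover have "indep_set (sets (natural_filtration M B s))
        {(\<lambda>\<omega>. B t \<omega> - B s \<omega>) -` A \<inter> space M | A. A \<in> sets borel}"
      using brownian assms False by (simp add: standard_brownian_motion_def)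
    ultimately show ?thesis
      unfolding eq using a'(1) indep_setD by blast
  qed
qed

text \<open>The intervals may have gaps but do not overlap, so an earlier increment is known when a
  later one starts. The functions \<open>h j\<close> admit linear as well as exponential steps, and
  the last hypothesis supplies \<open>zero_step\<close> through an increment that is identically
  0.\<close>

lemma independent_steps_increments:
  assumes "finite J" and times: "\<And>j. j \<in> J \<Longrightarrow> 0 \<le> s j \<and> s j \<le> u j"
    and ordered: "\<And>i j. i \<in> J \<Longrightarrow> j \<in> J \<Longrightarrow> i < j \<Longrightarrow> u i \<le> s j"
    and h: "\<And>j. j \<in> J \<Longrightarrow> h j \<in> borel_measurable borel"
    and "\<And>j. j \<in> J \<Longrightarrow> integrable M (\<lambda>\<omega>. (h j (B (u j) \<omega> - B (s j) \<omega>))\<^sup>2)"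
    and "\<And>j. j \<in> J \<Longrightarrow> expectation (\<lambda>\<omega>. h j (B (u j) \<omega> - B (s j) \<omega>)) = 0"
    and "\<And>j. j \<in> J \<Longrightarrow> expectation (\<lambda>\<omega>. (h j (B (u j) \<omega> - B (s j) \<omega>))\<^sup>2) \<le> v j"
    and "\<And>j. j \<in> J \<Longrightarrow> v j = 0 \<Longrightarrow> u j = s j \<and> h j 0 = 0"
  shows "independent_steps M J (\<lambda>j. F (s j)) (\<lambda>j \<omega>. h j (B (u j) \<omega> - B (s j) \<omega>)) v"
proof
  have known: "(\<lambda>\<omega>. h i (B (u i) \<omega> - B (s i) \<omega>)) \<in> borel_measurable (F t)" if "i \<in> J" "u i \<le> t" for i t
    using times[OF that(1)] that h[OF that(1)]
      measurable_brownian_F[of "u i" t] measurable_brownian_F[of "s i" t] by simp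
  show "(\<lambda>\<omega>. h j (B (u j) \<omega> - B (s j) \<omega>)) \<in> borel_measurable M" if "j \<in> J" for j
    using known[OF that order_refl] by (rule measurable_F_M)
  show "sets (F (s i)) \<subseteq> sets (F (s j))" if "i \<in> J" "j \<in> J" "i < j" for i j
    using times[of i] ordered[OF that] that by (intro sets_F_mono) auto
  show "(\<lambda>\<omega>. h i (B (u i) \<omega> - B (s i) \<omega>)) \<in> borel_measurable (F (s j))" if "i \<in> J" "j \<in> J" "i < j" for i j
    by (rule known[OF that(1) ordered[OF that]])
  show "indep_set (sets (F (s j))) {(\<lambda>\<omega>. h j (B (u j) \<omega> - B (s j) \<omega>)) -` A \<inter> space M |A. A \<in> sets borel}"
    if "j \<in> J" for j
    using times[OF that] h[OF that] by (intro indep_increment) auto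
qed (use assms subalgebra_F in auto)

lemma has_bochner_integral_increment:
  assumes "0 \<le> s" "s \<le> t"
  shows "has_bochner_integral M (\<lambda>\<omega>. exp (c * (B t \<omega> - B s \<omega>))) (exp (c\<^sup>2 * (t - s) / 2))"
    and "has_bochner_integral M (\<lambda>\<omega>. (B t \<omega> - B s \<omega>) * exp (c * (B t \<omega> - B s \<omega>)))
      (c * (t - s) * exp (c\<^sup>2 * (t - s) / 2))"
    and "has_bochner_integral M (\<lambda>\<omega>. (B t \<omega> - B s \<omega>)\<^sup>2 * exp (c * (B t \<omega> - B s \<omega>)))
      ((t - s + (c * (t - s))\<^sup>2) * exp (c\<^sup>2 * (t - s) / 2))"
proof -
  have transfer: "has_bochner_integral M (\<lambda>\<omega>. g (B t \<omega> - B s \<omega>)) x"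
    if "s < t" and [measurable]: "g \<in> borel_measurable borel"
      and "has_bochner_integral lborel (\<lambda>y. normal_density 0 (sqrt (t - s)) y * g y) x" for g x
  proof -
    have D: "distributed M lborel (\<lambda>\<omega>. B t \<omega> - B s \<omega>) (normal_density 0 (sqrt (t - s)))"
      using brownian assms \<open>s < t\<close> by (simp add: standard_brownian_motion_def)
    show ?thesis
      using that(3) distributed_integrable[OF D, of g] distributed_integral[OF D, of g]
      by (simp add: has_bochner_integral_iff)
  qed
  \<comment> \<open>These constants serve the degenerate case \<open>s = t\<close>, in which the
    increment is 0 and has no density.\<close>
  have "has_bochner_integral M (\<lambda>\<omega>. 1::real) 1" "has_bochner_integral M (\<lambda>\<omega>. 0::real) 0"
    by (simp_all add: has_bochner_integral_iff prob_space)
  then show "has_bochner_integral M (\<lambda>\<omega>. exp (c * (B t \<omega> - B s \<omega>))) (exp (c\<^sup>2 * (t - s) / 2))"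
    and "has_bochner_integral M (\<lambda>\<omega>. (B t \<omega> - B s \<omega>) * exp (c * (B t \<omega> - B s \<omega>)))
      (c * (t - s) * exp (c\<^sup>2 * (t - s) / 2))"
    and "has_bochner_integral M (\<lambda>\<omega>. (B t \<omega> - B s \<omega>)\<^sup>2 * exp (c * (B t \<omega> - B s \<omega>)))
      ((t - s + (c * (t - s))\<^sup>2) * exp (c\<^sup>2 * (t - s) / 2))"
    using has_bochner_integral_normal_exp[of "sqrt (t - s)" c] assms
      transfer[of "\<lambda>y. exp (c * y)"] transfer[of "\<lambda>y. y * exp (c * y)"] transfer[of "\<lambda>y. y\<^sup>2 * exp (c * y)"]
    by (cases "s = t"; simp)+
qed

lemma increment_moments:
  assumes "0 \<le> s" "s \<le> t"
  shows "has_bochner_integral M (\<lambda>\<omega>. B t \<omega> - B s \<omega>) 0"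
    and "has_bochner_integral M (\<lambda>\<omega>. (B t \<omega> - B s \<omega>)\<^sup>2) (t - s)"
  using has_bochner_integral_increment(2,3)[OF assms, of 0] by simp_all

text \<open>Each integrand expands into a combination of \<open>exp (c * a)\<close>,
  \<open>a * exp (c * a)\<close> and \<open>a\<^sup>2 * exp (c * a)\<close> with \<open>c\<close>
  between -2 and 2. The first two facts concern the relative change of the exponential beyond its
  linear part, the next two the factor of the quotient by the exponential with its mean subtracted,
  and the last one the relative change of the inverse exponential.\<close>

lemma
  fixes \<sigma> s t :: real
  assumes "0 \<le> s" "s \<le> t"
  defines "q \<equiv> \<sigma>\<^sup>2 * (t - s)" and "a \<equiv> \<lambda>\<omega>. \<sigma> * (B t \<omega> - B s \<omega>)"
  shows exp_step_expectation: "has_bochner_integral M (\<lambda>\<omega>. exp (a \<omega> - q / 2) - 1 - a \<omega>) 0"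
    and exp_step_second_moment: "has_bochner_integral M (\<lambda>\<omega>. (exp (a \<omega> - q / 2) - 1 - a \<omega>)\<^sup>2) (exp q - 1 - q)"
    and quotient_step_expectation: "has_bochner_integral M
      (\<lambda>\<omega>. (1 + a \<omega>) * exp (- a \<omega> + q / 2) - exp q * (1 - q)) 0"
    and quotient_step_second_moment: "has_bochner_integral M
      (\<lambda>\<omega>. ((1 + a \<omega>) * exp (- a \<omega> + q / 2) - exp q * (1 - q))\<^sup>2)
      (exp (3 * q) * ((1 - 2 * q)\<^sup>2 + q) - (exp q * (1 - q))\<^sup>2)"
    and inverse_step_second_moment: "has_bochner_integral M (\<lambda>\<omega>. (exp (- a \<omega> + q / 2) - 1)\<^sup>2)
      (exp (3 * q) - 2 * exp q + 1)"
proof -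
  have one: "has_bochner_integral M (\<lambda>\<omega>. 1::real) 1"
    by (simp add: has_bochner_integral_iff prob_space)
  have sc: "has_bochner_integral M (\<lambda>\<omega>. exp (c * a \<omega>)) (exp (c\<^sup>2 * q / 2))"
    "has_bochner_integral M (\<lambda>\<omega>. a \<omega> * exp (c * a \<omega>)) (c * q * exp (c\<^sup>2 * q / 2))"
    "has_bochner_integral M (\<lambda>\<omega>. (a \<omega>)\<^sup>2 * exp (c * a \<omega>)) ((q + (c * q)\<^sup>2) * exp (c\<^sup>2 * q / 2))" for c
    using has_bochner_integral_increment(1)[OF assms(1,2), of "c * \<sigma>"]
      has_bochner_integral_mult_right[OF has_bochner_integral_increment(2)[OF assms(1,2), of "c * \<sigma>"], of \<sigma>]
      has_bochner_integral_mult_right[OF has_bochner_integral_increment(3)[OF assms(1,2), of "c * \<sigma>"], of "\<sigma>\<^sup>2"]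
    by (simp_all add: a_def q_def power_mult_distrib power2_eq_square algebra_simps)
  note intros = has_bochner_integral_add has_bochner_integral_diff has_bochner_integral_mult_right sc one
  \<comment> \<open>Factors such as \<open>exp (0 * a \<omega>)\<close> and
    \<open>1 * a \<omega>\<close> are kept so that the expressions have the shape of the facts
    \<open>sc\<close>; simplification removes them afterwards.\<close>
  have "has_bochner_integral M (\<lambda>\<omega>. exp (- q / 2) * exp (1 * a \<omega>) - 1 - a \<omega> * exp (0 * a \<omega>))
    (exp (- q / 2) * exp (1\<^sup>2 * q / 2) - 1 - 0 * q * exp (0\<^sup>2 * q / 2))"
    by (intro intros)
  then show "has_bochner_integral M (\<lambda>\<omega>. exp (a \<omega> - q / 2) - 1 - a \<omega>) 0"
    by (simp flip: exp_add add: algebra_simps)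
  have "has_bochner_integral M
    (\<lambda>\<omega>. exp (- q) * exp (2 * a \<omega>) + 1 + (a \<omega>)\<^sup>2 * exp (0 * a \<omega>) - (2 * exp (- q / 2)) * exp (1 * a \<omega>)
      - (2 * exp (- q / 2)) * (a \<omega> * exp (1 * a \<omega>)) + 2 * (a \<omega> * exp (0 * a \<omega>)))
    (exp (- q) * exp (2\<^sup>2 * q / 2) + 1 + (q + (0 * q)\<^sup>2) * exp (0\<^sup>2 * q / 2)
      - (2 * exp (- q / 2)) * exp (1\<^sup>2 * q / 2)
      - (2 * exp (- q / 2)) * (1 * q * exp (1\<^sup>2 * q / 2)) + 2 * (0 * q * exp (0\<^sup>2 * q / 2)))"
    (is "has_bochner_integral M ?f ?v")
    by (intro intros)
  moreover have "?f \<omega> = (exp (a \<omega> - q / 2) - 1 - a \<omega>)\<^sup>2" for \<omega>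
  proof -
    have "exp (- q) * exp (2 * a \<omega>) = (exp (a \<omega> - q / 2))\<^sup>2" "exp (- q / 2) * exp (a \<omega>) = exp (a \<omega> - q / 2)"
      by (simp_all add: power2_eq_square flip: exp_add)
    then show ?thesis by (simp add: power2_eq_square algebra_simps)
  qed
  moreover have "?v = exp q - 1 - q"
  proof -
    have "exp (- q) * exp (2 * q) = exp q" "exp (- q / 2) * exp (q / 2) = 1"
      by (simp_all flip: exp_add)
    then show ?thesis by (simp add: algebra_simps)
  qed
  ultimately show "has_bochner_integral M (\<lambda>\<omega>. (exp (a \<omega> - q / 2) - 1 - a \<omega>)\<^sup>2) (exp q - 1 - q)"
    by (simp only:)
  have mean: "has_bochner_integral M (\<lambda>\<omega>. (1 + a \<omega>) * exp (- a \<omega> + q / 2)) (exp q * (1 - q))"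
  proof -
    have "has_bochner_integral M
      (\<lambda>\<omega>. exp (q / 2) * exp (- 1 * a \<omega>) + exp (q / 2) * (a \<omega> * exp (- 1 * a \<omega>)))
      (exp (q / 2) * exp ((- 1)\<^sup>2 * q / 2) + exp (q / 2) * (- 1 * q * exp ((- 1)\<^sup>2 * q / 2)))"
      (is "has_bochner_integral M ?f ?v")
      by (intro intros)
    moreover have "?f \<omega> = (1 + a \<omega>) * exp (- a \<omega> + q / 2)" for \<omega>
      unfolding exp_add by (simp add: algebra_simps)
    moreover have "?v = exp q * (1 - q)"
    proof -
      have "exp (q / 2) * exp (q / 2) = exp q" by (simp flip: exp_add)
      then show ?thesis by (simp add: algebra_simps)
    qed
    ultimately show ?thesis by simp
  qed
  then show "has_bochner_integral M (\<lambda>\<omega>. (1 + a \<omega>) * exp (- a \<omega> + q / 2) - exp q * (1 - q)) 0"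
    using has_bochner_integral_diff[OF mean has_bochner_integral_mult_right[OF one, of "exp q * (1 - q)"]]
    by simp
  have "has_bochner_integral M (\<lambda>\<omega>. exp q * exp (- 2 * a \<omega>) + (2 * exp q) * (a \<omega> * exp (- 2 * a \<omega>))
      + exp q * ((a \<omega>)\<^sup>2 * exp (- 2 * a \<omega>)) - (2 * (exp q * (1 - q))) * ((1 + a \<omega>) * exp (- a \<omega> + q / 2))
      + (exp q * (1 - q))\<^sup>2 * 1)
    (exp q * exp ((- 2)\<^sup>2 * q / 2) + (2 * exp q) * (- 2 * q * exp ((- 2)\<^sup>2 * q / 2))
      + exp q * ((q + (- 2 * q)\<^sup>2) * exp ((- 2)\<^sup>2 * q / 2)) - (2 * (exp q * (1 - q))) * (exp q * (1 - q))
      + (exp q * (1 - q))\<^sup>2 * 1)"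
    (is "has_bochner_integral M ?f ?v")
    by (intro intros mean)
  moreover have "?f \<omega> = ((1 + a \<omega>) * exp (- a \<omega> + q / 2) - exp q * (1 - q))\<^sup>2" for \<omega>
  proof -
    have "(exp (- a \<omega> + q / 2))\<^sup>2 = exp q * exp (- 2 * a \<omega>)"
      by (simp add: power2_eq_square flip: exp_add)
    then have "((1 + a \<omega>) * exp (- a \<omega> + q / 2))\<^sup>2
        = exp q * exp (- 2 * a \<omega>) + (2 * exp q) * (a \<omega> * exp (- 2 * a \<omega>)) + exp q * ((a \<omega>)\<^sup>2 * exp (- 2 * a \<omega>))"
      unfolding power_mult_distrib by (simp add: power2_eq_square algebra_simps)
    then show ?thesis unfolding power2_diff by (simp add: algebra_simps)
  qed
  moreover have "?v = exp (3 * q) * ((1 - 2 * q)\<^sup>2 + q) - (exp q * (1 - q))\<^sup>2"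
  proof -
    have "exp q * exp (2 * q) = exp (3 * q)" by (simp flip: exp_add)
    then have "exp q * exp (2 * q) + (2 * exp q) * (- 2 * q * exp (2 * q))
      + exp q * ((q + (- 2 * q)\<^sup>2) * exp (2 * q)) = exp (3 * q) * ((1 - 2 * q)\<^sup>2 + q)"
      by (simp flip: \<open>exp q * exp (2 * q) = exp (3 * q)\<close>) (simp add: power2_eq_square algebra_simps)
    then show ?thesis by (simp add: power2_eq_square)
  qed
  ultimately show "has_bochner_integral M
      (\<lambda>\<omega>. ((1 + a \<omega>) * exp (- a \<omega> + q / 2) - exp q * (1 - q))\<^sup>2)
      (exp (3 * q) * ((1 - 2 * q)\<^sup>2 + q) - (exp q * (1 - q))\<^sup>2)"
    by (simp only:)
  have "has_bochner_integral M
      (\<lambda>\<omega>. exp q * exp (- 2 * a \<omega>) - (2 * exp (q / 2)) * exp (- 1 * a \<omega>) + 1)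
      (exp q * exp ((- 2)\<^sup>2 * q / 2) - (2 * exp (q / 2)) * exp ((- 1)\<^sup>2 * q / 2) + 1)"
    (is "has_bochner_integral M ?f ?v")
    by (intro intros)
  moreover have "?f \<omega> = (exp (- a \<omega> + q / 2) - 1)\<^sup>2" for \<omega>
  proof -
    have "exp q * exp (- 2 * a \<omega>) = (exp (- a \<omega> + q / 2))\<^sup>2" "exp (q / 2) * exp (- 1 * a \<omega>) = exp (- a \<omega> + q / 2)"
      by (simp_all add: power2_eq_square flip: exp_add)
    then show ?thesis by (simp add: power2_diff)
  qed
  moreover have "?v = exp (3 * q) - 2 * exp q + 1"
    by (simp add: mult.assoc flip: exp_add)
  ultimately show "has_bochner_integral M (\<lambda>\<omega>. (exp (- a \<omega> + q / 2) - 1)\<^sup>2) (exp (3 * q) - 2 * exp q + 1)"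
    by (simp only:)
qed

end

section \<open>Elementary bounds for the moments of one step\<close>

lemma exp_minus_one_le:
  fixes x :: real
  assumes "0 \<le> x"
  shows "exp x - 1 \<le> x * exp x"
proof -
  have "(1 - x) * exp x \<le> exp (- x) * exp x"
    using exp_ge_add_one_self[of "- x"] by (intro mult_right_mono) auto
  then show ?thesis by (simp add: algebra_simps flip: exp_add)
qed

text \<open>Two applications of \<open>exp x - 1 \<le> x * exp x\<close>. The quadratic order makes
  the variances summable to something that vanishes with the mesh.\<close>

lemma exp_step_bound:
  fixes q Q :: real
  assumes "0 \<le> q" "q \<le> Q"
  shows "exp q - 1 - q \<le> exp Q * q\<^sup>2"
proof -
  have "exp q - 1 - q \<le> q * (exp q - 1)"
    using exp_minus_one_le[OF assms(1)] by (simp add: algebra_simps)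
  also have "\<dots> \<le> q * (q * exp q)"
    by (intro mult_left_mono exp_minus_one_le assms)
  also have "\<dots> \<le> exp Q * q\<^sup>2"
    using assms mult_right_mono[of "exp q" "exp Q" "q * q"] by (simp add: power2_eq_square ac_simps)
  finally show ?thesis .
qed

text \<open>In \<open>exp q * (1 - q)\<close> the terms of order \<open>q\<close> cancel. This is
  the effect of the correction \<open>q / 2\<close> in the exponent: the quotient of a solution by
  the explicit one has no drift to first order.\<close>

lemma quotient_step_mean:
  fixes q Q :: real
  assumes "0 \<le> q" "q \<le> Q"
  shows "exp q * (1 - q) \<le> 1" and "1 - exp Q * q\<^sup>2 \<le> exp q * (1 - q)"
proof -
  show "exp q * (1 - q) \<le> 1"
    using exp_minus_one_le[OF assms(1)] by (simp add: algebra_simps)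
  have "1 - exp q * (1 - q) \<le> q * (exp q - 1)"
    using exp_ge_add_one_self[of q] by (simp add: algebra_simps)
  also have "\<dots> \<le> q * (q * exp q)"
    by (intro mult_left_mono exp_minus_one_le assms)
  also have "\<dots> \<le> exp Q * q\<^sup>2"
    using assms mult_right_mono[of "exp q" "exp Q" "q * q"] by (simp add: power2_eq_square ac_simps)
  finally show "1 - exp Q * q\<^sup>2 \<le> exp q * (1 - q)" by simp
qed

text \<open>Since \<open>(1 - 2 * q)\<^sup>2 + q = 1 - 3 * q + 4 * q\<^sup>2\<close>, the second
  moment is at most \<open>1\<close> plus a quadratic term, by the mean bound at
  \<open>3 * q\<close>. The squared mean is at least \<open>1\<close> minus a quadratic term, from
  \<open>x\<^sup>2 \<ge> 2 * x - 1\<close>. The constant adds up both quadratic terms.\<close>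

lemma quotient_step_bound:
  fixes q Q :: real
  assumes "0 \<le> q" "q \<le> Q"
  shows "exp (3 * q) * ((1 - 2 * q)\<^sup>2 + q) - (exp q * (1 - q))\<^sup>2 \<le> (4 * exp (3 * Q) + 2 * exp Q) * q\<^sup>2"
proof -
  have "exp (3 * q) * ((1 - 2 * q)\<^sup>2 + q) = exp (3 * q) * (1 - 3 * q) + 4 * exp (3 * q) * q\<^sup>2"
    by (simp add: power2_eq_square algebra_simps)
  moreover have "exp (3 * q) * (1 - 3 * q) \<le> 1"
    using assms by (intro quotient_step_mean[OF _ order_refl]) simp
  moreover have "4 * exp (3 * q) * q\<^sup>2 \<le> 4 * exp (3 * Q) * q\<^sup>2"
    using assms by (intro mult_right_mono) auto
  moreover have "1 - 2 * exp Q * q\<^sup>2 \<le> (exp q * (1 - q))\<^sup>2"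
  proof -
    have "2 * (exp q * (1 - q)) - 1 \<le> (exp q * (1 - q))\<^sup>2"
      using zero_le_power2[of "exp q * (1 - q) - 1"] by (simp add: power2_diff)
    then show ?thesis using quotient_step_mean(2)[OF assms] by simp
  qed
  ultimately show ?thesis by (simp add: algebra_simps)
qed

text \<open>Only of first order in \<open>q\<close>: summed over a grid this stays bounded but does
  not vanish, which is enough for tightness.\<close>

lemma inverse_step_bound:
  fixes q Q :: real
  assumes "0 \<le> q" "q \<le> Q"
  shows "exp (3 * q) - 2 * exp q + 1 \<le> 3 * exp (3 * Q) * q"
proof -
  have "exp (3 * q) - 2 * exp q + 1 \<le> exp (3 * q) - 1"
    using exp_ge_add_one_self[of q] assms by simp
  also have "\<dots> \<le> 3 * q * exp (3 * q)"
    using exp_minus_one_le[of "3 * q"] assms by simp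
  also have "\<dots> \<le> 3 * q * exp (3 * Q)"
    using assms by (intro mult_left_mono) auto
  finally show ?thesis by (simp add: mult.commute mult.left_commute)
qed

section \<open>Grids and progressive measurability\<close>

text \<open>Multiples of \<open>c / (k + 1)\<close> stopped at \<open>t\<close>. Horizon and
  stopping time are separate because one sequence of simple processes on \<open>{0..c}\<close> has
  to serve all \<open>t \<le> c\<close>: the stopped times are exactly those occurring in
  \<open>simple_integral\<close> at time \<open>t\<close>. Steps beyond \<open>t\<close> are
  degenerate.\<close>

definition grid :: "real \<Rightarrow> real \<Rightarrow> nat \<Rightarrow> nat \<Rightarrow> real" where
  "grid c t k i = min (c * real i / real (Suc k)) t"

abbreviation mesh :: "real \<Rightarrow> real \<Rightarrow> nat \<Rightarrow> nat \<Rightarrow> real" where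
  "mesh c t k i \<equiv> grid c t k (Suc i) - grid c t k i"

abbreviation (in brownian) incr :: "real \<Rightarrow> real \<Rightarrow> nat \<Rightarrow> nat \<Rightarrow> 'a \<Rightarrow> real" where
  "incr c t k i \<omega> \<equiv> B (grid c t k (Suc i)) \<omega> - B (grid c t k i) \<omega>"

abbreviation square_error ::
  "nat \<Rightarrow> (nat \<Rightarrow> real) \<Rightarrow> (nat \<Rightarrow> 'a \<Rightarrow> real) \<Rightarrow> (real \<Rightarrow> 'a \<Rightarrow> real) \<Rightarrow> real \<Rightarrow> 'a \<Rightarrow> ennreal" where
  "square_error n \<tau> \<xi> H T \<omega> \<equiv>
    \<integral>\<^sup>+s\<in>{0..T}. ennreal ((simple_value n \<tau> \<xi> s \<omega> - H s \<omega>)\<^sup>2) \<partial>lborel"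

context
  fixes c t :: real
  assumes t: "0 \<le> t" "t \<le> c"
begin

lemma grid_0: "grid c t k 0 = 0"
  using t by (simp add: grid_def)

lemma grid_end: "grid c t k (Suc k) = t"
  using t by (simp add: grid_def)

lemma grid_mono: "i \<le> j \<Longrightarrow> grid c t k i \<le> grid c t k j"
  unfolding grid_def using t by (intro min.mono divide_right_mono mult_left_mono) auto

lemma grid_nonneg: "0 \<le> grid c t k i"
  using grid_mono[of 0 i k] by (simp add: grid_0)

lemma grid_le: "grid c t k i \<le> t"
  by (simp add: grid_def)

lemma grid_step_nonneg: "0 \<le> mesh c t k i"
  using grid_mono[of i "Suc i" k] by simp

lemma grid_step: "mesh c t k i \<le> c / real (Suc k)"
proof -
  have "c * real (Suc i) / real (Suc k) = c * real i / real (Suc k) + c / real (Suc k)"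
    by (simp add: add_divide_distrib distrib_left)
  moreover have "0 \<le> c / real (Suc k)" using t by simp
  ultimately show ?thesis unfolding grid_def by linarith
qed

lemma sum_grid_step: "(\<Sum>i<Suc k. mesh c t k i) = t"
  by (subst sum_lessThan_telescope) (simp only: grid_end grid_0 diff_0_right)

lemma grid_step_tendsto: "(\<lambda>k. c / real (Suc k)) \<longlonglongrightarrow> 0"
  by (rule LIMSEQ_Suc[OF lim_const_over_n])

lemma sum_grid_step_square: "(\<Sum>i<Suc k. (mesh c t k i)\<^sup>2) \<le> t * (c / real (Suc k))"
proof -
  have "(\<Sum>i<Suc k. (mesh c t k i)\<^sup>2)
      \<le> (\<Sum>i<Suc k. (mesh c t k i) * (c / real (Suc k)))"
    unfolding power2_eq_square by (intro sum_mono mult_left_mono grid_step grid_step_nonneg)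
  also have "\<dots> = t * (c / real (Suc k))"
    by (simp only: sum_distrib_right[symmetric] sum_grid_step)
  finally show ?thesis .
qed

lemma grid_oscillation:
  fixes P :: "real \<Rightarrow> real"
  assumes "continuous_on {0..t} P" "0 < e"
  shows "\<forall>\<^sub>F k in sequentially. \<forall>i. \<forall>s\<in>{grid c t k i..grid c t k (Suc i)}.
    \<forall>u\<in>{grid c t k i..grid c t k (Suc i)}. \<bar>P s - P u\<bar> \<le> e"
proof -
  have "uniformly_continuous_on {0..t} P"
    using assms(1) by (intro compact_uniformly_continuous) auto
  then obtain d where d: "d > 0" "\<And>x x'. x \<in> {0..t} \<Longrightarrow> x' \<in> {0..t} \<Longrightarrow> dist x' x < d \<Longrightarrow> dist (P x') (P x) < e"
    unfolding uniformly_continuous_on_def using \<open>0 < e\<close> by blast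
  have "\<forall>\<^sub>F k in sequentially. c / real (Suc k) < d"
    using grid_step_tendsto d(1) by (rule order_tendstoD)
  then show ?thesis
  proof eventually_elim
    case (elim k)
    show ?case
    proof (intro allI ballI)
      fix i s u assume "s \<in> {grid c t k i..grid c t k (Suc i)}" "u \<in> {grid c t k i..grid c t k (Suc i)}"
      then have "dist s u < d" "s \<in> {0..t}" "u \<in> {0..t}"
        using elim grid_step[of k i] grid_nonneg[of k i] grid_le[of k "Suc i"]
        by (auto simp: dist_real_def)
      then show "\<bar>P s - P u\<bar> \<le> e"
        using d(2)[of u s] by (simp add: dist_real_def)
    qed
  qed
qed

text \<open>With \<open>C' = f' P\<close>, the error in step \<open>i\<close> is the increment of
  \<open>s \<mapsto> f s * P (grid (i + 1)) - C s\<close>, whose derivative is \<open>f' s * (P (grid (i + 1)) - P s)\<close>.\<close>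

lemma grid_integration_by_parts:
  fixes P C f f' :: "real \<Rightarrow> real"
  assumes P: "continuous_on {0..t} P"
    and f: "\<And>s. s \<in> {0..t} \<Longrightarrow> (f has_real_derivative f' s) (at s within {0..t})"
    and C: "\<And>s. s \<in> {0..t} \<Longrightarrow> (C has_real_derivative f' s * P s) (at s within {0..t})"
    and L: "\<And>s. s \<in> {0..t} \<Longrightarrow> \<bar>f' s\<bar> \<le> L"
  shows "(\<lambda>k. \<Sum>i<Suc k. \<bar>f (grid c t k (Suc i)) * P (grid c t k (Suc i)) - f (grid c t k i) * P (grid c t k i)
    - f (grid c t k i) * (P (grid c t k (Suc i)) - P (grid c t k i))
    - (C (grid c t k (Suc i)) - C (grid c t k i))\<bar>) \<longlonglongrightarrow> 0" (is "(\<lambda>k. \<Sum>i<Suc k. \<bar>?err k i\<bar>) \<longlonglongrightarrow> 0")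
proof (rule LIMSEQ_I)
  fix r :: real assume "0 < r"
  have "0 \<le> L" using L[of 0] t by auto
  \<comment> \<open>The summands 1 make \<open>D\<close> positive even if \<open>L\<close> or
    \<open>t\<close> is 0, so that it may be divided by in the choice of \<open>e\<close>.\<close>
  define D where "D = (L + 1) * (t + 1)"
  have "0 < D" using \<open>0 \<le> L\<close> t by (simp add: D_def)
  define e where "e = r / (2 * D)"
  have "0 < e" using \<open>0 < r\<close> \<open>0 < D\<close> by (simp add: e_def)
  have "L * e * t \<le> D * e"
    using \<open>0 \<le> L\<close> t \<open>0 < e\<close> by (simp add: D_def algebra_simps)
  also have "\<dots> = r / 2" using \<open>0 < D\<close> by (simp add: e_def)
  also have "\<dots> < r" using \<open>0 < r\<close> by simp
  finally have small: "L * e * t < r" .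
  have "\<forall>\<^sub>F k in sequentially. norm ((\<Sum>i<Suc k. \<bar>?err k i\<bar>) - 0) < r"
    using grid_oscillation[OF P \<open>0 < e\<close>]
  proof eventually_elim
    case (elim k)
    have step: "\<bar>?err k i\<bar> \<le> (L * e) * mesh c t k i" for i
    proof -
      let ?l = "grid c t k i" and ?r = "grid c t k (Suc i)"
      have sub: "{?l..?r} \<subseteq> {0..t}" using grid_nonneg[of k i] grid_le[of k "Suc i"] by auto
      have "norm ((f ?r * P ?r - C ?r) - (f ?l * P ?r - C ?l)) \<le> (L * e) * norm (?r - ?l)"
      proof (rule field_differentiable_bound)
        show "convex {?l..?r}" by simp
        fix s assume s: "s \<in> {?l..?r}"
        show "((\<lambda>s. f s * P ?r - C s) has_real_derivative f' s * P ?r - f' s * P s) (at s within {?l..?r})"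
          using s sub by (intro DERIV_diff DERIV_cmult_right DERIV_subset[OF f] DERIV_subset[OF C]) auto
        have "\<bar>f' s\<bar> * \<bar>P ?r - P s\<bar> \<le> L * e"
        proof (intro mult_mono L)
          show "\<bar>P ?r - P s\<bar> \<le> e"
            by (rule bspec[OF bspec[OF spec[OF elim, of i]]]) (use s in auto)
        qed (use s sub \<open>0 \<le> L\<close> in auto)
        then show "norm (f' s * P ?r - f' s * P s) \<le> L * e"
          by (simp add: abs_mult flip: right_diff_distrib)
      qed (use grid_mono[of i "Suc i" k] in auto)
      then show ?thesis
        using grid_step_nonneg[of k i] by (simp add: algebra_simps)
    qed
    have "(\<Sum>i<Suc k. \<bar>?err k i\<bar>) \<le> (\<Sum>i<Suc k. (L * e) * mesh c t k i)"
      by (intro sum_mono step)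
    also have "\<dots> = L * e * t"
      by (simp only: sum_distrib_left[symmetric] sum_grid_step)
    finally show ?case using small by (simp add: sum_nonneg)
  qed
  then show "\<exists>no. \<forall>n\<ge>no. norm ((\<Sum>i<Suc n. \<bar>?err n i\<bar>) - 0) < r"
    by (simp only: eventually_sequentially)
qed

end

section \<open>Integrals along paths and joint measurability\<close>

lemma has_real_derivative_set_integral:
  fixes h :: "real \<Rightarrow> real"
  assumes h: "continuous_on {0..} h" and "0 \<le> s"
  shows "((\<lambda>t. LINT u:{0..t}|lborel. h u) has_real_derivative h s) (at s within {0..})"
proof -
  have cont: "continuous_on {0..t} h" for t
    using h by (rule continuous_on_subset) auto
  have eq: "(LINT u:{0..t}|lborel. h u) = integral {0..t} h" for t
    by (intro set_borel_integral_eq_integral borel_integrable_atLeastAtMost' cont)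
  \<comment> \<open>The fundamental theorem of calculus is applied on a compact interval reaching
    beyond \<open>s\<close>, which gives the same one-sided or two-sided limit.\<close>
  have "at s within {0..} = at s within {0..s + 1}"
    using \<open>0 \<le> s\<close> by (intro at_within_nhd[of _ "{..<s + 1}"]) auto
  then show ?thesis
    unfolding eq using integral_has_real_derivative[OF cont, of s "s + 1"] \<open>0 \<le> s\<close> by simp
qed

text \<open>Rounding down to multiples of \<open>1 / (k + 1)\<close> replaces a time by one of
  countably many. It serves joint measurability as well as the recovery of a continuous path from a
  countable set of times.\<close>

lemma floor_quotient_tendsto:
  fixes s :: real
  shows "(\<lambda>k. real_of_int \<lfloor>s * real (Suc k)\<rfloor> / real (Suc k)) \<longlonglongrightarrow> s"
proof (rule LIMSEQ_I)
  fix r :: real assume "0 < r"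
  have "\<forall>\<^sub>F k in sequentially. inverse (real (Suc k)) < r"
    using LIMSEQ_inverse_real_of_nat \<open>0 < r\<close> by (rule order_tendstoD)
  then have "\<forall>\<^sub>F k in sequentially. norm (real_of_int \<lfloor>s * real (Suc k)\<rfloor> / real (Suc k) - s) < r"
  proof eventually_elim
    case (elim k)
    have "\<bar>real_of_int \<lfloor>s * real (Suc k)\<rfloor> - s * real (Suc k)\<bar> \<le> 1"
      by linarith
    then have "\<bar>real_of_int \<lfloor>s * real (Suc k)\<rfloor> - s * real (Suc k)\<bar> / real (Suc k) \<le> inverse (real (Suc k))"
      unfolding inverse_eq_divide by (intro divide_right_mono) auto
    moreover have "real_of_int \<lfloor>s * real (Suc k)\<rfloor> / real (Suc k) - s
        = (real_of_int \<lfloor>s * real (Suc k)\<rfloor> - s * real (Suc k)) / real (Suc k)"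
      by (simp add: diff_divide_distrib)
    ultimately show ?case using elim by (simp only: real_norm_def abs_divide abs_of_nat)
  qed
  then show "\<exists>no. \<forall>n\<ge>no. norm (real_of_int \<lfloor>s * real (Suc n)\<rfloor> / real (Suc n) - s) < r"
    by (simp only: eventually_sequentially)
qed

text \<open>With time rounded to a countable set, the process is a countable composition of
  variables at fixed times, and path continuity passes to the limit. Clamping to
  \<open>{0..t}\<close> is needed since the countable composition runs over all integers: only at
  clamped times is each of these variables measurable for \<open>F t\<close>.\<close>

lemma progressively_measurable_continuous:
  assumes "filtration (space M) F" and X: "adapted F X" and cont: "continuous_paths M X"
  shows "progressively_measurable F X"
  unfolding progressively_measurable_def
proof (intro allI impI)
  interpret filtration "space M" F by fact
  fix t :: real assume "0 \<le> t"
  let ?S = "restrict_space borel {0..t} \<Otimes>\<^sub>M F t"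
  define clamp where "clamp s = max 0 (min s t)" for s
  have clamp: "0 \<le> clamp s" "clamp s \<le> t" for s
    using \<open>0 \<le> t\<close> by (auto simp: clamp_def)
  define Y where "Y k p = X (clamp (real_of_int \<lfloor>fst p * real (Suc k)\<rfloor> / real (Suc k))) (snd p)" for k p
  show "(\<lambda>(s, \<omega>). X s \<omega>) \<in> borel_measurable ?S"
  proof (rule borel_measurable_LIMSEQ_real)
    fix p assume "p \<in> space ?S"
    then obtain s \<omega> where p: "p = (s, \<omega>)" "0 \<le> s" "s \<le> t" "\<omega> \<in> space M"
      by (auto simp: space_pair_measure space_restrict_space space_F)
    from floor_quotient_tendsto[of s]
    have "(\<lambda>k. clamp (real_of_int \<lfloor>s * real (Suc k)\<rfloor> / real (Suc k))) \<longlonglongrightarrow> clamp s"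
      unfolding clamp_def by (intro tendsto_intros)
    then have lim: "(\<lambda>k. clamp (real_of_int \<lfloor>s * real (Suc k)\<rfloor> / real (Suc k))) \<longlonglongrightarrow> s"
      using p by (simp add: clamp_def)
    have "continuous_on {0..} (\<lambda>t. X t \<omega>)" using cont p by (simp add: continuous_paths_def)
    then show "(\<lambda>k. Y k p) \<longlonglongrightarrow> (case p of (s, \<omega>) \<Rightarrow> X s \<omega>)"
      unfolding Y_def p fst_conv snd_conv prod.case
      by (rule continuous_on_tendsto_compose[OF _ lim]) (use p clamp in auto)
  next
    fix k
    have X_t: "X (clamp s) \<in> borel_measurable (F t)" for s
    proof (rule measurable_from_subalg)
      show "subalgebra (F t) (F (clamp s))"
        using clamp by (simp add: subalgebra_def space_F sets_F_mono)
      show "X (clamp s) \<in> borel_measurable (F (clamp s))"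
        using X clamp by (simp add: adapted_def)
    qed
    show "Y k \<in> borel_measurable ?S"
      unfolding Y_def
    proof (rule measurable_compose_countable[where f = "\<lambda>i p. X (clamp (real_of_int i / real (Suc k))) (snd p)"])
      show "(\<lambda>p. X (clamp (real_of_int i / real (Suc k))) (snd p)) \<in> borel_measurable ?S" for i
        by (rule measurable_compose[OF measurable_snd X_t])
      have "(\<lambda>x. x) \<in> restrict_space borel {0..t} \<rightarrow>\<^sub>M (borel :: real measure)"
        by (rule measurable_restrict_space1) simp
      from measurable_compose[OF measurable_fst this]
      have "fst \<in> borel_measurable ?S" .
      then show "(\<lambda>p. \<lfloor>fst p * real (Suc k)\<rfloor>) \<in> ?S \<rightarrow>\<^sub>M count_space UNIV"
        by measurable
    qed
  qed
qed

text \<open>Clamping extends the process from times in \<open>{0..t}\<close> to the whole line, so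
  that measurability of integrals over \<open>lborel\<close> becomes applicable.\<close>

lemma progressively_measurable_clamp:
  assumes "progressively_measurable F X" "0 \<le> t"
  shows "(\<lambda>(s, \<omega>). X (max 0 (min s t)) \<omega>) \<in> borel_measurable (borel \<Otimes>\<^sub>M F t)"
proof -
  have 1: "(\<lambda>(s, \<omega>). X s \<omega>) \<in> borel_measurable (restrict_space borel {0..t} \<Otimes>\<^sub>M F t)"
    using assms by (simp add: progressively_measurable_def)
  have "(\<lambda>p. max 0 (min (fst p) t)) \<in> borel \<Otimes>\<^sub>M F t \<rightarrow>\<^sub>M restrict_space borel {0..t}"
    using assms(2) by (intro measurable_restrict_space2) auto
  then have "(\<lambda>p. (max 0 (min (fst p) t), snd p)) \<in> borel \<Otimes>\<^sub>M F t \<rightarrow>\<^sub>M restrict_space borel {0..t} \<Otimes>\<^sub>M F t"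
    by (intro measurable_Pair) simp_all
  from measurable_compose[OF this 1] show ?thesis by (simp add: case_prod_beta')
qed

lemma continuous_on_bounded_abs:
  fixes P :: "real \<Rightarrow> real"
  assumes "continuous_on {0..} P"
  obtains C where "0 \<le> C" "\<And>s. 0 \<le> s \<Longrightarrow> s \<le> t \<Longrightarrow> \<bar>P s\<bar> \<le> C"
proof -
  have "compact (P ` {0..t})"
    using assms by (intro compact_continuous_image continuous_on_subset[OF assms]) auto
  then obtain C where C: "\<And>x. x \<in> P ` {0..t} \<Longrightarrow> norm x \<le> C"
    using compact_imp_bounded bounded_iff by metis
  show thesis
    by (rule that[of "max 0 C"]) (use C in \<open>auto simp: le_max_iff_disj\<close>)
qed

lemma borel_measurable_set_integral_adapted:
  assumes "filtration (space M) F" "adapted F H" "continuous_paths M H" "0 \<le> t"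
  shows "(\<lambda>\<omega>. LINT u:{0..t}|lborel. H u \<omega>) \<in> borel_measurable (F t)"
proof -
  have prog: "(\<lambda>(s, \<omega>). H (max 0 (min s t)) \<omega>) \<in> borel_measurable (borel \<Otimes>\<^sub>M F t)"
    by (rule progressively_measurable_clamp[OF progressively_measurable_continuous[OF assms(1-3)] assms(4)])
  have "(\<lambda>p. (snd p, fst p)) \<in> F t \<Otimes>\<^sub>M lborel \<rightarrow>\<^sub>M borel \<Otimes>\<^sub>M F t" by measurable
  from measurable_compose[OF this prog]
  have [measurable]: "(\<lambda>p. H (max 0 (min (snd p) t)) (fst p)) \<in> borel_measurable (F t \<Otimes>\<^sub>M lborel)"
    by (simp add: case_prod_beta')
  have "(\<lambda>\<omega>. LINT u|lborel. indicator {0..t} u * H (max 0 (min u t)) \<omega>) \<in> borel_measurable (F t)"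
    by (rule lborel.borel_measurable_lebesgue_integral) (simp add: case_prod_beta')
  moreover have "(LINT u:{0..t}|lborel. H u \<omega>) = (LINT u|lborel. indicator {0..t} u * H (max 0 (min u t)) \<omega>)" for \<omega>
    unfolding set_lebesgue_integral_def
    by (intro Bochner_Integration.integral_cong) (auto simp: indicator_def)
  ultimately show ?thesis by simp
qed

text \<open>The integrand may depend on time and outcome besides the value of \<open>H\<close>, so
  that squared distances from \<open>H\<close> to simple processes are covered.\<close>

lemma borel_measurable_nn_integral_progressive:
  assumes "progressively_measurable F H" "0 \<le> t" "subalgebra M (F t)"
    and f: "(\<lambda>(x, s, \<omega>). f x s \<omega>) \<in> borel_measurable (borel \<Otimes>\<^sub>M borel \<Otimes>\<^sub>M M)"
  shows "(\<lambda>\<omega>. \<integral>\<^sup>+s\<in>{0..t}. ennreal (f (H s \<omega>) s \<omega>) \<partial>lborel) \<in> borel_measurable M"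
proof -
  have "(\<lambda>p. (snd p, fst p)) \<in> M \<Otimes>\<^sub>M lborel \<rightarrow>\<^sub>M borel \<Otimes>\<^sub>M F t"
    using assms(3)
    by (intro measurable_Pair measurable_snd'' measurable_compose[OF measurable_fst]) 
      (auto simp: subalgebra_def measurable_def)
  from measurable_compose[OF this progressively_measurable_clamp[OF assms(1,2)]]
  have [measurable]: "(\<lambda>p. H (max 0 (min (snd p) t)) (fst p)) \<in> borel_measurable (M \<Otimes>\<^sub>M lborel)"
    by (simp add: case_prod_beta')
  have "(\<lambda>p. (H (max 0 (min (snd p) t)) (fst p), snd p, fst p)) \<in> M \<Otimes>\<^sub>M lborel \<rightarrow>\<^sub>M borel \<Otimes>\<^sub>M borel \<Otimes>\<^sub>M M"
    by measurable
  from measurable_compose[OF this f]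
  have [measurable]: "(\<lambda>p. f (H (max 0 (min (snd p) t)) (fst p)) (snd p) (fst p)) \<in> borel_measurable (M \<Otimes>\<^sub>M lborel)"
    by (simp add: case_prod_beta')
  have "(\<lambda>\<omega>. \<integral>\<^sup>+s. ennreal (f (H (max 0 (min s t)) \<omega>) s \<omega>) * indicator {0..t} s \<partial>lborel) \<in> borel_measurable M"
    by (rule lborel.borel_measurable_nn_integral) (simp add: case_prod_beta')
  moreover have "(\<integral>\<^sup>+s\<in>{0..t}. ennreal (f (H s \<omega>) s \<omega>) \<partial>lborel)
      = (\<integral>\<^sup>+s. ennreal (f (H (max 0 (min s t)) \<omega>) s \<omega>) * indicator {0..t} s \<partial>lborel)" for \<omega>
    by (intro nn_integral_cong) (auto simp: indicator_def)
  ultimately show ?thesis by simp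
qed

section \<open>Sums of small centred terms along a grid\<close>

context brownian
begin

text \<open>A continuous path of \<open>Y\<close> is bounded on \<open>{0..t}\<close> by some
  \<open>C\<close>, so the accumulated variance is at most \<open>C\<^sup>2 * L * t\<close> times
  the mesh \<open>c / (k + 1)\<close>. The function \<open>h\<close> may depend on the step length
  because compensators do; \<open>0 < L\<close> ensures that the bound
  \<open>L * \<delta>\<^sup>2\<close> vanishes for degenerate steps alone.\<close>

lemma null_grid_transform:
  fixes h :: "real \<Rightarrow> real \<Rightarrow> real"
  assumes t: "0 \<le> t" "t \<le> c" and Y: "adapted F Y" "continuous_paths M Y"
    and h [measurable]: "\<And>\<delta>. h \<delta> \<in> borel_measurable borel" and "h 0 0 = 0" and "0 < L"
    and mean: "\<And>s u. 0 \<le> s \<Longrightarrow> s \<le> u \<Longrightarrow> u \<le> c \<Longrightarrow>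
      has_bochner_integral M (\<lambda>\<omega>. h (u - s) (B u \<omega> - B s \<omega>)) 0"
    and square: "\<And>s u. 0 \<le> s \<Longrightarrow> s \<le> u \<Longrightarrow> u \<le> c \<Longrightarrow>
      has_bochner_integral M (\<lambda>\<omega>. (h (u - s) (B u \<omega> - B s \<omega>))\<^sup>2) (w (u - s))"
    and w: "\<And>\<delta>. 0 \<le> \<delta> \<Longrightarrow> \<delta> \<le> c \<Longrightarrow> w \<delta> \<le> L * \<delta>\<^sup>2"
  shows "null_in_probability M (\<lambda>k \<omega>. ennreal \<bar>\<Sum>i<Suc k. Y (grid c t k i) \<omega> *
    h (mesh c t k i) (incr c t k i \<omega>)\<bar>)"
proof -
  note g = grid_nonneg[OF t] grid_le[OF t] grid_mono[OF t] grid_step_nonneg[OF t]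
  have le_c: "grid c t k i \<le> c" for k i
    using g(2)[of k i] t by linarith
  have Y_F: "Y (grid c t k i) \<in> borel_measurable (F (grid c t k i))" for k i
    using Y(1) g(1) by (simp add: adapted_def)
  have steps: "independent_steps M {..<Suc k} (\<lambda>i. F (grid c t k i))
    (\<lambda>i \<omega>. h (mesh c t k i) (incr c t k i \<omega>))
    (\<lambda>i. L * (mesh c t k i)\<^sup>2)" for k
  proof (rule independent_steps_increments)
    fix i
    have le: "grid c t k i \<le> grid c t k (Suc i)" using g(3)[of i "Suc i" k] by simp
    note mean' = mean[OF g(1) le le_c] and square' = square[OF g(1) le le_c]
    show "integrable M (\<lambda>\<omega>. (h (mesh c t k i) (incr c t k i \<omega>))\<^sup>2)"
      using square' by (simp add: has_bochner_integral_iff)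
    show "expectation (\<lambda>\<omega>. h (mesh c t k i) (incr c t k i \<omega>)) = 0"
      using mean' by (simp add: has_bochner_integral_iff)
    have "mesh c t k i \<le> c"
      using g(1)[of k i] le_c[of k "Suc i"] by linarith
    then show "expectation (\<lambda>\<omega>. (h (mesh c t k i) (incr c t k i \<omega>))\<^sup>2)
        \<le> L * (mesh c t k i)\<^sup>2"
      using square' w[OF g(4)[of k i]] by (simp add: has_bochner_integral_iff)
    show "L * (mesh c t k i)\<^sup>2 = 0 \<Longrightarrow>
        grid c t k (Suc i) = grid c t k i \<and> h (mesh c t k i) 0 = 0"
      using \<open>0 < L\<close> \<open>h 0 0 = 0\<close> by simp
  qed (use g in auto)
  have null: "null_in_probability M
      (\<lambda>k \<omega>. ennreal (\<Sum>i<Suc k. (Y (grid c t k i) \<omega>)\<^sup>2 * (L * (mesh c t k i)\<^sup>2)))"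
  proof (rule null_in_probability_AE[OF _ AE_I2])
    show "(\<lambda>\<omega>. ennreal (\<Sum>i<Suc k. (Y (grid c t k i) \<omega>)\<^sup>2 * (L * (mesh c t k i)\<^sup>2)))
        \<in> borel_measurable M" for k
      using measurable_F_M[OF Y_F] by measurable
    fix \<omega> assume "\<omega> \<in> space M"
    then have "continuous_on {0..} (\<lambda>s. Y s \<omega>)" using Y(2) by (simp add: continuous_paths_def)
    then obtain C where C: "0 \<le> C" "\<And>s. 0 \<le> s \<Longrightarrow> s \<le> t \<Longrightarrow> \<bar>Y s \<omega>\<bar> \<le> C"
      by (rule continuous_on_bounded_abs[where t = t]) blast
    have bound: "(\<Sum>i<Suc k. (Y (grid c t k i) \<omega>)\<^sup>2 * (L * (mesh c t k i)\<^sup>2))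
        \<le> C\<^sup>2 * L * (t * (c / real (Suc k)))" for k
    proof -
      have "(\<Sum>i<Suc k. (Y (grid c t k i) \<omega>)\<^sup>2 * (L * (mesh c t k i)\<^sup>2))
          \<le> (\<Sum>i<Suc k. C\<^sup>2 * (L * (mesh c t k i)\<^sup>2))"
        using C g \<open>0 < L\<close> by (intro sum_mono mult_right_mono) (auto intro!: power2_mono simp: abs_le_square_iff[symmetric])
      also have "\<dots> = C\<^sup>2 * L * (\<Sum>i<Suc k. (mesh c t k i)\<^sup>2)"
        by (simp only: sum_distrib_left mult.assoc)
      also have "\<dots> \<le> C\<^sup>2 * L * (t * (c / real (Suc k)))"
        using \<open>0 < L\<close> by (intro mult_left_mono sum_grid_step_square[OF t]) auto
      finally show ?thesis .
    qed
    have "(\<lambda>k. C\<^sup>2 * L * (t * (c / real (Suc k)))) \<longlonglongrightarrow> C\<^sup>2 * L * (t * 0)"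
      by (intro tendsto_intros grid_step_tendsto[OF t])
    then have "(\<lambda>k. C\<^sup>2 * L * (t * (c / real (Suc k)))) \<longlonglongrightarrow> 0" by simp
    then have "(\<lambda>k. \<Sum>i<Suc k. (Y (grid c t k i) \<omega>)\<^sup>2 * (L * (mesh c t k i)\<^sup>2)) \<longlonglongrightarrow> 0"
      by (rule tendsto_sandwich[OF always_eventually always_eventually tendsto_const, rotated 2])
         (use bound \<open>0 < L\<close> in \<open>auto intro!: sum_nonneg simp del: sum.lessThan_Suc\<close>)
    then show "(\<lambda>k. ennreal (\<Sum>i<Suc k. (Y (grid c t k i) \<omega>)\<^sup>2 * (L * (mesh c t k i)\<^sup>2))) \<longlonglongrightarrow> 0"
      using tendsto_ennrealI by fastforce
  qed
  \<comment> \<open>All indices share the label 0, and the norm over the single block is the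
    absolute value of the sum.\<close>
  show ?thesis
    using null_in_probability_transform[OF steps Y_F null, of "\<lambda>_ _. 0" "\<lambda>_. {0}"]
    by (simp add: L2_set_def lessThan_def del: sum.lessThan_Suc)
qed

lemma simple_process_measurable:
  assumes "simple_process F n \<tau> \<xi>" "i < n"
  shows "\<xi> i \<in> borel_measurable M"
  using assms by (auto simp: simple_process_def intro: measurable_F_M)

lemma borel_measurable_simple_error:
  assumes S: "simple_process F n \<tau> \<xi>" and H: "progressively_measurable F H" and "0 \<le> T"
  shows "(\<lambda>\<omega>. square_error n \<tau> \<xi> H T \<omega>) \<in> borel_measurable M"
proof (rule borel_measurable_nn_integral_progressive[where f = "\<lambda>x s \<omega>. (simple_value n \<tau> \<xi> s \<omega> - x)\<^sup>2",
      OF H \<open>0 \<le> T\<close> subalgebra_F])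
  have "(\<lambda>p. \<xi> i (snd (snd p)) * indicator {\<tau> i<..\<tau> (Suc i)} (fst (snd p)))
      \<in> borel_measurable (borel \<Otimes>\<^sub>M borel \<Otimes>\<^sub>M M)" if "i < n" for i
    using simple_process_measurable[OF S that] by measurable
  then have "(\<lambda>p. ((\<Sum>i<n. \<xi> i (snd (snd p)) * indicator {\<tau> i<..\<tau> (Suc i)} (fst (snd p))) - fst p)\<^sup>2)
      \<in> borel_measurable (borel \<Otimes>\<^sub>M borel \<Otimes>\<^sub>M M)"
    by (intro borel_measurable_power borel_measurable_diff borel_measurable_sum) auto
  then show "(\<lambda>(x, s, \<omega>). (simple_value n \<tau> \<xi> s \<omega> - x)\<^sup>2) \<in> borel_measurable (borel \<Otimes>\<^sub>M borel \<Otimes>\<^sub>M M)"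
    by (simp add: simple_value_def case_prod_beta')
qed

end

section \<open>Simple processes as step functions of time\<close>

lemma step_times_mono:
  fixes \<tau> :: "nat \<Rightarrow> real"
  assumes "\<And>i. i < n \<Longrightarrow> \<tau> i \<le> \<tau> (Suc i)" "i \<le> j" "j \<le> n"
  shows "\<tau> i \<le> \<tau> j"
  using assms(2,3)
proof (induction rule: dec_induct)
  case (step j)
  then show ?case using assms(1)[of j] by simp
qed simp

lemma simple_value_eq:
  assumes mono: "\<And>i. i < n \<Longrightarrow> \<tau> i \<le> \<tau> (Suc i)" and i: "i < n" "\<tau> i < s" "s \<le> \<tau> (Suc i)"
  shows "simple_value n \<tau> \<xi> s \<omega> = \<xi> i \<omega>"
proof -
  have "indicator {\<tau> j<..\<tau> (Suc j)} s = (if j = i then 1 else 0 :: real)" if "j < n" for j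
    using step_times_mono[where \<tau> = \<tau> and n = n, OF mono, of "Suc j" i] step_times_mono[where \<tau> = \<tau> and n = n, OF mono, of "Suc i" j] that i
    by (cases j i rule: linorder_cases) (auto simp: indicator_def)
  then have "simple_value n \<tau> \<xi> s \<omega> = (\<Sum>j<n. if j = i then \<xi> i \<omega> else 0)"
    unfolding simple_value_def by (intro sum.cong) auto
  then show ?thesis using i by simp
qed

lemma simple_value_outside:
  assumes mono: "\<And>i. i < n \<Longrightarrow> \<tau> i \<le> \<tau> (Suc i)" and s: "s \<le> \<tau> 0 \<or> \<tau> n < s"
  shows "simple_value n \<tau> \<xi> s \<omega> = 0"
proof -
  have "s \<notin> {\<tau> j<..\<tau> (Suc j)}" if "j < n" for j
    using step_times_mono[where \<tau> = \<tau> and n = n, OF mono, of 0 j] step_times_mono[where \<tau> = \<tau> and n = n, OF mono, of "Suc j" n] that s by auto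
  then show ?thesis unfolding simple_value_def by (intro sum.neutral) (auto simp: indicator_def)
qed

lemma step_times_cover:
  fixes \<tau> :: "nat \<Rightarrow> real"
  assumes "\<tau> 0 < s" "s \<le> \<tau> n"
  obtains i where "i < n" "\<tau> i < s" "s \<le> \<tau> (Suc i)"
proof -
  define j where "j = (LEAST j. s \<le> \<tau> j)"
  have j: "s \<le> \<tau> j" unfolding j_def by (rule LeastI) (rule assms)
  have "j \<le> n" unfolding j_def by (rule Least_le) (rule assms)
  have "j \<noteq> 0"
  proof
    assume "j = 0"
    with j assms show False by simp
  qed
  then obtain i where i: "j = Suc i" using not0_implies_Suc by blast
  have "\<not> s \<le> \<tau> i" using not_less_Least[of i "\<lambda>j. s \<le> \<tau> j"] i by (simp add: j_def)
  then show thesis using that[of i] i j \<open>j \<le> n\<close> by auto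
qed

text \<open>Uniform closeness is asked for on \<open>0 < s\<close> only: the intervals of a simple
  process are open on the left, so at time 0 it takes the value 0 whatever \<open>H\<close> is. A
  single point does not affect the integral.\<close>

lemma nn_integral_square_tendsto_0:
  fixes f :: "nat \<Rightarrow> real \<Rightarrow> real"
  assumes "0 \<le> T" and small: "\<And>e. 0 < e \<Longrightarrow> \<forall>\<^sub>F k in sequentially. \<forall>s. 0 < s \<longrightarrow> s \<le> T \<longrightarrow> \<bar>f k s\<bar> \<le> e"
  shows "(\<lambda>k. \<integral>\<^sup>+s\<in>{0..T}. ennreal ((f k s)\<^sup>2) \<partial>lborel) \<longlonglongrightarrow> 0"
proof (rule tendsto_zero_ennreal)
  fix r :: real assume "0 < r"
  define e where "e = sqrt (r / (T + 1))"
  have "0 < e" "e\<^sup>2 * T < r" using \<open>0 < r\<close> \<open>0 \<le> T\<close> by (simp_all add: e_def field_simps)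
  from small[OF this(1)]
  show "\<forall>\<^sub>F k in sequentially. (\<integral>\<^sup>+s\<in>{0..T}. ennreal ((f k s)\<^sup>2) \<partial>lborel) < ennreal r"
  proof eventually_elim
    case (elim k)
    have close: "(f k s)\<^sup>2 \<le> e\<^sup>2" if "0 < s" "s \<le> T" for s
      using elim that \<open>0 < e\<close> by (simp add: abs_le_square_iff[symmetric])
    have "(\<integral>\<^sup>+s\<in>{0..T}. ennreal ((f k s)\<^sup>2) \<partial>lborel) \<le> (\<integral>\<^sup>+s. ennreal (e\<^sup>2) * indicator {0..T} s \<partial>lborel)"
    proof (rule nn_integral_mono_AE)
      have "AE s in lborel. s \<noteq> (0::real)" by (rule AE_lborel_singleton)
      then show "AE s in lborel. ennreal ((f k s)\<^sup>2) * indicator {0..T} s \<le> ennreal (e\<^sup>2) * indicator {0..T} s"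
        by eventually_elim (auto simp: indicator_def intro!: ennreal_leI close)
    qed
    also have "\<dots> = ennreal (e\<^sup>2 * T)"
      using \<open>0 \<le> T\<close> by (simp add: nn_integral_cmult_indicator ennreal_mult)
    also have "\<dots> < ennreal r" using \<open>e\<^sup>2 * T < r\<close> \<open>0 < r\<close> by (simp add: ennreal_lessI)
    finally show ?case .
  qed
qed

text \<open>Truncation at \<open>k\<close> supplies the boundedness that a simple process requires.
  A continuous path is bounded on \<open>{0..c}\<close>, so for large \<open>k\<close> the
  truncation is invisible and uniform continuity controls the error.\<close>

lemma (in brownian)
  assumes H: "adapted F H" "continuous_paths M H" and T: "0 \<le> T" "T \<le> c" "0 < c"
  defines "\<tau> \<equiv> \<lambda>k i. c * real i / real (Suc k)"
    and "\<xi> \<equiv> \<lambda>k i \<omega>. max (- real k) (min (real k) (H (c * real i / real (Suc k)) \<omega>))"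
  shows simple_process_truncated_grid: "simple_process F (Suc k) (\<tau> k) (\<xi> k)"
    and null_simple_error_truncated_grid: "null_in_probability M (\<lambda>k \<omega>.
      square_error (Suc k) (\<tau> k) (\<xi> k) H T \<omega>)"
proof -
  have \<tau>_nonneg: "0 \<le> \<tau> k i" for k i using T by (simp add: \<tau>_def)
  have \<tau>_mono: "\<tau> k i \<le> \<tau> k (Suc i)" for k i
    unfolding \<tau>_def using T by (intro divide_right_mono mult_left_mono) auto
  have \<tau>_0: "\<tau> k 0 = 0" and \<tau>_end: "\<tau> k (Suc k) = c" for k by (simp_all add: \<tau>_def)
  have \<tau>_grid: "\<tau> k i = grid c c k i" if "i \<le> Suc k" for k i
    using step_times_mono[of "Suc k" "\<tau> k" i "Suc k"] \<tau>_mono that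
    by (simp add: grid_def \<tau>_end) (simp add: \<tau>_def)
  show simple: "simple_process F (Suc k) (\<tau> k) (\<xi> k)" for k
    unfolding simple_process_def
  proof (intro conjI allI impI)
    fix i
    have "H (\<tau> k i) \<in> borel_measurable (F (\<tau> k i))"
      using H \<tau>_nonneg by (simp add: adapted_def)
    then show "\<xi> k i \<in> borel_measurable (F (\<tau> k i))"
      unfolding \<xi>_def \<tau>_def by measurable
    show "\<exists>C. \<forall>\<omega>\<in>space (F (\<tau> k i)). \<bar>\<xi> k i \<omega>\<bar> \<le> C"
      by (intro exI[of _ "real k"]) (auto simp: \<xi>_def)
  qed (use \<tau>_nonneg \<tau>_mono in auto)
  show "null_in_probability M (\<lambda>k \<omega>.
      square_error (Suc k) (\<tau> k) (\<xi> k) H T \<omega>)"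
  proof (rule null_in_probability_AE[OF _ AE_I2])
    show "(\<lambda>\<omega>. square_error (Suc k) (\<tau> k) (\<xi> k) H T \<omega>) \<in> borel_measurable M" for k
      by (intro borel_measurable_simple_error simple T
          progressively_measurable_continuous[OF filtration_augmented_filtration] H)
    fix \<omega> assume "\<omega> \<in> space M"
    then have cont: "continuous_on {0..} (\<lambda>s. H s \<omega>)" using H by (simp add: continuous_paths_def)
    then obtain C where C: "0 \<le> C" "\<And>s. 0 \<le> s \<Longrightarrow> s \<le> c \<Longrightarrow> \<bar>H s \<omega>\<bar> \<le> C"
      by (rule continuous_on_bounded_abs[where t = c]) blast
    show "(\<lambda>k. square_error (Suc k) (\<tau> k) (\<xi> k) H T \<omega>) \<longlonglongrightarrow> 0"
    proof (rule nn_integral_square_tendsto_0[OF T(1)])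
      fix e :: real assume "0 < e"
      have "continuous_on {0..c} (\<lambda>s. H s \<omega>)" using cont by (rule continuous_on_subset) auto
      then have "\<forall>\<^sub>F k in sequentially. \<forall>i. \<forall>s\<in>{grid c c k i..grid c c k (Suc i)}.
          \<forall>u\<in>{grid c c k i..grid c c k (Suc i)}. \<bar>H s \<omega> - H u \<omega>\<bar> \<le> e"
        using T \<open>0 < e\<close> by (intro grid_oscillation) auto
      moreover have "\<forall>\<^sub>F k in sequentially. C \<le> real k"
        by (rule filterlim_at_top[THEN iffD1, OF filterlim_real_sequentially, rule_format])
      ultimately show "\<forall>\<^sub>F k in sequentially. \<forall>s. 0 < s \<longrightarrow> s \<le> T \<longrightarrow>
          \<bar>simple_value (Suc k) (\<tau> k) (\<xi> k) s \<omega> - H s \<omega>\<bar> \<le> e"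
      proof eventually_elim
        case (elim k)
        show ?case
        proof (intro allI impI)
          fix s assume that: "0 < s" "s \<le> T"
          have s: "0 < s" "s \<le> c" using that T by auto
          obtain i where i: "i < Suc k" "\<tau> k i < s" "s \<le> \<tau> k (Suc i)"
            by (rule step_times_cover[of "\<tau> k" s "Suc k"]) (use s in \<open>simp_all only: \<tau>_0 \<tau>_end\<close>)
          have "\<bar>H (\<tau> k i) \<omega> - H s \<omega>\<bar> \<le> e"
            by (rule bspec[OF bspec[OF spec[OF elim(1), of i]]]) (use i in \<open>auto simp: \<tau>_grid\<close>)
          moreover have "\<bar>H (\<tau> k i) \<omega>\<bar> \<le> real k"
            using C(2)[of "\<tau> k i"] \<tau>_nonneg i that T elim(2) by fastforce
          then have "\<xi> k i \<omega> = H (\<tau> k i) \<omega>" by (auto simp: \<xi>_def \<tau>_def max_def min_def abs_le_iff)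
          moreover have "simple_value (Suc k) (\<tau> k) (\<xi> k) s \<omega> = \<xi> k i \<omega>"
            by (rule simple_value_eq[OF \<tau>_mono i])
          ultimately show "\<bar>simple_value (Suc k) (\<tau> k) (\<xi> k) s \<omega> - H s \<omega>\<bar> \<le> e" by simp
        qed
      qed
    qed
  qed
qed

section \<open>Existence for the linear equation\<close>

lemma set_integral_singleton_0: "(LINT u:{0..0::real}|lborel. h u) = (0::real)"
  unfolding set_lebesgue_integral_def
proof (rule integral_eq_zero_AE)
  show "AE u in lborel. indicator {0..0::real} u *\<^sub>R h u = 0"
    using AE_lborel_singleton[of "0::real"] by eventually_elim (auto simp: indicator_def)
qed

locale linear_sde = brownian M B for M :: "'a measure" and B +
  fixes m g :: "real \<Rightarrow> real" and \<sigma> x0 :: real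
  assumes continuous_m: "continuous_on {0..} m"
    and g_pos: "\<And>t. 0 \<le> t \<Longrightarrow> 0 < g t"
    and g_deriv: "\<And>t. 0 \<le> t \<Longrightarrow> (g has_real_derivative m t * g t) (at t within {0..})"
    and g_0: "g 0 = 1"
begin

definition E :: "real \<Rightarrow> 'a \<Rightarrow> real" where
  "E t \<omega> = exp (\<sigma> * B t \<omega> - \<sigma>\<^sup>2 * t / 2)"

definition X :: "real \<Rightarrow> 'a \<Rightarrow> real" where
  "X t \<omega> = x0 * g t * E t \<omega>"

definition D :: "real \<Rightarrow> 'a \<Rightarrow> real" where
  "D t \<omega> = (LINT u:{0..t}|lborel. m u * X u \<omega>)"

text \<open>Defined as what the equation leaves for the stochastic integral. The equation thus holds
  by definition, and the work lies in showing that this process is the Ito integral of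
  \<open>\<sigma> * X\<close>.\<close>

definition I :: "real \<Rightarrow> 'a \<Rightarrow> real" where
  "I t \<omega> = X t \<omega> - x0 - D t \<omega>"

lemma continuous_g: "continuous_on {0..} g"
  by (rule DERIV_continuous_on[OF g_deriv]) simp

lemma adapted_E: "adapted F E"
  unfolding adapted_def E_def using measurable_brownian_F by auto

lemma continuous_E: "continuous_paths M E"
  unfolding continuous_paths_def E_def by (auto intro!: continuous_intros continuous_brownian)

lemma adapted_X: "adapted F X"
  using adapted_E unfolding adapted_def X_def by auto

lemma continuous_X: "continuous_paths M X"
  using continuous_E unfolding continuous_paths_def X_def by (auto intro!: continuous_intros continuous_g)

lemma continuous_drift: "\<omega> \<in> space M \<Longrightarrow> continuous_on {0..} (\<lambda>u. m u * X u \<omega>)"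
  using continuous_X unfolding continuous_paths_def by (auto intro!: continuous_intros continuous_m)

lemma D_deriv:
  "\<omega> \<in> space M \<Longrightarrow> 0 \<le> t \<Longrightarrow> ((\<lambda>t. D t \<omega>) has_real_derivative m t * X t \<omega>) (at t within {0..})"
  unfolding D_def by (rule has_real_derivative_set_integral[OF continuous_drift])

lemma adapted_D: "adapted F D"
  unfolding adapted_def D_def
proof (intro allI impI borel_measurable_set_integral_adapted[where M = M] filtration_augmented_filtration)
  show "adapted F (\<lambda>u \<omega>. m u * X u \<omega>)" using adapted_X by (auto simp: adapted_def)
  show "continuous_paths M (\<lambda>u \<omega>. m u * X u \<omega>)" using continuous_drift by (simp add: continuous_paths_def)
qed

lemma continuous_D: "continuous_paths M D"
  unfolding continuous_paths_def by (intro ballI DERIV_continuous_on[OF D_deriv]) auto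

lemma adapted_I: "adapted F I"
  using adapted_X adapted_D unfolding adapted_def I_def
  by (auto intro!: borel_measurable_diff borel_measurable_const)

lemma continuous_I: "continuous_paths M I"
  using continuous_X continuous_D unfolding continuous_paths_def I_def by (auto intro!: continuous_intros)

lemma X_0: "AE \<omega> in M. X 0 \<omega> = x0"
  using brownian_0 by eventually_elim (simp add: X_def E_def g_0)

lemma E_step:
  "E u \<omega> = E s \<omega> * exp (\<sigma> * (B u \<omega> - B s \<omega>) - \<sigma>\<^sup>2 * (u - s) / 2)"
  unfolding E_def by (simp flip: exp_add add: field_simps)

text \<open>These are the residuals of replacing a relative increment of \<open>E\<close> by
  \<open>\<sigma>\<close> times the increment of \<open>B\<close>. In \<open>L\<close> the first
  summand comes from \<open>exp_step_bound\<close> with \<open>q \<le> \<sigma>\<^sup>2 * c\<close>;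
  the summand 1 keeps \<open>L\<close> positive when \<open>\<sigma> = 0\<close>.\<close>

lemma null_exp_steps:
  assumes "0 \<le> t" "t \<le> c"
  shows "null_in_probability M (\<lambda>k \<omega>. ennreal \<bar>\<Sum>i<Suc k. X (grid c t k i) \<omega> *
    (exp (\<sigma> * incr c t k i \<omega> - \<sigma>\<^sup>2 * mesh c t k i / 2)
      - 1 - \<sigma> * incr c t k i \<omega>)\<bar>)"
proof (rule null_grid_transform[OF assms adapted_X continuous_X,
      where h = "\<lambda>\<delta> x. exp (\<sigma> * x - \<sigma>\<^sup>2 * \<delta> / 2) - 1 - \<sigma> * x"
        and w = "\<lambda>\<delta>. exp (\<sigma>\<^sup>2 * \<delta>) - 1 - \<sigma>\<^sup>2 * \<delta>" and L = "exp (\<sigma>\<^sup>2 * c) * (\<sigma>\<^sup>2)\<^sup>2 + 1"])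
  fix \<delta> :: real assume "0 \<le> \<delta>" "\<delta> \<le> c"
  then have "exp (\<sigma>\<^sup>2 * \<delta>) - 1 - \<sigma>\<^sup>2 * \<delta> \<le> exp (\<sigma>\<^sup>2 * c) * (\<sigma>\<^sup>2 * \<delta>)\<^sup>2"
    by (intro exp_step_bound mult_left_mono) auto
  then show "exp (\<sigma>\<^sup>2 * \<delta>) - 1 - \<sigma>\<^sup>2 * \<delta> \<le> (exp (\<sigma>\<^sup>2 * c) * (\<sigma>\<^sup>2)\<^sup>2 + 1) * \<delta>\<^sup>2"
    using zero_le_power2[of \<delta>] unfolding power_mult_distrib distrib_right mult.assoc by linarith
qed (auto intro!: exp_step_expectation exp_step_second_moment add_nonneg_pos)

text \<open>A statement about a single path: \<open>E\<close> is rough but \<open>g\<close> is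
  differentiable, so integration by parts moves the differential to \<open>g\<close>, and its
  contribution is the drift \<open>D\<close>. What remains of \<open>X\<close> telescopes to
  \<open>X t - X 0\<close>.\<close>

lemma ito_sum_tendsto:
  assumes "\<omega> \<in> space M" "X 0 \<omega> = x0" and t: "0 \<le> t" "t \<le> c"
  shows "(\<lambda>k. \<Sum>i<Suc k. x0 * g (grid c t k i) * (E (grid c t k (Suc i)) \<omega> - E (grid c t k i) \<omega>)) \<longlonglongrightarrow> I t \<omega>"
proof -
  have "continuous_on {0..} (\<lambda>s. x0 * (m s * g s))"
    by (intro continuous_intros continuous_m continuous_g)
  then obtain L where "0 \<le> L" and L: "\<And>s. 0 \<le> s \<Longrightarrow> s \<le> t \<Longrightarrow> \<bar>x0 * (m s * g s)\<bar> \<le> L"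
    by (rule continuous_on_bounded_abs[where t = t]) blast
  have sub: "{0..t} \<subseteq> {0..}" by auto
  have E: "continuous_on {0..t} (\<lambda>s. E s \<omega>)"
    using continuous_E assms(1) sub unfolding continuous_paths_def by (blast intro: continuous_on_subset)
  let ?err = "\<lambda>k i. x0 * g (grid c t k (Suc i)) * E (grid c t k (Suc i)) \<omega> - x0 * g (grid c t k i) * E (grid c t k i) \<omega>
      - x0 * g (grid c t k i) * (E (grid c t k (Suc i)) \<omega> - E (grid c t k i) \<omega>)
      - (D (grid c t k (Suc i)) \<omega> - D (grid c t k i) \<omega>)"
  have "(\<lambda>k. \<Sum>i<Suc k. \<bar>?err k i\<bar>) \<longlonglongrightarrow> 0"
  proof (rule grid_integration_by_parts[OF t E])
    fix s assume s: "s \<in> {0..t}"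
    show "((\<lambda>s. x0 * g s) has_real_derivative x0 * (m s * g s)) (at s within {0..t})"
      using s by (intro DERIV_cmult DERIV_subset[OF g_deriv sub]) auto
    show "((\<lambda>t. D t \<omega>) has_real_derivative x0 * (m s * g s) * E s \<omega>) (at s within {0..t})"
      using DERIV_subset[OF D_deriv[OF assms(1)] sub, of s] s by (simp add: X_def ac_simps)
    show "\<bar>x0 * (m s * g s)\<bar> \<le> L" using L s by simp
  qed
  then have "(\<lambda>k. \<Sum>i<Suc k. ?err k i) \<longlonglongrightarrow> 0"
    by (rule tendsto_rabs_zero_cancel[OF tendsto_sandwich[OF always_eventually always_eventually tendsto_const, rotated 2]])
       (auto intro!: sum_abs simp del: sum.lessThan_Suc)
  moreover have "(\<Sum>i<Suc k. ?err k i)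
      = I t \<omega> - (\<Sum>i<Suc k. x0 * g (grid c t k i) * (E (grid c t k (Suc i)) \<omega> - E (grid c t k i) \<omega>))" for k
  proof -
    have "(\<Sum>i<Suc k. (X (grid c t k (Suc i)) \<omega> - D (grid c t k (Suc i)) \<omega>) - (X (grid c t k i) \<omega> - D (grid c t k i) \<omega>))
        = (X t \<omega> - D t \<omega>) - (X 0 \<omega> - D 0 \<omega>)"
      by (subst sum_lessThan_telescope) (simp only: grid_end[OF t] grid_0[OF t])
    also have "\<dots> = I t \<omega>"
      using assms(2) by (simp only: I_def D_def set_integral_singleton_0)
    finally have *: "(\<Sum>i<Suc k. (X (grid c t k (Suc i)) \<omega> - D (grid c t k (Suc i)) \<omega>) - (X (grid c t k i) \<omega> - D (grid c t k i) \<omega>)) = I t \<omega>" .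
    show ?thesis
      unfolding *[symmetric] sum_subtractf[symmetric] by (intro sum.cong refl) (simp add: X_def)
  qed
  ultimately have "(\<lambda>k. I t \<omega> - (\<Sum>i<Suc k. x0 * g (grid c t k i) * (E (grid c t k (Suc i)) \<omega> - E (grid c t k i) \<omega>))) \<longlonglongrightarrow> 0"
    by (simp only:)
  from tendsto_diff[OF tendsto_const[of "I t \<omega>"] this] show ?thesis
    by (simp only: diff_diff_eq2 diff_0_right add_diff_cancel_left')
qed

text \<open>Adding the residuals \<open>S\<close> to the integral of the truncated grid process
  gives, once the truncation is inactive, the sums of \<open>x0 * g\<close> against increments of
  \<open>E\<close>. These converge to \<open>I\<close> pathwise, and \<open>S\<close> vanishes in
  probability.\<close>

lemma has_ito_integral_X: "has_ito_integral M F B (\<lambda>u \<omega>. \<sigma> * X u \<omega>) I"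
  unfolding has_ito_integral_def
proof (intro conjI allI impI)
  have H: "adapted F (\<lambda>u \<omega>. \<sigma> * X u \<omega>)" "continuous_paths M (\<lambda>u \<omega>. \<sigma> * X u \<omega>)"
    using adapted_X continuous_X by (auto simp: adapted_def continuous_paths_def intro!: continuous_intros)
  show "progressively_measurable F (\<lambda>u \<omega>. \<sigma> * X u \<omega>)"
    by (rule progressively_measurable_continuous[OF filtration_augmented_filtration H])
  show "adapted F I" "continuous_paths M I" by (fact adapted_I continuous_I)+
  fix T :: real assume "0 \<le> T"
  show "AE \<omega> in M. (\<integral>\<^sup>+s\<in>{0..T}. ennreal ((\<sigma> * X s \<omega>)\<^sup>2) \<partial>lborel) < \<infinity>"
  proof (rule AE_I2)
    fix \<omega> assume "\<omega> \<in> space M"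
    then have "continuous_on {0..} (\<lambda>s. (\<sigma> * X s \<omega>)\<^sup>2)"
      using continuous_X by (auto simp: continuous_paths_def intro!: continuous_intros)
    then obtain C where C: "0 \<le> C" "\<And>s. 0 \<le> s \<Longrightarrow> s \<le> T \<Longrightarrow> \<bar>(\<sigma> * X s \<omega>)\<^sup>2\<bar> \<le> C"
      by (rule continuous_on_bounded_abs[where t = T]) blast
    have "(\<integral>\<^sup>+s\<in>{0..T}. ennreal ((\<sigma> * X s \<omega>)\<^sup>2) \<partial>lborel) \<le> (\<integral>\<^sup>+s. ennreal C * indicator {0..T} s \<partial>lborel)"
      using C by (intro nn_integral_mono) (auto simp: indicator_def intro!: ennreal_leI)
    also have "\<dots> < \<infinity>" using \<open>0 \<le> T\<close> by (simp add: nn_integral_cmult_indicator ennreal_mult_less_top)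
    finally show "(\<integral>\<^sup>+s\<in>{0..T}. ennreal ((\<sigma> * X s \<omega>)\<^sup>2) \<partial>lborel) < \<infinity>" .
  qed
  \<comment> \<open>A horizon that is positive even for \<open>T = 0\<close>.\<close>
  define c where "c = T + 1"
  have c: "0 < c" "T \<le> c" using \<open>0 \<le> T\<close> by (simp_all add: c_def)
  define \<tau> where "\<tau> k i = c * real i / real (Suc k)" for k i
  define \<xi> where "\<xi> k i \<omega> = max (- real k) (min (real k) (\<sigma> * X (c * real i / real (Suc k)) \<omega>))" for k i \<omega>
  have \<tau>_eq: "\<tau> = (\<lambda>k i. c * real i / real (Suc k))" by (intro ext) (rule \<tau>_def)
  have \<xi>_eq: "\<xi> = (\<lambda>k i \<omega>. max (- real k) (min (real k) (\<sigma> * X (c * real i / real (Suc k)) \<omega>)))"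
    by (intro ext) (rule \<xi>_def)
  have simple: "simple_process F (Suc k) (\<tau> k) (\<xi> k)" for k
    unfolding \<tau>_eq \<xi>_eq by (rule simple_process_truncated_grid[OF H \<open>0 \<le> T\<close> c(2,1)])
  show "\<exists>n \<tau> \<xi>. (\<forall>k. simple_process F (n k) (\<tau> k) (\<xi> k)) \<and>
      null_in_probability M
        (\<lambda>k \<omega>. square_error (n k) (\<tau> k) (\<xi> k) (\<lambda>u \<omega>. \<sigma> * X u \<omega>) T \<omega>) \<and>
      (\<forall>t\<in>{0..T}. null_in_probability M
        (\<lambda>k \<omega>. ennreal \<bar>simple_integral B (n k) (\<tau> k) (\<xi> k) t \<omega> - I t \<omega>\<bar>))"
  proof (intro exI[of _ Suc] exI[of _ \<tau>] exI[of _ \<xi>] conjI allI ballI simple)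
    show "null_in_probability M
        (\<lambda>k \<omega>. square_error (Suc k) (\<tau> k) (\<xi> k) (\<lambda>u \<omega>. \<sigma> * X u \<omega>) T \<omega>)"
      unfolding \<tau>_eq \<xi>_eq by (rule null_simple_error_truncated_grid[OF H \<open>0 \<le> T\<close> c(2,1)])
    fix t assume "t \<in> {0..T}"
    then have t: "0 \<le> t" "t \<le> c" using c by auto
    let ?t = "grid c t"
    define S where "S k \<omega> = (\<Sum>i<Suc k. X (?t k i) \<omega> *
      (exp (\<sigma> * (B (?t k (Suc i)) \<omega> - B (?t k i) \<omega>) - \<sigma>\<^sup>2 * (?t k (Suc i) - ?t k i) / 2)
      - 1 - \<sigma> * (B (?t k (Suc i)) \<omega> - B (?t k i) \<omega>)))" for k \<omega>
    \<comment> \<open>The part that converges on almost every path; the error to be estimated is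
      \<open>R - S\<close>.\<close>
    define R where "R k \<omega> = simple_integral B (Suc k) (\<tau> k) (\<xi> k) t \<omega> + S k \<omega> - I t \<omega>" for k \<omega>
    have B_M: "B (?t k i) \<in> borel_measurable M" for k i
      by (rule measurable_brownian[OF grid_nonneg[OF t]])
    have X_M: "X (?t k i) \<in> borel_measurable M" for k i
      using adapted_X grid_nonneg[OF t] by (auto simp: adapted_def intro: measurable_F_M)
    note [measurable] = B_M X_M
    have int_eq: "simple_integral B (Suc k) (\<tau> k) (\<xi> k) t \<omega>
        = (\<Sum>i<Suc k. \<xi> k i \<omega> * (B (?t k (Suc i)) \<omega> - B (?t k i) \<omega>))" for k \<omega>
      by (simp add: simple_integral_def grid_def \<tau>_def del: sum.lessThan_Suc)
    have I_M: "I t \<in> borel_measurable M"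
      using adapted_I t by (auto simp: adapted_def intro: measurable_F_M)
    have S_M: "S k \<in> borel_measurable M" for k
      unfolding S_def by measurable
    have int_M: "simple_integral B (Suc k) (\<tau> k) (\<xi> k) t \<in> borel_measurable M" for k
      unfolding int_eq using simple_process_measurable[OF simple] B_M
      by (intro borel_measurable_sum borel_measurable_times borel_measurable_diff) auto
    have "null_in_probability M (\<lambda>k \<omega>. ennreal \<bar>R k \<omega>\<bar>)"
    proof (rule null_in_probability_real_AE)
      show "R k \<in> borel_measurable M" for k
        unfolding R_def using I_M S_M int_M by measurable
      show "AE \<omega> in M. (\<lambda>k. R k \<omega>) \<longlonglongrightarrow> 0"
        using X_0 AE_space
      proof eventually_elim
        case (elim \<omega>)
        then have "continuous_on {0..} (\<lambda>s. \<sigma> * X s \<omega>)" using H by (simp add: continuous_paths_def)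
        then obtain C where C: "0 \<le> C" "\<And>s. 0 \<le> s \<Longrightarrow> s \<le> t \<Longrightarrow> \<bar>\<sigma> * X s \<omega>\<bar> \<le> C"
          by (rule continuous_on_bounded_abs[where t = t]) blast
        have "\<forall>\<^sub>F k in sequentially. C \<le> real k"
          by (rule filterlim_at_top[THEN iffD1, OF filterlim_real_sequentially, rule_format])
        then have "\<forall>\<^sub>F k in sequentially. (\<Sum>i<Suc k. x0 * g (?t k i) * (E (?t k (Suc i)) \<omega> - E (?t k i) \<omega>)) - I t \<omega> = R k \<omega>"
        proof eventually_elim
          case (elim k)
          have "x0 * g (?t k i) * (E (?t k (Suc i)) \<omega> - E (?t k i) \<omega>)
            = \<xi> k i \<omega> * (B (?t k (Suc i)) \<omega> - B (?t k i) \<omega>) + X (?t k i) \<omega> *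
              (exp (\<sigma> * (B (?t k (Suc i)) \<omega> - B (?t k i) \<omega>) - \<sigma>\<^sup>2 * (?t k (Suc i) - ?t k i) / 2)
              - 1 - \<sigma> * (B (?t k (Suc i)) \<omega> - B (?t k i) \<omega>))" for i
          proof -
            have "\<xi> k i \<omega> * (B (?t k (Suc i)) \<omega> - B (?t k i) \<omega>)
                = \<sigma> * X (?t k i) \<omega> * (B (?t k (Suc i)) \<omega> - B (?t k i) \<omega>)"
            proof (cases "\<tau> k i \<le> t")
              case True
              then have "?t k i = \<tau> k i" by (simp add: grid_def \<tau>_def)
              moreover have "\<bar>\<sigma> * X (?t k i) \<omega>\<bar> \<le> real k"
                using C(2)[OF grid_nonneg[OF t] grid_le[OF t]] elim by (rule order_trans)
              ultimately have "\<xi> k i \<omega> = \<sigma> * X (?t k i) \<omega>"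
                by (auto simp: \<xi>_def \<tau>_def max_def min_def abs_le_iff)
              then show ?thesis by simp
            next
              \<comment> \<open>Here \<open>\<xi> k i\<close> looks at \<open>X\<close> after time
                \<open>t\<close>, but both stopped grid points equal \<open>t\<close> and the
                increment of \<open>B\<close> is 0.\<close>
              case False
              then have "?t k i = t" by (simp add: grid_def \<tau>_def)
              moreover have "?t k (Suc i) = t"
                using grid_mono[OF t, of i "Suc i" k] grid_le[OF t, of k "Suc i"] \<open>?t k i = t\<close> by simp
              ultimately show ?thesis by simp
            qed
            then show ?thesis
              unfolding E_step[of "?t k (Suc i)" \<omega> "?t k i"] by (simp add: X_def algebra_simps)
          qed
          then show ?case
            by (simp only: R_def int_eq S_def sum.distrib[symmetric])
        qed
        moreover have "(\<lambda>k. (\<Sum>i<Suc k. x0 * g (?t k i) * (E (?t k (Suc i)) \<omega> - E (?t k i) \<omega>)) - I t \<omega>) \<longlonglongrightarrow> I t \<omega> - I t \<omega>"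
          by (intro tendsto_diff tendsto_const ito_sum_tendsto elim t)
        ultimately show ?case using Lim_transform_eventually by fastforce
      qed
    qed
    from null_in_probability_add[OF this null_exp_steps[OF t, folded S_def]]
    show "null_in_probability M (\<lambda>k \<omega>. ennreal \<bar>simple_integral B (Suc k) (\<tau> k) (\<xi> k) t \<omega> - I t \<omega>\<bar>)"
    proof (rule null_in_probability_mono[OF _ _ AE_I2])
      show "(\<lambda>\<omega>. ennreal \<bar>simple_integral B (Suc k) (\<tau> k) (\<xi> k) t \<omega> - I t \<omega>\<bar>) \<in> borel_measurable M" for k
        using I_M int_M by measurable
      fix k \<omega>
      have "\<bar>simple_integral B (Suc k) (\<tau> k) (\<xi> k) t \<omega> - I t \<omega>\<bar> \<le> \<bar>R k \<omega>\<bar> + \<bar>S k \<omega>\<bar>"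
        by (simp add: R_def)
      then show "ennreal \<bar>simple_integral B (Suc k) (\<tau> k) (\<xi> k) t \<omega> - I t \<omega>\<bar> \<le> ennreal \<bar>R k \<omega>\<bar> + ennreal \<bar>S k \<omega>\<bar>"
        by (simp add: ennreal_leI flip: ennreal_plus)
    qed
  qed
qed

lemma strong_solution_X: "strong_solution M B (\<lambda>t x. m t * x) (\<lambda>t x. \<sigma> * x) x0 X"
  unfolding strong_solution_def
proof (intro conjI allI impI exI[of _ I] adapted_X continuous_X X_0 has_ito_integral_X)
  fix t :: real assume "0 \<le> t"
  show "AE \<omega> in M. set_integrable lborel {0..t} (\<lambda>u. m u * X u \<omega>)"
    by (intro AE_I2 borel_integrable_atLeastAtMost' continuous_on_subset[OF continuous_drift]) auto
qed (simp add: I_def D_def)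

end

section \<open>Estimates for Ito integrals\<close>

text \<open>Codes a pair of indices as \<open>i * m + j\<close>. The cells of a common refinement
  thereby get one linear index that respects the order of time, as \<open>independent_steps\<close>
  requires.\<close>

lemma sum_div_mod:
  fixes f :: "nat \<Rightarrow> nat \<Rightarrow> 'b::comm_monoid_add"
  shows "(\<Sum>l<n * m. f (l div m) (l mod m)) = (\<Sum>i<n. \<Sum>j<m. f i j)"
proof -
  have "(\<Sum>l<n * m. f (l div m) (l mod m)) = (\<Sum>(i, j)\<in>{..<n} \<times> {..<m}. f i j)"
  proof (rule sum.reindex_bij_witness[where i = "\<lambda>(i, j). i * m + j" and j = "\<lambda>l. (l div m, l mod m)"])
    fix l assume l: "l \<in> {..<n * m}"
    then have "0 < m" by (cases m) auto
    then show "(l div m, l mod m) \<in> {..<n} \<times> {..<m}"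
      using l by (simp add: less_mult_imp_div_less)
  next
    fix p assume "p \<in> {..<n} \<times> {..<m}"
    then obtain i j where p: "p = (i, j)" "i < n" "j < m" by auto
    have "i * m + j < Suc i * m" using p by simp
    also have "\<dots> \<le> n * m" using p by (intro mult_right_mono) auto
    finally show "(case p of (i, j) \<Rightarrow> i * m + j) \<in> {..<n * m}" using p by simp
  qed auto
  then show ?thesis by (simp add: sum.cartesian_product)
qed

text \<open>The weighted error, within block \<open>b\<close>, of freezing the integrand of
  \<open>I\<close> at the value \<open>h i\<close> on the \<open>i\<close>th interval of
  \<open>\<rho>\<close>.\<close>

abbreviation (in brownian) block_error where
  "block_error n \<rho> w h I blk (b :: nat) \<omega> \<equiv> \<Sum>i\<in>{i\<in>{..<n}. blk i = b}. w i \<omega> *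
    (I (\<rho> (Suc i)) \<omega> - I (\<rho> i) \<omega> - h i \<omega> * (B (\<rho> (Suc i)) \<omega> - B (\<rho> i) \<omega> :: real))"

text \<open>On the common refinement of \<open>\<rho>\<close> and \<open>\<tau>\<close> the error is
  a transform of increments of \<open>B\<close> with weights \<open>w * (\<xi> - h)\<close>, whose
  accumulated variance is at most the integral in the hypothesis. Stating that integral through a
  majorant \<open>R\<close> leaves the choice of a convenient measurable bound open.\<close>

lemma (in brownian) simple_block_estimate:
  fixes w h \<xi> :: "nat \<Rightarrow> 'a \<Rightarrow> real" and \<rho> \<tau> :: "nat \<Rightarrow> real" and blk :: "nat \<Rightarrow> nat"
  assumes S: "simple_process F N \<tau> \<xi>"
    and \<rho>: "0 \<le> \<rho> 0" "\<And>i. i < n \<Longrightarrow> \<rho> i \<le> \<rho> (Suc i)" "\<rho> n \<le> T"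
    and w: "\<And>i. i < n \<Longrightarrow> w i \<in> borel_measurable (F (\<rho> i))"
    and h: "\<And>i. i < n \<Longrightarrow> h i \<in> borel_measurable (F (\<rho> i))"
    and pos: "0 < \<epsilon>" "0 < \<delta>"
    and R: "R \<in> borel_measurable M"
    and le_R: "\<And>\<omega>. \<omega> \<in> space M \<Longrightarrow> (\<integral>\<^sup>+s\<in>{0..T}. ennreal ((simple_value n \<rho> w s \<omega> * simple_value N \<tau> \<xi> s \<omega>
        - simple_value n \<rho> (\<lambda>i \<omega>. w i \<omega> * h i \<omega>) s \<omega>)\<^sup>2) \<partial>lborel) \<le> R \<omega>"
  shows "\<P>(\<omega> in M. \<epsilon> < L2_set (\<lambda>b. block_error n \<rho> w h (simple_integral B N \<tau> \<xi>) blk b \<omega>) A)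
    \<le> \<delta> / \<epsilon>\<^sup>2 + \<P>(\<omega> in M. ennreal \<delta> < R \<omega>)"
proof -
  have \<tau>_0: "0 \<le> \<tau> 0" and \<tau>_mono: "\<And>i. i < N \<Longrightarrow> \<tau> i \<le> \<tau> (Suc i)"
    and \<xi>_F: "\<And>i. i < N \<Longrightarrow> \<xi> i \<in> borel_measurable (F (\<tau> i))"
    using S by (simp_all add: simple_process_def)
  note \<rho>_le = step_times_mono[where \<tau> = \<rho> and n = n, OF \<rho>(2)]
  define m where "m = Suc (Suc N)"
  \<comment> \<open>A cell from 0 to \<open>\<tau> 0\<close> and one from \<open>\<tau> N\<close> to
    at least \<open>T\<close> are added, so that the \<open>m = N + 2\<close> cells cover
    \<open>{0..T}\<close>; on the two added ones \<open>\<xi>'\<close> is 0.\<close>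
  define \<tau>' where "\<tau>' j = (if j = 0 then 0 else if j \<le> Suc N then \<tau> (j - 1) else max T (\<tau> N))" for j
  define \<xi>' where "\<xi>' j \<omega> = (if j = 0 \<or> N < j then 0 else \<xi> (j - 1) \<omega>)" for j \<omega>
  \<comment> \<open>Projection onto the \<open>i\<close>th interval of \<open>\<rho>\<close>; the
    projected times of \<open>\<tau>'\<close> cut this interval into \<open>m\<close> cells, some of
    them empty.\<close>
  define cl where "cl i x = max (\<rho> i) (min (\<rho> (Suc i)) x)" for i x
  define s where "s l = cl (l div m) (\<tau>' (l mod m))" for l
  define u where "u l = cl (l div m) (\<tau>' (Suc (l mod m)))" for l
  \<comment> \<open>The weight is 0 on empty cells. There \<open>s l\<close> may precede the time at
    which \<open>\<xi>'\<close> is known, and without the case distinction the weight need not be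
    measurable for \<open>F (s l)\<close>.\<close>
  define c where "c l \<omega> = (if s l < u l then w (l div m) \<omega> * (\<xi>' (l mod m) \<omega> - h (l div m) \<omega>) else 0)" for l \<omega>
  let ?J = "{..<n * m}"
  have "0 < m" by (simp add: m_def)
  have \<tau>'_step: "\<tau>' j \<le> \<tau>' (Suc j)" if "j < m" for j
  proof -
    have "j < Suc (Suc N)" using that by (simp add: m_def)
    then consider "j = 0" | i where "j = Suc i" "i < N" | "j = Suc N" by (cases j) (auto simp: less_Suc_eq)
    then show ?thesis using \<tau>_0 \<tau>_mono by cases (auto simp: \<tau>'_def)
  qed
  note \<tau>'_mono = step_times_mono[where \<tau> = \<tau>' and n = m, OF \<tau>'_step]
  have idx: "l div m < n" "l mod m < m" if "l < n * m" for l
    using that \<open>0 < m\<close> by (simp_all add: less_mult_imp_div_less)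
  have \<rho>_nonneg: "0 \<le> \<rho> i" if "i \<le> n" for i using \<rho>_le[of 0 i] \<rho>(1) that by simp
  have \<rho>_T: "\<rho> i \<le> T" if "i \<le> n" for i using \<rho>_le[of i n] \<rho>(3) that by simp
  have cl_mono: "x \<le> y \<Longrightarrow> cl i x \<le> cl i y" for i x y unfolding cl_def by auto
  have cl_bounds: "\<rho> i \<le> cl i x" "cl i x \<le> \<rho> (Suc i)" if "i < n" for i x
    using \<rho>(2)[OF that] by (auto simp: cl_def)
  have su: "s l \<le> u l" if "l < n * m" for l
    unfolding s_def u_def using idx[OF that] by (intro cl_mono \<tau>'_step) auto
  have s_ge: "\<rho> (l div m) \<le> s l" and u_le: "u l \<le> \<rho> (Suc (l div m))" if "l < n * m" for l
    unfolding s_def u_def using cl_bounds[OF idx(1)[OF that]] by auto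
  have s_nonneg: "0 \<le> s l" if "l < n * m" for l
    using s_ge[OF that] \<rho>_nonneg[of "l div m"] idx(1)[OF that] by simp
  have ordered: "u l \<le> s l'" if "l < n * m" "l' < n * m" "l < l'" for l l'
  proof (cases "l div m = l' div m")
    case True
    then have "l mod m < l' mod m"
      using that(3) by (metis div_mult_mod_eq nat_add_left_cancel_less)
    then show ?thesis
      unfolding s_def u_def True[symmetric] using idx(2)[OF that(2)] by (intro cl_mono \<tau>'_mono) auto
  next
    case False
    then have "Suc (l div m) \<le> l' div m" using div_le_mono[of l l' m] that(3) by simp
    then have "\<rho> (Suc (l div m)) \<le> \<rho> (l' div m)" using idx(1)[OF that(2)] by (intro \<rho>_le) auto
    then show ?thesis using u_le[OF that(1)] s_ge[OF that(2)] by simp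
  qed
  have inside: "\<tau>' (l mod m) \<le> s l" "u l \<le> \<tau>' (Suc (l mod m))" if "l < n * m" "s l < u l" for l
    using that(2) u_le[OF that(1)] s_ge[OF that(1)] unfolding s_def u_def cl_def by (auto simp: max_def min_def split: if_splits)
  have c_F: "c l \<in> borel_measurable (F (s l))" if l: "l < n * m" for l
  proof (cases "s l < u l")
    case True
    have "\<xi>' (l mod m) \<in> borel_measurable (F (s l))"
    proof (cases "l mod m = 0 \<or> N < l mod m")
      case False
      then have "\<tau> (l mod m - 1) \<le> s l" using inside(1)[OF l True] by (simp add: \<tau>'_def)
      moreover have "l mod m - 1 < N" using False by auto
      ultimately have "\<xi> (l mod m - 1) \<in> borel_measurable (F (s l))"
        using measurable_F_mono[OF \<xi>_F] by blast
      moreover have "\<xi>' (l mod m) = \<xi> (l mod m - 1)" using False by (auto simp: \<xi>'_def)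
      ultimately show ?thesis by simp
    next
      case True
      then have "\<xi>' (l mod m) = (\<lambda>_. 0)" by (auto simp: \<xi>'_def)
      then show ?thesis by simp
    qed
    moreover have "w (l div m) \<in> borel_measurable (F (s l))" "h (l div m) \<in> borel_measurable (F (s l))"
      using w h idx(1)[OF l] s_ge[OF l] by (auto intro: measurable_F_mono)
    ultimately show ?thesis unfolding c_def by measurable
  next
    case False
    then have "c l = (\<lambda>_. 0)" by (auto simp: c_def)
    then show ?thesis by simp
  qed
  interpret steps: independent_steps M ?J "\<lambda>l. F (s l)" "\<lambda>l \<omega>. B (u l) \<omega> - B (s l) \<omega>" "\<lambda>l. u l - s l"
  proof (rule independent_steps_increments[where h = "\<lambda>_ x. x"])
    fix l assume "l \<in> ?J"
    then have "0 \<le> s l" "s l \<le> u l" using s_nonneg su by auto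
    from increment_moments[OF this]
    show "integrable M (\<lambda>\<omega>. (B (u l) \<omega> - B (s l) \<omega>)\<^sup>2)" "expectation (\<lambda>\<omega>. B (u l) \<omega> - B (s l) \<omega>) = 0"
      "expectation (\<lambda>\<omega>. (B (u l) \<omega> - B (s l) \<omega>)\<^sup>2) \<le> u l - s l"
      by (simp_all add: has_bochner_integral_iff)
  qed (use s_nonneg su ordered in auto)
  have increments: "(\<Sum>j<m. c (i * m + j) \<omega> * (B (u (i * m + j)) \<omega> - B (s (i * m + j)) \<omega>))
      = w i \<omega> * (simple_integral B N \<tau> \<xi> (\<rho> (Suc i)) \<omega> - simple_integral B N \<tau> \<xi> (\<rho> i) \<omega>
        - h i \<omega> * (B (\<rho> (Suc i)) \<omega> - B (\<rho> i) \<omega>))" if i: "i < n" for i \<omega>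
  proof -
    let ?d = "\<lambda>j. B (cl i (\<tau>' (Suc j))) \<omega> - B (cl i (\<tau>' j)) \<omega>"
    have "(\<Sum>j<m. c (i * m + j) \<omega> * (B (u (i * m + j)) \<omega> - B (s (i * m + j)) \<omega>))
        = (\<Sum>j<m. w i \<omega> * (\<xi>' j \<omega> * ?d j - h i \<omega> * ?d j))"
    proof (intro sum.cong refl)
      fix j assume "j \<in> {..<m}"
      then have dm: "(i * m + j) div m = i" "(i * m + j) mod m = j" by auto
      have "i * m + j < Suc i * m" using \<open>j \<in> {..<m}\<close> by simp
      also have "\<dots> \<le> n * m" using i by (intro mult_right_mono) auto
      finally have "s (i * m + j) \<le> u (i * m + j)" by (rule su)
      then have "c (i * m + j) \<omega> * (B (u (i * m + j)) \<omega> - B (s (i * m + j)) \<omega>)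
        = w i \<omega> * (\<xi>' j \<omega> - h i \<omega>) * (B (u (i * m + j)) \<omega> - B (s (i * m + j)) \<omega>)"
        unfolding c_def dm by auto
      then show "c (i * m + j) \<omega> * (B (u (i * m + j)) \<omega> - B (s (i * m + j)) \<omega>)
        = w i \<omega> * (\<xi>' j \<omega> * ?d j - h i \<omega> * ?d j)"
        unfolding s_def u_def dm by (simp add: algebra_simps)
    qed
    also have "\<dots> = w i \<omega> * ((\<Sum>j<m. \<xi>' j \<omega> * ?d j) - h i \<omega> * (\<Sum>j<m. ?d j))"
      by (simp only: sum_distrib_left sum_subtractf right_diff_distrib)
    also have "(\<Sum>j<m. ?d j) = B (\<rho> (Suc i)) \<omega> - B (\<rho> i) \<omega>"
    proof -
      have "cl i (\<tau>' m) = \<rho> (Suc i)"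
        using \<rho>_T[of "Suc i"] \<rho>(2)[OF i] i by (simp add: cl_def \<tau>'_def m_def)
      moreover have "cl i (\<tau>' 0) = \<rho> i"
        using \<rho>_nonneg[of i] i by (simp add: cl_def \<tau>'_def)
      ultimately show ?thesis by (subst sum_lessThan_telescope) simp
    qed
    also have "(\<Sum>j<m. \<xi>' j \<omega> * ?d j) = (\<Sum>j<N. \<xi> j \<omega> * (B (cl i (\<tau> (Suc j))) \<omega> - B (cl i (\<tau> j)) \<omega>))"
    proof -
      have "(\<Sum>j<m. \<xi>' j \<omega> * ?d j) = (\<Sum>j<Suc N. \<xi>' j \<omega> * ?d j)"
        unfolding m_def by (simp add: \<xi>'_def)
      also have "\<dots> = (\<Sum>j<N. \<xi>' (Suc j) \<omega> * ?d (Suc j))"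
        by (subst sum.lessThan_Suc_shift) (simp add: \<xi>'_def)
      also have "\<dots> = (\<Sum>j<N. \<xi> j \<omega> * (B (cl i (\<tau> (Suc j))) \<omega> - B (cl i (\<tau> j)) \<omega>))"
        by (intro sum.cong) (auto simp: \<xi>'_def \<tau>'_def)
      finally show ?thesis .
    qed
    also have "\<dots> = simple_integral B N \<tau> \<xi> (\<rho> (Suc i)) \<omega> - simple_integral B N \<tau> \<xi> (\<rho> i) \<omega>"
    proof -
      \<comment> \<open>Projecting a time onto an interval turns into a difference of stopped
        values, which is the form in which \<open>simple_integral\<close> at the two end points is
        written.\<close>
      have cl_eq: "B (cl i x) \<omega> = B (\<rho> i) \<omega> + (B (min x (\<rho> (Suc i))) \<omega> - B (min x (\<rho> i)) \<omega>)" for x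
        using \<rho>(2)[OF i] by (auto simp: cl_def min_def max_def)
      show ?thesis
        unfolding simple_integral_def sum_subtractf[symmetric] cl_eq
        by (intro sum.cong refl) (simp add: algebra_simps)
    qed
    finally show ?thesis .
  qed
  have blocks: "(\<Sum>l\<in>{l\<in>?J. blk (l div m) = b}. c l \<omega> * (B (u l) \<omega> - B (s l) \<omega>))
      = block_error n \<rho> w h (simple_integral B N \<tau> \<xi>) blk b \<omega>" for b \<omega>
  proof -
    let ?f = "\<lambda>l. c l \<omega> * (B (u l) \<omega> - B (s l) \<omega>)"
    have "(\<Sum>l\<in>{l\<in>?J. blk (l div m) = b}. ?f l)
        = (\<Sum>l<n * m. if blk (l div m) = b then ?f (l div m * m + l mod m) else 0)"
      unfolding div_mult_mod_eq by (rule sum.inter_filter) simp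
    also have "\<dots> = (\<Sum>i<n. \<Sum>j<m. if blk i = b then ?f (i * m + j) else 0)"
      by (rule sum_div_mod[of "\<lambda>i j. if blk i = b then ?f (i * m + j) else 0"])
    also have "\<dots> = (\<Sum>i<n. if blk i = b then \<Sum>j<m. ?f (i * m + j) else 0)"
      by (intro sum.cong) auto
    also have "\<dots> = (\<Sum>i\<in>{i\<in>{..<n}. blk i = b}. \<Sum>j<m. ?f (i * m + j))"
      by (rule sum.inter_filter[symmetric]) simp
    also have "\<dots> = block_error n \<rho> w h (simple_integral B N \<tau> \<xi>) blk b \<omega>"
      by (intro sum.cong refl increments) auto
    finally show ?thesis .
  qed
  have variance: "ennreal (\<Sum>l\<in>?J. (c l \<omega>)\<^sup>2 * (u l - s l)) \<le> R \<omega>" if "\<omega> \<in> space M" for \<omega>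
  proof -
    let ?f = "\<lambda>x. (simple_value n \<rho> w x \<omega> * simple_value N \<tau> \<xi> x \<omega> - simple_value n \<rho> (\<lambda>i \<omega>. w i \<omega> * h i \<omega>) x \<omega>)\<^sup>2"
    have sq_value: "(c l \<omega>)\<^sup>2 = ?f x" if l: "l < n * m" and x: "s l < x" "x \<le> u l" for l x
    proof -
      have lt: "s l < u l" using x by simp
      have i: "l div m < n" "\<rho> (l div m) < x" "x \<le> \<rho> (Suc (l div m))"
        using idx[OF l] s_ge[OF l] u_le[OF l] x by auto
      have x': "\<tau>' (l mod m) < x" "x \<le> \<tau>' (Suc (l mod m))"
        using inside[OF l lt] x by auto
      have "simple_value N \<tau> \<xi> x \<omega> = \<xi>' (l mod m) \<omega>"
      proof -
        consider "l mod m = 0" | j where "l mod m = Suc j" "j < N" | "l mod m = Suc N"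
          using idx(2)[OF l] by (cases "l mod m") (auto simp: m_def less_Suc_eq)
        then show ?thesis
        proof cases
          case 1
          then have "x \<le> \<tau> 0" using x' by (simp add: \<tau>'_def)
          then show ?thesis using 1 simple_value_outside[where \<tau> = \<tau> and n = N and s = x and \<xi> = \<xi> and \<omega> = \<omega>, OF \<tau>_mono] by (simp add: \<xi>'_def)
        next
          case 2
          then have "\<tau> j < x" "x \<le> \<tau> (Suc j)" using x' by (auto simp: \<tau>'_def)
          then show ?thesis using 2 simple_value_eq[where \<tau> = \<tau> and n = N and i = j and s = x and \<xi> = \<xi> and \<omega> = \<omega>, OF \<tau>_mono] by (simp add: \<xi>'_def)
        next
          case 3
          then have "\<tau> N < x" using x' by (simp add: \<tau>'_def)
          then show ?thesis using 3 simple_value_outside[where \<tau> = \<tau> and n = N and s = x and \<xi> = \<xi> and \<omega> = \<omega>, OF \<tau>_mono] by (simp add: \<xi>'_def)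
        qed
      qed
      moreover have "simple_value n \<rho> w' x \<omega> = w' (l div m) \<omega>" for w'
        by (rule simple_value_eq[OF \<rho>(2) i])
      ultimately show ?thesis using lt by (simp add: c_def right_diff_distrib)
    qed
    \<comment> \<open>The cells are half-open and ordered, so at most one indicator is nonzero at
      \<open>x\<close>, and on that cell all step functions are constant.\<close>
    have pointwise: "(\<Sum>l\<in>?J. ennreal ((c l \<omega>)\<^sup>2) * indicator {s l<..u l} x) \<le> ennreal (?f x) * indicator {0..T} x" for x
    proof (cases "\<exists>l\<in>?J. x \<in> {s l<..u l}")
      case True
      then obtain l where l: "l < n * m" "s l < x" "x \<le> u l" by auto
      have "indicator {s l'<..u l'} x = (if l' = l then 1 else 0 :: ennreal)" if "l' < n * m" for l'
        using ordered[OF that l(1)] ordered[OF l(1) that] l by (cases l' l rule: linorder_cases) auto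
      then have "(\<Sum>l\<in>?J. ennreal ((c l \<omega>)\<^sup>2) * indicator {s l<..u l} x)
          = (\<Sum>l'\<in>?J. if l' = l then ennreal ((c l \<omega>)\<^sup>2) else 0)"
        by (intro sum.cong) auto
      also have "\<dots> = ennreal ((c l \<omega>)\<^sup>2)" using l by simp
      also have "\<dots> = ennreal (?f x)" using sq_value[OF l] by simp
      finally show ?thesis
        using l s_nonneg[OF l(1)] u_le[OF l(1)] \<rho>_T[of "Suc (l div m)"] idx(1)[OF l(1)] by (simp add: indicator_def)
    next
      case False
      then have "(\<Sum>l\<in>?J. ennreal ((c l \<omega>)\<^sup>2) * indicator {s l<..u l} x) = 0"
        by (intro sum.neutral) (auto simp: indicator_def)
      then show ?thesis by simp
    qed
    have "ennreal (\<Sum>l\<in>?J. (c l \<omega>)\<^sup>2 * (u l - s l)) = (\<Sum>l\<in>?J. ennreal ((c l \<omega>)\<^sup>2 * (u l - s l)))"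
      using su by (intro sum_ennreal[symmetric]) auto
    also have "\<dots> = (\<Sum>l\<in>?J. \<integral>\<^sup>+x. ennreal ((c l \<omega>)\<^sup>2) * indicator {s l<..u l} x \<partial>lborel)"
      using su by (intro sum.cong refl) (simp add: nn_integral_cmult_indicator ennreal_mult)
    also have "\<dots> = (\<integral>\<^sup>+x. (\<Sum>l\<in>?J. ennreal ((c l \<omega>)\<^sup>2) * indicator {s l<..u l} x) \<partial>lborel)"
      by (intro nn_integral_sum[symmetric]) simp
    also have "\<dots> \<le> (\<integral>\<^sup>+x\<in>{0..T}. ennreal (?f x) \<partial>lborel)"
      by (intro nn_integral_mono pointwise)
    also have "\<dots> \<le> R \<omega>" by (rule le_R[OF that])
    finally show ?thesis .
  qed
  have "\<P>(\<omega> in M. \<epsilon> < L2_set (\<lambda>b. \<Sum>l\<in>{l\<in>?J. blk (l div m) = b}. c l \<omega> * (B (u l) \<omega> - B (s l) \<omega>)) A)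
    \<le> \<delta> / \<epsilon>\<^sup>2 + \<P>(\<omega> in M. \<delta> < (\<Sum>l\<in>?J. (c l \<omega>)\<^sup>2 * (u l - s l)))"
    by (rule steps.transform_estimate[OF c_F pos]) simp
  also have "\<P>(\<omega> in M. \<delta> < (\<Sum>l\<in>?J. (c l \<omega>)\<^sup>2 * (u l - s l))) \<le> \<P>(\<omega> in M. ennreal \<delta> < R \<omega>)"
  proof (rule measure_pred_mono)
    fix \<omega> assume "\<omega> \<in> space M" "\<delta> < (\<Sum>l\<in>?J. (c l \<omega>)\<^sup>2 * (u l - s l))"
    then have "ennreal \<delta> < ennreal (\<Sum>l\<in>?J. (c l \<omega>)\<^sup>2 * (u l - s l))"
      using pos by (simp add: ennreal_lessI)
    also have "\<dots> \<le> R \<omega>" by (rule variance) fact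
    finally show "ennreal \<delta> < R \<omega>" .
  qed (use R in measurable)
  finally show ?thesis unfolding blocks by simp
qed

section \<open>Passage from simple integrands to general ones\<close>

lemma simple_value_square_le:
  assumes mono: "\<And>i. i < n \<Longrightarrow> \<tau> i \<le> \<tau> (Suc i)"
  shows "(simple_value n \<tau> \<xi> s \<omega>)\<^sup>2 \<le> (\<Sum>i<n. (\<xi> i \<omega>)\<^sup>2)"
proof (cases "\<tau> 0 < s \<and> s \<le> \<tau> n")
  case True
  then obtain i where i: "i < n" "\<tau> i < s" "s \<le> \<tau> (Suc i)"
    using step_times_cover[of \<tau> s n] by blast
  then have "simple_value n \<tau> \<xi> s \<omega> = \<xi> i \<omega>" by (intro simple_value_eq mono)
  moreover have "(\<xi> i \<omega>)\<^sup>2 \<le> (\<Sum>i<n. (\<xi> i \<omega>)\<^sup>2)"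
    using i by (intro member_le_sum) auto
  ultimately show ?thesis by simp
next
  case False
  then have "simple_value n \<tau> \<xi> s \<omega> = 0" by (intro simple_value_outside mono) auto
  then show ?thesis by (simp add: sum_nonneg)
qed

lemma borel_measurable_simple_value:
  assumes "\<And>i. i < n \<Longrightarrow> \<xi> i \<in> borel_measurable M"
  shows "(\<lambda>(s, \<omega>). simple_value n \<tau> \<xi> s \<omega>) \<in> borel_measurable (borel \<Otimes>\<^sub>M M)"
  unfolding simple_value_def case_prod_beta'
proof (intro borel_measurable_sum borel_measurable_times)
  fix i assume "i \<in> {..<n}"
  then show "(\<lambda>p. \<xi> i (snd p)) \<in> borel_measurable (borel \<Otimes>\<^sub>M M)"
    using assms by (intro measurable_compose[OF measurable_snd]) auto
qed measurable

context brownian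
begin

text \<open>The block errors involve \<open>I\<close> at finitely many times only, where it is
  approximated in probability by simple integrals. Half of the threshold
  \<open>2 * \<epsilon>\<close> absorbs this approximation. The factor 4 arises from two halvings of
  the variance budget: one for comparing the squared integrands, one for splitting their
  sum.\<close>

lemma ito_block_estimate:
  fixes w h :: "nat \<Rightarrow> 'a \<Rightarrow> real" and \<rho> :: "nat \<Rightarrow> real" and blk :: "nat \<Rightarrow> nat"
  assumes ito: "has_ito_integral M F B H I"
    and \<rho>: "0 \<le> \<rho> 0" "\<And>i. i < n \<Longrightarrow> \<rho> i \<le> \<rho> (Suc i)" "\<rho> n \<le> T"
    and w: "\<And>i. i < n \<Longrightarrow> w i \<in> borel_measurable (F (\<rho> i))"
    and h: "\<And>i. i < n \<Longrightarrow> h i \<in> borel_measurable (F (\<rho> i))"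
    and pos: "0 < \<epsilon>" "0 < \<delta>"
  defines "G \<equiv> \<lambda>\<omega>. \<integral>\<^sup>+s\<in>{0..T}. ennreal ((simple_value n \<rho> w s \<omega> * H s \<omega>
        - simple_value n \<rho> (\<lambda>i \<omega>. w i \<omega> * h i \<omega>) s \<omega>)\<^sup>2) \<partial>lborel"
  shows borel_measurable_block_error: "G \<in> borel_measurable M"
    and "\<P>(\<omega> in M. 2 * \<epsilon> < L2_set (\<lambda>b. block_error n \<rho> w h I blk b \<omega>) A)
    \<le> 4 * \<delta> / \<epsilon>\<^sup>2 + \<P>(\<omega> in M. ennreal \<delta> < G \<omega>)"
proof -
  note \<rho>_le = step_times_mono[where \<tau> = \<rho> and n = n, OF \<rho>(2)]
  have \<rho>_T: "\<rho> i \<in> {0..T}" if "i \<le> n" for i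
    using \<rho>_le[of 0 i] \<rho>_le[of i n] \<rho> that by simp
  have "0 \<le> T" using \<rho>_T[of 0] by simp
  have prog: "progressively_measurable F H" using ito by (simp add: has_ito_integral_def)
  have approximation: "\<exists>n \<tau> \<xi>. (\<forall>k. simple_process F (n k) (\<tau> k) (\<xi> k)) \<and>
      null_in_probability M
        (\<lambda>k \<omega>. square_error (n k) (\<tau> k) (\<xi> k) H T \<omega>) \<and>
      (\<forall>t\<in>{0..T}. null_in_probability M
        (\<lambda>k \<omega>. ennreal \<bar>simple_integral B (n k) (\<tau> k) (\<xi> k) t \<omega> - I t \<omega>\<bar>))"
    using ito \<open>0 \<le> T\<close> by (simp add: has_ito_integral_def)
  obtain N \<tau> \<xi> where "\<forall>k. simple_process F (N k) (\<tau> k) (\<xi> k)"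
    and Err_null: "null_in_probability M (\<lambda>k \<omega>. square_error (N k) (\<tau> k) (\<xi> k) H T \<omega>)"
    and "\<forall>t\<in>{0..T}. null_in_probability M
          (\<lambda>k \<omega>. ennreal \<bar>simple_integral B (N k) (\<tau> k) (\<xi> k) t \<omega> - I t \<omega>\<bar>)"
    using approximation by (elim exE conjE) (rule that, assumption+)
  then have S: "\<And>k. simple_process F (N k) (\<tau> k) (\<xi> k)"
    and I_null: "\<And>t. t \<in> {0..T} \<Longrightarrow> null_in_probability M
          (\<lambda>k \<omega>. ennreal \<bar>simple_integral B (N k) (\<tau> k) (\<xi> k) t \<omega> - I t \<omega>\<bar>)"
    by auto
  have w_M: "w i \<in> borel_measurable M" and h_M: "h i \<in> borel_measurable M" if "i < n" for i
    using w h that by (auto intro: measurable_F_M)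
  have V_M: "(\<lambda>(s, \<omega>). simple_value n \<rho> w s \<omega>) \<in> borel_measurable (borel \<Otimes>\<^sub>M M)"
    "(\<lambda>(s, \<omega>). simple_value n \<rho> (\<lambda>i \<omega>. w i \<omega> * h i \<omega>) s \<omega>) \<in> borel_measurable (borel \<Otimes>\<^sub>M M)"
    using w_M h_M by (auto intro!: borel_measurable_simple_value borel_measurable_times)
  show G_M [measurable]: "G \<in> borel_measurable M"
    unfolding G_def
  proof (rule borel_measurable_nn_integral_progressive[where
        f = "\<lambda>x s \<omega>. (simple_value n \<rho> w s \<omega> * x - simple_value n \<rho> (\<lambda>i \<omega>. w i \<omega> * h i \<omega>) s \<omega>)\<^sup>2",
        OF prog \<open>0 \<le> T\<close> subalgebra_F])
    show "(\<lambda>(x, s, \<omega>). (simple_value n \<rho> w s \<omega> * x - simple_value n \<rho> (\<lambda>i \<omega>. w i \<omega> * h i \<omega>) s \<omega>)\<^sup>2)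
        \<in> borel_measurable (borel \<Otimes>\<^sub>M borel \<Otimes>\<^sub>M M)"
      using V_M[THEN measurable_compose[OF measurable_snd, of _ "borel \<Otimes>\<^sub>M M"], of borel]
      unfolding case_prod_beta'
      by (intro borel_measurable_power borel_measurable_diff borel_measurable_times measurable_fst)
  qed
  define Wm where "Wm \<omega> = (\<Sum>i<n. (w i \<omega>)\<^sup>2)" for \<omega>
  have Wm_M [measurable]: "Wm \<in> borel_measurable M"
    unfolding Wm_def using w_M by (intro borel_measurable_sum borel_measurable_power) auto
  define Err where "Err k \<omega> = (square_error (N k) (\<tau> k) (\<xi> k) H T \<omega>)" for k \<omega>
  have Err_M [measurable]: "Err k \<in> borel_measurable M" for k
    unfolding Err_def by (intro borel_measurable_simple_error S prog \<open>0 \<le> T\<close>)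
  have split: "(\<integral>\<^sup>+s\<in>{0..T}. ennreal ((simple_value n \<rho> w s \<omega> * simple_value (N k) (\<tau> k) (\<xi> k) s \<omega>
        - simple_value n \<rho> (\<lambda>i \<omega>. w i \<omega> * h i \<omega>) s \<omega>)\<^sup>2) \<partial>lborel)
      \<le> 2 * G \<omega> + ennreal (2 * Wm \<omega>) * Err k \<omega>" if \<omega>: "\<omega> \<in> space M" for k \<omega>
  proof -
    define V where "V s = simple_value n \<rho> w s \<omega>" for s
    define U where "U s = simple_value n \<rho> (\<lambda>i \<omega>. w i \<omega> * h i \<omega>) s \<omega>" for s
    define S' where "S' s = simple_value (N k) (\<tau> k) (\<xi> k) s \<omega>" for s
    define H' where "H' s = H (max 0 (min s T)) \<omega>" for s
    have [measurable]: "V \<in> borel_measurable borel" "U \<in> borel_measurable borel" "S' \<in> borel_measurable borel"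
      unfolding V_def U_def S'_def simple_value_def by measurable
    have "(\<lambda>s. (s, \<omega>)) \<in> borel \<rightarrow>\<^sub>M borel \<Otimes>\<^sub>M F T" using \<omega> by (simp add: space_F)
    from measurable_compose[OF this progressively_measurable_clamp[OF prog \<open>0 \<le> T\<close>]]
    have [measurable]: "H' \<in> borel_measurable borel" unfolding H'_def by simp
    have H'_eq: "H s \<omega> = H' s" if "s \<in> {0..T}" for s using that by (simp add: H'_def)
    have G_eq: "G \<omega> = (\<integral>\<^sup>+s. ennreal ((V s * H' s - U s)\<^sup>2) * indicator {0..T} s \<partial>lborel)"
      unfolding G_def V_def U_def by (intro nn_integral_cong) (auto simp: H'_eq indicator_def)
    have Err_eq: "Err k \<omega> = (\<integral>\<^sup>+s. ennreal ((S' s - H' s)\<^sup>2) * indicator {0..T} s \<partial>lborel)"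
      unfolding Err_def S'_def by (intro nn_integral_cong) (auto simp: H'_eq indicator_def)
    have "0 \<le> Wm \<omega>" by (simp add: Wm_def sum_nonneg)
    have pointwise: "ennreal ((V s * S' s - U s)\<^sup>2) \<le> 2 * ennreal ((V s * H' s - U s)\<^sup>2)
        + ennreal (2 * Wm \<omega>) * ennreal ((S' s - H' s)\<^sup>2)" for s
    proof -
      \<comment> \<open>The left base is the sum of \<open>V * H' - U\<close> and
        \<open>V * (S' - H')\<close>; the square of their difference being nonnegative gives the
        factor 2.\<close>
      have "(V s * S' s - U s)\<^sup>2 \<le> 2 * (V s * H' s - U s)\<^sup>2 + 2 * (V s * (S' s - H' s))\<^sup>2"
        using zero_le_power2[of "(V s * H' s - U s) - V s * (S' s - H' s)"]
        by (simp add: power2_eq_square algebra_simps)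
      also have "(V s * (S' s - H' s))\<^sup>2 \<le> Wm \<omega> * (S' s - H' s)\<^sup>2"
        unfolding power_mult_distrib V_def Wm_def
        by (intro mult_right_mono simple_value_square_le \<rho>(2)) auto
      finally have "(V s * S' s - U s)\<^sup>2 \<le> 2 * (V s * H' s - U s)\<^sup>2 + 2 * Wm \<omega> * (S' s - H' s)\<^sup>2"
        by simp
      then have "ennreal ((V s * S' s - U s)\<^sup>2) \<le> ennreal (2 * (V s * H' s - U s)\<^sup>2 + 2 * Wm \<omega> * (S' s - H' s)\<^sup>2)"
        by (rule ennreal_leI)
      then show ?thesis
        using \<open>0 \<le> Wm \<omega>\<close> by (simp add: ennreal_plus ennreal_mult)
    qed
    have "(\<integral>\<^sup>+s\<in>{0..T}. ennreal ((V s * S' s - U s)\<^sup>2) \<partial>lborel)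
      \<le> (\<integral>\<^sup>+s. 2 * (ennreal ((V s * H' s - U s)\<^sup>2) * indicator {0..T} s)
        + ennreal (2 * Wm \<omega>) * (ennreal ((S' s - H' s)\<^sup>2) * indicator {0..T} s) \<partial>lborel)"
      using pointwise by (intro nn_integral_mono) (auto simp: indicator_def)
    also have "\<dots> = 2 * G \<omega> + ennreal (2 * Wm \<omega>) * Err k \<omega>"
      unfolding G_eq Err_eq by (simp add: nn_integral_add nn_integral_cmult)
    finally show ?thesis unfolding V_def U_def S'_def .
  qed
  let ?x = "\<lambda>b \<omega>. block_error n \<rho> w h I blk b \<omega>"
  let ?SI = "\<lambda>k t. simple_integral B (N k) (\<tau> k) (\<xi> k) t"
  let ?y = "\<lambda>k b \<omega>. block_error n \<rho> w h (?SI k) blk b \<omega>"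
  \<comment> \<open>A finite sum of approximation errors at the times of \<open>\<rho>\<close>; by
    the triangle inequality it dominates the distance between the two norms of block errors.\<close>
  define Z where "Z k \<omega> = (\<Sum>b\<in>A. \<Sum>i\<in>{i\<in>{..<n}. blk i = b}. ennreal \<bar>w i \<omega>\<bar> *
      (ennreal \<bar>?SI k (\<rho> (Suc i)) \<omega> - I (\<rho> (Suc i)) \<omega>\<bar> + ennreal \<bar>?SI k (\<rho> i) \<omega> - I (\<rho> i) \<omega>\<bar>))" for k \<omega>
  have Z_null: "null_in_probability M Z"
    unfolding Z_def using w_M
    by (intro null_in_probability_sum null_in_probability_mult_fixed null_in_probability_add
        I_null \<rho>_T borel_measurable_abs) auto
  then have Z_M [measurable]: "Z k \<in> borel_measurable M" for k by (simp add: null_in_probability_def)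
  have B_M: "B (\<rho> i) \<in> borel_measurable M" if "i \<le> n" for i
    using \<rho>_T[OF that] by (auto intro: measurable_brownian)
  have SI_M: "?SI k (\<rho> i) \<in> borel_measurable M" if "i \<le> n" for k i
  proof -
    have "0 \<le> \<tau> k j" if "j \<le> N k" for j
      using S[of k] step_times_mono[of "N k" "\<tau> k" 0 j] that by (auto simp: simple_process_def)
    then have "B (min (\<tau> k j) (\<rho> i)) \<in> borel_measurable M" if "j \<le> N k" for j
      using \<rho>_T[OF \<open>i \<le> n\<close>] that by (intro measurable_brownian) auto
    then show ?thesis
      unfolding simple_integral_def using simple_process_measurable[OF S]
      by (intro borel_measurable_sum borel_measurable_times borel_measurable_diff) auto
  qed
  have y_M [measurable]: "?y k b \<in> borel_measurable M" for k b
    using w_M h_M SI_M B_M by (intro borel_measurable_sum borel_measurable_times borel_measurable_diff) auto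
  have close: "ennreal (L2_set (\<lambda>b. ?x b \<omega>) A) \<le> ennreal (L2_set (\<lambda>b. ?y k b \<omega>) A) + Z k \<omega>" for k \<omega>
  proof -
    let ?z = "\<lambda>i. \<bar>w i \<omega>\<bar> *
      (\<bar>?SI k (\<rho> (Suc i)) \<omega> - I (\<rho> (Suc i)) \<omega>\<bar> + \<bar>?SI k (\<rho> i) \<omega> - I (\<rho> i) \<omega>\<bar>)"
    have "L2_set (\<lambda>b. ?x b \<omega>) A = L2_set (\<lambda>b. ?y k b \<omega> + (?x b \<omega> - ?y k b \<omega>)) A"
      by simp
    also have "\<dots> \<le> L2_set (\<lambda>b. ?y k b \<omega>) A + L2_set (\<lambda>b. ?x b \<omega> - ?y k b \<omega>) A"
      by (rule L2_set_triangle_ineq)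
    also have "L2_set (\<lambda>b. ?x b \<omega> - ?y k b \<omega>) A \<le> (\<Sum>b\<in>A. \<bar>?x b \<omega> - ?y k b \<omega>\<bar>)"
      by (rule L2_set_le_sum_abs)
    also have "\<dots> \<le> (\<Sum>b\<in>A. \<Sum>i\<in>{i\<in>{..<n}. blk i = b}. ?z i)"
    proof (intro sum_mono)
      fix b
      have "\<bar>?x b \<omega> - ?y k b \<omega>\<bar> = \<bar>\<Sum>i\<in>{i\<in>{..<n}. blk i = b}. w i \<omega> *
        ((?SI k (\<rho> i) \<omega> - I (\<rho> i) \<omega>) - (?SI k (\<rho> (Suc i)) \<omega> - I (\<rho> (Suc i)) \<omega>))\<bar>"
        unfolding sum_subtractf[symmetric] by (intro arg_cong[of _ _ abs] sum.cong refl) (simp add: algebra_simps)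
      also have "\<dots> \<le> (\<Sum>i\<in>{i\<in>{..<n}. blk i = b}. \<bar>w i \<omega> *
        ((?SI k (\<rho> i) \<omega> - I (\<rho> i) \<omega>) - (?SI k (\<rho> (Suc i)) \<omega> - I (\<rho> (Suc i)) \<omega>))\<bar>)"
        by (rule sum_abs)
      also have "\<dots> \<le> (\<Sum>i\<in>{i\<in>{..<n}. blk i = b}. \<bar>w i \<omega>\<bar> *
        (\<bar>?SI k (\<rho> (Suc i)) \<omega> - I (\<rho> (Suc i)) \<omega>\<bar> + \<bar>?SI k (\<rho> i) \<omega> - I (\<rho> i) \<omega>\<bar>))"
        unfolding abs_mult by (intro sum_mono mult_left_mono) auto
      finally show "\<bar>?x b \<omega> - ?y k b \<omega>\<bar> \<le> \<dots>" .
    qed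
    finally have "L2_set (\<lambda>b. ?x b \<omega>) A \<le> L2_set (\<lambda>b. ?y k b \<omega>) A + (\<Sum>b\<in>A. \<Sum>i\<in>{i\<in>{..<n}. blk i = b}. ?z i)"
      by simp
    then have "ennreal (L2_set (\<lambda>b. ?x b \<omega>) A)
        \<le> ennreal (L2_set (\<lambda>b. ?y k b \<omega>) A + (\<Sum>b\<in>A. \<Sum>i\<in>{i\<in>{..<n}. blk i = b}. ?z i))"
      by (rule ennreal_leI)
    also have "\<dots> = ennreal (L2_set (\<lambda>b. ?y k b \<omega>) A) + ennreal (\<Sum>b\<in>A. \<Sum>i\<in>{i\<in>{..<n}. blk i = b}. ?z i)"
      by (intro ennreal_plus L2_set_nonneg sum_nonneg) auto
    also have "ennreal (\<Sum>b\<in>A. \<Sum>i\<in>{i\<in>{..<n}. blk i = b}. ?z i)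
        = (\<Sum>b\<in>A. ennreal (\<Sum>i\<in>{i\<in>{..<n}. blk i = b}. ?z i))"
      by (intro sum_ennreal[symmetric] sum_nonneg) auto
    also have "\<dots> = (\<Sum>b\<in>A. \<Sum>i\<in>{i\<in>{..<n}. blk i = b}. ennreal (?z i))"
      by (intro sum.cong refl sum_ennreal[symmetric]) auto
    also have "\<dots> = Z k \<omega>"
      unfolding Z_def by (intro sum.cong refl) (simp add: ennreal_mult ennreal_plus)
    finally show ?thesis .
  qed
  let ?p = "\<lambda>k. \<P>(\<omega> in M. ennreal (2 * \<delta>) < ennreal (2 * Wm \<omega>) * Err k \<omega>)"
  let ?q = "\<lambda>k. \<P>(\<omega> in M. ennreal \<epsilon> < Z k \<omega>)"
  have bound: "\<P>(\<omega> in M. 2 * \<epsilon> < L2_set (\<lambda>b. ?x b \<omega>) A)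
    \<le> 4 * \<delta> / \<epsilon>\<^sup>2 + \<P>(\<omega> in M. ennreal \<delta> < G \<omega>) + (?p k + ?q k)" for k
  proof -
    have L2_M [measurable]: "(\<lambda>\<omega>. L2_set (\<lambda>b. ?y k b \<omega>) A) \<in> borel_measurable M"
      unfolding L2_set_def by measurable
    have "\<P>(\<omega> in M. 2 * \<epsilon> < L2_set (\<lambda>b. ?x b \<omega>) A)
      \<le> \<P>(\<omega> in M. ennreal (2 * \<epsilon>) < ennreal (L2_set (\<lambda>b. ?y k b \<omega>) A) + Z k \<omega>)"
    proof (rule measure_pred_mono)
      fix \<omega> assume "2 * \<epsilon> < L2_set (\<lambda>b. ?x b \<omega>) A"
      then have "ennreal (2 * \<epsilon>) < ennreal (L2_set (\<lambda>b. ?x b \<omega>) A)"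
        using pos by (simp add: ennreal_lessI)
      also note close[of \<omega> k]
      finally show "ennreal (2 * \<epsilon>) < ennreal (L2_set (\<lambda>b. ?y k b \<omega>) A) + Z k \<omega>" .
    qed measurable
    also have "\<dots> \<le> \<P>(\<omega> in M. ennreal \<epsilon> < ennreal (L2_set (\<lambda>b. ?y k b \<omega>) A)) + ?q k"
      by (intro measure_sum_gt_le measurable_compose[OF L2_M measurable_ennreal] Z_M pos)
    also have "\<P>(\<omega> in M. ennreal \<epsilon> < ennreal (L2_set (\<lambda>b. ?y k b \<omega>) A))
        = \<P>(\<omega> in M. \<epsilon> < L2_set (\<lambda>b. ?y k b \<omega>) A)"
      using pos by (simp add: ennreal_less_iff)
    \<comment> \<open>The budget \<open>4 * \<delta>\<close> is later divided evenly between
      \<open>2 * G\<close> and the approximation error, leaving the threshold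
      \<open>\<delta>\<close> for \<open>G\<close>.\<close>
    also have "\<dots> \<le> (2 * (2 * \<delta>)) / \<epsilon>\<^sup>2
        + \<P>(\<omega> in M. ennreal (2 * (2 * \<delta>)) < 2 * G \<omega> + ennreal (2 * Wm \<omega>) * Err k \<omega>)"
      using pos G_M by (intro simple_block_estimate[OF S \<rho> w h]) (auto intro: split)
    also have "\<P>(\<omega> in M. ennreal (2 * (2 * \<delta>)) < 2 * G \<omega> + ennreal (2 * Wm \<omega>) * Err k \<omega>)
        \<le> \<P>(\<omega> in M. ennreal (2 * \<delta>) < 2 * G \<omega>) + ?p k"
      using pos by (intro measure_sum_gt_le) auto
    also have "\<P>(\<omega> in M. ennreal (2 * \<delta>) < 2 * G \<omega>) \<le> \<P>(\<omega> in M. ennreal \<delta> < G \<omega>)"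
    proof (rule measure_pred_mono, rule ccontr)
      fix \<omega> assume "ennreal (2 * \<delta>) < 2 * G \<omega>" "\<not> ennreal \<delta> < G \<omega>"
      then have "2 * G \<omega> \<le> 2 * ennreal \<delta>" by (intro mult_left_mono) auto
      also have "\<dots> = ennreal (2 * \<delta>)" using pos by (simp add: ennreal_mult)
      finally show False using \<open>ennreal (2 * \<delta>) < 2 * G \<omega>\<close> by (simp add: not_less)
    qed measurable
    finally show ?thesis by (simp add: add.assoc)
  qed
  have "?p \<longlonglongrightarrow> 0"
    using null_in_probability_mult_fixed[OF Err_null[folded Err_def], of "\<lambda>\<omega>. 2 * Wm \<omega>"] pos
    by (simp add: null_in_probability_def)
  moreover have "?q \<longlonglongrightarrow> 0" using Z_null pos by (simp add: null_in_probability_def)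
  ultimately have "(\<lambda>k. 4 * \<delta> / \<epsilon>\<^sup>2 + \<P>(\<omega> in M. ennreal \<delta> < G \<omega>) + (?p k + ?q k))
      \<longlonglongrightarrow> 4 * \<delta> / \<epsilon>\<^sup>2 + \<P>(\<omega> in M. ennreal \<delta> < G \<omega>) + (0 + 0)"
    by (intro tendsto_intros)
  then show "\<P>(\<omega> in M. 2 * \<epsilon> < L2_set (\<lambda>b. ?x b \<omega>) A)
    \<le> 4 * \<delta> / \<epsilon>\<^sup>2 + \<P>(\<omega> in M. ennreal \<delta> < G \<omega>)"
    \<comment> \<open>The left side does not depend on the index \<open>k\<close> of the
      approximation, so the two vanishing probabilities can be removed in the limit.\<close>
    using LIMSEQ_le_const[of _ "4 * \<delta> / \<epsilon>\<^sup>2 + \<P>(\<omega> in M. ennreal \<delta> < G \<omega>) + (0 + 0)"] bound by fastforce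
qed

end

text \<open>Along a path \<open>W\<close> is bounded and \<open>H\<close> uniformly continuous on
  \<open>{0..T}\<close>, so the integral that controls the block errors tends to 0. The labels and
  the set of blocks are arbitrary for each grid.\<close>

lemma (in brownian) null_ito_grid:
  fixes blk :: "nat \<Rightarrow> nat \<Rightarrow> nat"
  assumes ito: "has_ito_integral M F B H I"
    and H: "adapted F H" "continuous_paths M H" and W: "adapted F W" "continuous_paths M W" and "0 \<le> T"
  shows "null_in_probability M (\<lambda>k \<omega>. ennreal (L2_set (\<lambda>b. \<Sum>i\<in>{i\<in>{..<Suc k}. blk k i = b}.
    W (grid T T k i) \<omega> * (I (grid T T k (Suc i)) \<omega> - I (grid T T k i) \<omega>
      - H (grid T T k i) \<omega> * (incr T T k i \<omega>))) (A k)))"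
    (is "null_in_probability M (\<lambda>k \<omega>. ennreal (?L k \<omega>))")
proof -
  have T: "0 \<le> T" "T \<le> T" using \<open>0 \<le> T\<close> by simp_all
  note g = grid_nonneg[OF T] grid_le[OF T] grid_mono[OF T]
  have g_step: "grid T T k i \<le> grid T T k (Suc i)" for k i using g(3)[of i "Suc i" k] by simp
  have H_F: "H (grid T T k i) \<in> borel_measurable (F (grid T T k i))"
    and W_F: "W (grid T T k i) \<in> borel_measurable (F (grid T T k i))" for k i
    using H W g(1) by (simp_all add: adapted_def)
  have I: "adapted F I" using ito by (simp add: has_ito_integral_def)
  define G where "G k \<omega> = (\<integral>\<^sup>+s\<in>{0..T}. ennreal ((simple_value (Suc k) (grid T T k) (\<lambda>i. W (grid T T k i)) s \<omega> * H s \<omega>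
    - simple_value (Suc k) (grid T T k) (\<lambda>i \<omega>. W (grid T T k i) \<omega> * H (grid T T k i) \<omega>) s \<omega>)\<^sup>2) \<partial>lborel)" for k \<omega>
  have "grid T T k 0 \<ge> 0" "grid T T k (Suc k) \<le> T" for k using g(1,2) by auto
  note block = ito_block_estimate[where n = "Suc k" and \<rho> = "grid T T k" and T = T
      and w = "\<lambda>i. W (grid T T k i)" and h = "\<lambda>i. H (grid T T k i)" for k,
      OF ito this(1) g_step this(2) W_F H_F, folded G_def]
  have G_null: "null_in_probability M G"
  proof (rule null_in_probability_AE[OF _ AE_I2])
    show "G k \<in> borel_measurable M" for k
      \<comment> \<open>Only measurability is extracted; the two thresholds are set to 1 to satisfy
        the positivity assumptions.\<close>
      using block(1)[of 1 1 k] unfolding G_def[symmetric] by simp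
    fix \<omega> assume \<omega>: "\<omega> \<in> space M"
    then have "continuous_on {0..} (\<lambda>s. W s \<omega>)" using W by (simp add: continuous_paths_def)
    then obtain C where C: "0 \<le> C" "\<And>s. 0 \<le> s \<Longrightarrow> s \<le> T \<Longrightarrow> \<bar>W s \<omega>\<bar> \<le> C"
      by (rule continuous_on_bounded_abs[where t = T]) blast
    have cont: "continuous_on {0..T} (\<lambda>s. H s \<omega>)"
      using H \<omega> unfolding continuous_paths_def by (auto intro: continuous_on_subset)
    show "(\<lambda>k. G k \<omega>) \<longlonglongrightarrow> 0"
      unfolding G_def
    proof (rule nn_integral_square_tendsto_0[OF T(1)])
      fix e :: real assume "0 < e"
      \<comment> \<open>The oscillation allowed for \<open>H\<close>, so that after multiplication
        by a weight of size at most \<open>C\<close> it stays below \<open>e\<close>; adding 1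
        avoids division by 0.\<close>
      define d where "d = e / (C + 1)"
      have d: "0 < d" "C * d \<le> e" using \<open>0 < e\<close> C(1) by (simp_all add: d_def field_simps)
      show "\<forall>\<^sub>F k in sequentially. \<forall>s. 0 < s \<longrightarrow> s \<le> T \<longrightarrow> \<bar>simple_value (Suc k) (grid T T k) (\<lambda>i. W (grid T T k i)) s \<omega> * H s \<omega>
            - simple_value (Suc k) (grid T T k) (\<lambda>i \<omega>. W (grid T T k i) \<omega> * H (grid T T k i) \<omega>) s \<omega>\<bar> \<le> e"
        using grid_oscillation[OF T cont d(1)]
      proof eventually_elim
        case (elim k)
        show ?case
        proof (intro allI impI)
          fix s assume that: "0 < s" "s \<le> T"
          have s: "grid T T k 0 < s" "s \<le> grid T T k (Suc k)"
            using that by (simp_all only: grid_0[OF T] grid_end[OF T])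
          obtain i where i: "i < Suc k" "grid T T k i < s" "s \<le> grid T T k (Suc i)"
            by (rule step_times_cover[OF s])
          have "\<bar>H s \<omega> - H (grid T T k i) \<omega>\<bar> \<le> d"
            by (rule bspec[OF bspec[OF spec[OF elim, of i]]]) (use i in auto)
          then have "\<bar>W (grid T T k i) \<omega>\<bar> * \<bar>H s \<omega> - H (grid T T k i) \<omega>\<bar> \<le> C * d"
            using C g by (intro mult_mono) auto
          moreover have "simple_value (Suc k) (grid T T k) w s \<omega> = w i \<omega>" for w
            by (rule simple_value_eq[OF g_step i])
          ultimately show "\<bar>simple_value (Suc k) (grid T T k) (\<lambda>i. W (grid T T k i)) s \<omega> * H s \<omega>
            - simple_value (Suc k) (grid T T k) (\<lambda>i \<omega>. W (grid T T k i) \<omega> * H (grid T T k i) \<omega>) s \<omega>\<bar> \<le> e"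
            using d(2) by (simp flip: right_diff_distrib add: abs_mult)
        qed
      qed
    qed
  qed
  show ?thesis
    unfolding null_in_probability_def
  proof (intro conjI allI impI)
    fix k
    have "(\<lambda>\<omega>. \<Sum>i\<in>{i\<in>{..<Suc k}. blk k i = b}. W (grid T T k i) \<omega> * (I (grid T T k (Suc i)) \<omega> - I (grid T T k i) \<omega>
      - H (grid T T k i) \<omega> * (incr T T k i \<omega>))) \<in> borel_measurable M" for b
      using I g(1) measurable_brownian
      by (intro borel_measurable_sum borel_measurable_times borel_measurable_diff measurable_F_M[OF H_F] measurable_F_M[OF W_F])
         (auto simp: adapted_def intro: measurable_F_M)
    then show "(\<lambda>\<omega>. ennreal (?L k \<omega>)) \<in> borel_measurable M"
      unfolding L2_set_def by measurable
  next
    fix \<epsilon> :: real assume "0 < \<epsilon>"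
    define \<epsilon>' where "\<epsilon>' = \<epsilon> / 2"
    have \<epsilon>': "0 < \<epsilon>'" "\<epsilon> = 2 * \<epsilon>'" using \<open>0 < \<epsilon>\<close> by (simp_all add: \<epsilon>'_def)
    show "(\<lambda>k. \<P>(\<omega> in M. ennreal \<epsilon> < ennreal (?L k \<omega>))) \<longlonglongrightarrow> 0"
    proof (rule LIMSEQ_I)
      fix e :: real assume "0 < e"
      define \<delta> where "\<delta> = e / 2 * \<epsilon>'\<^sup>2 / 4"
      have \<delta>: "0 < \<delta>" "4 * \<delta> / \<epsilon>'\<^sup>2 = e / 2" using \<open>0 < e\<close> \<epsilon>' by (simp_all add: \<delta>_def)
      have "(\<lambda>k. \<P>(\<omega> in M. ennreal \<delta> < G k \<omega>)) \<longlonglongrightarrow> 0"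
        using G_null \<delta>(1) by (simp add: null_in_probability_def)
      then have "\<exists>N. \<forall>k\<ge>N. norm (\<P>(\<omega> in M. ennreal \<delta> < G k \<omega>) - 0) < e / 2"
        using \<open>0 < e\<close> by (intro LIMSEQ_D) auto
      then obtain N where N: "\<And>k. k \<ge> N \<Longrightarrow> \<P>(\<omega> in M. ennreal \<delta> < G k \<omega>) < e / 2"
        by auto
      have "norm (\<P>(\<omega> in M. ennreal \<epsilon> < ennreal (?L k \<omega>)) - 0) < e" if "k \<ge> N" for k
      proof -
        have "\<P>(\<omega> in M. ennreal \<epsilon> < ennreal (?L k \<omega>)) = \<P>(\<omega> in M. 2 * \<epsilon>' < ?L k \<omega>)"
          using \<epsilon>' by (simp add: ennreal_less_iff del: sum.lessThan_Suc)
        also have "\<dots> \<le> 4 * \<delta> / \<epsilon>'\<^sup>2 + \<P>(\<omega> in M. ennreal \<delta> < G k \<omega>)"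
          by (rule block(2)[OF \<epsilon>'(1) \<delta>(1)])
        finally show ?thesis using N[OF that] \<delta>(2) by simp
      qed
      then show "\<exists>no. \<forall>k\<ge>no. norm (\<P>(\<omega> in M. ennreal \<epsilon> < ennreal (?L k \<omega>)) - 0) < e"
        by blast
    qed
  qed
qed

section \<open>Uniqueness for the linear equation\<close>

text \<open>The fractions \<open>i / (k + 1)\<close> form a countable dense set of times, so almost
  sure equality at each of them can be collected into one null set.\<close>

lemma eq_on_nonneg_reals:
  fixes f h :: "real \<Rightarrow> real"
  assumes f: "continuous_on {0..} f" and h: "continuous_on {0..} h"
    and eq: "\<And>i k. f (real i / real (Suc k)) = h (real i / real (Suc k))" and "0 \<le> t"
  shows "f t = h t"
proof -
  define r where "r k = real_of_int \<lfloor>t * real (Suc k)\<rfloor> / real (Suc k)" for k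
  have r: "r k = real (nat \<lfloor>t * real (Suc k)\<rfloor>) / real (Suc k)" for k
    using \<open>0 \<le> t\<close> by (simp add: r_def)
  have lim: "r \<longlonglongrightarrow> t" unfolding r_def by (rule floor_quotient_tendsto)
  have "\<forall>\<^sub>F k in sequentially. r k \<in> {0..}" by (simp add: r)
  then have "(\<lambda>k. f (r k)) \<longlonglongrightarrow> f t" "(\<lambda>k. h (r k)) \<longlonglongrightarrow> h t"
    using \<open>0 \<le> t\<close> by (auto intro!: continuous_on_tendsto_compose[OF f lim] continuous_on_tendsto_compose[OF h lim])
  moreover have "(\<lambda>k. f (r k)) = (\<lambda>k. h (r k))" by (simp only: r eq)
  ultimately show ?thesis using LIMSEQ_unique by metis
qed

lemma (in brownian) adapted_measurable: "adapted F Y \<Longrightarrow> 0 \<le> t \<Longrightarrow> Y t \<in> borel_measurable M"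
  unfolding adapted_def by (blast intro: measurable_F_M)

section \<open>The quotient of a solution by the explicit exponential\<close>

context linear_sde
begin

text \<open>The integrating factor: for a solution \<open>Y\<close> the product \<open>W * Y\<close>
  is to be shown constant in time, and \<open>W * X = x0\<close>.\<close>

definition W :: "real \<Rightarrow> 'a \<Rightarrow> real" where
  "W t \<omega> = inverse (g t * E t \<omega>)"

lemma adapted_W: "adapted F W"
  using adapted_E unfolding adapted_def W_def by auto

lemma continuous_W: "continuous_paths M W"
  unfolding continuous_paths_def W_def
proof
  fix \<omega> assume "\<omega> \<in> space M"
  then have "continuous_on {0..} (\<lambda>t. E t \<omega>)" using continuous_E by (simp add: continuous_paths_def)
  then show "continuous_on {0..} (\<lambda>t. inverse (g t * E t \<omega>))"
    using g_pos by (intro continuous_intros continuous_g) (auto simp: E_def less_le)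
qed

text \<open>The factor of the quotient minus its mean is centred with variance of second order, by
  \<open>quotient_step_bound\<close>. The summand 1 in \<open>L\<close> again keeps it positive when
  \<open>\<sigma> = 0\<close>.\<close>

lemma null_quotient_steps:
  assumes "0 \<le> t" "t \<le> c" and Z: "adapted F Z" "continuous_paths M Z"
  shows "null_in_probability M (\<lambda>k \<omega>. ennreal \<bar>\<Sum>i<Suc k. Z (grid c t k i) \<omega> *
    ((1 + \<sigma> * incr c t k i \<omega>)
        * exp (- (\<sigma> * incr c t k i \<omega>) + \<sigma>\<^sup>2 * mesh c t k i / 2)
      - exp (\<sigma>\<^sup>2 * mesh c t k i) * (1 - \<sigma>\<^sup>2 * mesh c t k i))\<bar>)"
proof (rule null_grid_transform[OF assms,
      where h = "\<lambda>\<delta> x. (1 + \<sigma> * x) * exp (- (\<sigma> * x) + \<sigma>\<^sup>2 * \<delta> / 2) - exp (\<sigma>\<^sup>2 * \<delta>) * (1 - \<sigma>\<^sup>2 * \<delta>)"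
        and w = "\<lambda>\<delta>. exp (3 * (\<sigma>\<^sup>2 * \<delta>)) * ((1 - 2 * (\<sigma>\<^sup>2 * \<delta>))\<^sup>2 + \<sigma>\<^sup>2 * \<delta>)
          - (exp (\<sigma>\<^sup>2 * \<delta>) * (1 - \<sigma>\<^sup>2 * \<delta>))\<^sup>2"
        and L = "(4 * exp (3 * (\<sigma>\<^sup>2 * c)) + 2 * exp (\<sigma>\<^sup>2 * c)) * (\<sigma>\<^sup>2)\<^sup>2 + 1"])
  show "0 < (4 * exp (3 * (\<sigma>\<^sup>2 * c)) + 2 * exp (\<sigma>\<^sup>2 * c)) * (\<sigma>\<^sup>2)\<^sup>2 + 1"
    by (intro add_nonneg_pos mult_nonneg_nonneg add_nonneg_nonneg) auto
  fix \<delta> :: real assume "0 \<le> \<delta>" "\<delta> \<le> c"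
  then have "exp (3 * (\<sigma>\<^sup>2 * \<delta>)) * ((1 - 2 * (\<sigma>\<^sup>2 * \<delta>))\<^sup>2 + \<sigma>\<^sup>2 * \<delta>) - (exp (\<sigma>\<^sup>2 * \<delta>) * (1 - \<sigma>\<^sup>2 * \<delta>))\<^sup>2
      \<le> (4 * exp (3 * (\<sigma>\<^sup>2 * c)) + 2 * exp (\<sigma>\<^sup>2 * c)) * (\<sigma>\<^sup>2 * \<delta>)\<^sup>2"
    by (intro quotient_step_bound mult_left_mono) auto
  then show "exp (3 * (\<sigma>\<^sup>2 * \<delta>)) * ((1 - 2 * (\<sigma>\<^sup>2 * \<delta>))\<^sup>2 + \<sigma>\<^sup>2 * \<delta>) - (exp (\<sigma>\<^sup>2 * \<delta>) * (1 - \<sigma>\<^sup>2 * \<delta>))\<^sup>2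
      \<le> ((4 * exp (3 * (\<sigma>\<^sup>2 * c)) + 2 * exp (\<sigma>\<^sup>2 * c)) * (\<sigma>\<^sup>2)\<^sup>2 + 1) * \<delta>\<^sup>2"
    using zero_le_power2[of \<delta>] unfolding power_mult_distrib distrib_right[of _ 1] mult.assoc[symmetric] by linarith
qed (assumption | rule quotient_step_expectation quotient_step_second_moment | simp)+

text \<open>The expected sum of squares is at most \<open>Q * t\<close> for every grid, being a
  discrete quadratic variation; Markov's inequality turns this into a bound uniform in
  \<open>k\<close>.\<close>

lemma inverse_steps_tight:
  assumes t: "0 \<le> t" "t \<le> c" and "0 < e"
  shows "\<exists>C>0. \<forall>k. \<P>(\<omega> in M. C < L2_set (\<lambda>i. exp (- (\<sigma> * incr c t k i \<omega>)
      + \<sigma>\<^sup>2 * mesh c t k i / 2) - 1) {..<Suc k}) \<le> e"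
proof -
  note g = grid_nonneg[OF t] grid_le[OF t] grid_mono[OF t] grid_step_nonneg[OF t]
  define \<zeta> where "\<zeta> k i \<omega> = exp (- (\<sigma> * incr c t k i \<omega>)
      + \<sigma>\<^sup>2 * mesh c t k i / 2) - 1" for k i \<omega>
  define Q where "Q = 3 * exp (3 * (\<sigma>\<^sup>2 * c)) * \<sigma>\<^sup>2"
  \<comment> \<open>Makes the Markov bound \<open>Q * t / C\<^sup>2\<close> at most
    \<open>e\<close>, while the summand 1 keeps \<open>C\<close> positive if \<open>Q * t\<close> is
    0.\<close>
  define C where "C = sqrt ((Q * t + 1) / e)"
  have "0 \<le> Q * t" using t by (simp add: Q_def)
  then have C: "0 < C" "(Q * t + 1) / C\<^sup>2 = e" using \<open>0 < e\<close> by (simp_all add: C_def)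
  have \<zeta>: "integrable M (\<lambda>\<omega>. (\<zeta> k i \<omega>)\<^sup>2)" "expectation (\<lambda>\<omega>. (\<zeta> k i \<omega>)\<^sup>2) \<le> Q * mesh c t k i" for k i
  proof -
    let ?q = "\<sigma>\<^sup>2 * mesh c t k i"
    have *: "has_bochner_integral M (\<lambda>\<omega>. (\<zeta> k i \<omega>)\<^sup>2) (exp (3 * ?q) - 2 * exp ?q + 1)"
      unfolding \<zeta>_def by (rule inverse_step_second_moment) (use g in auto)
    then show "integrable M (\<lambda>\<omega>. (\<zeta> k i \<omega>)\<^sup>2)" by (simp add: has_bochner_integral_iff)
    have "mesh c t k i \<le> c" using g(1)[of k i] g(2)[of k "Suc i"] t by linarith
    then have "exp (3 * ?q) - 2 * exp ?q + 1 \<le> 3 * exp (3 * (\<sigma>\<^sup>2 * c)) * ?q"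
      using g(4) by (intro inverse_step_bound mult_left_mono) auto
    then show "expectation (\<lambda>\<omega>. (\<zeta> k i \<omega>)\<^sup>2) \<le> Q * mesh c t k i"
      using * by (simp add: has_bochner_integral_iff Q_def mult.assoc)
  qed
  have "\<P>(\<omega> in M. C < L2_set (\<lambda>i. \<zeta> k i \<omega>) {..<Suc k}) \<le> e" for k
  proof -
    have int: "integrable M (\<lambda>\<omega>. \<Sum>i<Suc k. (\<zeta> k i \<omega>)\<^sup>2)"
      by (intro Bochner_Integration.integrable_sum \<zeta>)
    have "\<P>(\<omega> in M. C < L2_set (\<lambda>i. \<zeta> k i \<omega>) {..<Suc k})
        \<le> \<P>(\<omega> in M. C\<^sup>2 \<le> (\<Sum>i<Suc k. (\<zeta> k i \<omega>)\<^sup>2))"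
    proof (rule measure_pred_mono)
      fix \<omega> assume "C < L2_set (\<lambda>i. \<zeta> k i \<omega>) {..<Suc k}"
      then have "C\<^sup>2 \<le> (L2_set (\<lambda>i. \<zeta> k i \<omega>) {..<Suc k})\<^sup>2"
        using C(1) by (intro power_mono) auto
      also have "\<dots> = (\<Sum>i<Suc k. (\<zeta> k i \<omega>)\<^sup>2)"
        unfolding L2_set_def by (intro real_sqrt_pow2 sum_nonneg) simp
      finally show "C\<^sup>2 \<le> (\<Sum>i<Suc k. (\<zeta> k i \<omega>)\<^sup>2)" .
    qed (use borel_measurable_integrable[OF int] in measurable)
    also have "\<dots> \<le> expectation (\<lambda>\<omega>. \<Sum>i<Suc k. (\<zeta> k i \<omega>)\<^sup>2) / C\<^sup>2"
      using C(1) by (intro integral_Markov_inequality_measure[OF int, where A = "{}"]) (auto intro!: sum_nonneg simp del: sum.lessThan_Suc)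
    also have "expectation (\<lambda>\<omega>. \<Sum>i<Suc k. (\<zeta> k i \<omega>)\<^sup>2) = (\<Sum>i<Suc k. expectation (\<lambda>\<omega>. (\<zeta> k i \<omega>)\<^sup>2))"
      by (intro Bochner_Integration.integral_sum \<zeta>)
    also have "\<dots> \<le> (\<Sum>i<Suc k. Q * mesh c t k i)"
      by (intro sum_mono \<zeta>)
    also have "\<dots> = Q * t" by (simp only: sum_distrib_left[symmetric] sum_grid_step[OF t])
    also have "Q * t / C\<^sup>2 \<le> (Q * t + 1) / C\<^sup>2" by (intro divide_right_mono) auto
    finally show ?thesis using C(2) by (simp add: divide_right_mono)
  qed
  then show ?thesis using C(1) unfolding \<zeta>_def by blast
qed

text \<open>The increment of \<open>Z = W * Y\<close> over \<open>{0..T}\<close> splits into four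
  sums. \<open>S1\<close> is a centred transform, \<open>S2\<close> collects what vanishes along
  each path, and \<open>S3\<close> and \<open>S4\<close> contain the remainders \<open>R\<close> of
  the Ito integral. The total does not depend on the grid, so it is almost surely 0.\<close>

lemma solution_unique_at:
  assumes sol: "strong_solution M B (\<lambda>t x. m t * x) (\<lambda>t x. \<sigma> * x) x0 Y" and "0 \<le> T"
  shows "AE \<omega> in M. Y T \<omega> = X T \<omega>"
proof -
  have Y: "adapted F Y" "continuous_paths M Y" and Y_0: "AE \<omega> in M. Y 0 \<omega> = x0"
    using sol by (simp_all add: strong_solution_def)
  obtain J where ito: "has_ito_integral M F B (\<lambda>u \<omega>. \<sigma> * Y u \<omega>) J"
    and eq: "AE \<omega> in M. \<forall>t\<ge>0. Y t \<omega> = x0 + (LINT u:{0..t}|lborel. m u * Y u \<omega>) + J t \<omega>"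
    using sol unfolding strong_solution_def by blast
  have J: "adapted F J" "continuous_paths M J" using ito by (simp_all add: has_ito_integral_def)
  have T: "0 \<le> T" "T \<le> T" using \<open>0 \<le> T\<close> by simp_all
  note r = grid_nonneg[OF T] grid_le[OF T] grid_mono[OF T] grid_step_nonneg[OF T]
  let ?r = "grid T T"
  define Z where "Z t \<omega> = W t \<omega> * Y t \<omega>" for t \<omega>
  define K where "K t \<omega> = inverse (E t \<omega>)" for t \<omega>
  define V where "V t = inverse (g t)" for t
  define dB where "dB k i \<omega> = B (?r k (Suc i)) \<omega> - B (?r k i) \<omega>" for k i \<omega>
  define q where "q k i = \<sigma>\<^sup>2 * (?r k (Suc i) - ?r k i)" for k i
  define \<theta> where "\<theta> k i \<omega> = (1 + \<sigma> * dB k i \<omega>) * exp (- (\<sigma> * dB k i \<omega>) + q k i / 2)" for k i \<omega>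
  define \<mu> where "\<mu> k i = exp (q k i) * (1 - q k i)" for k i
  define \<zeta> where "\<zeta> k i \<omega> = exp (- (\<sigma> * dB k i \<omega>) + q k i / 2) - 1" for k i \<omega>
  define R where "R k i \<omega> = J (?r k (Suc i)) \<omega> - J (?r k i) \<omega> - \<sigma> * Y (?r k i) \<omega> * dB k i \<omega>" for k i \<omega>
  \<comment> \<open>The factor \<open>V = 1 / g\<close> removes the drift: ideally the increment of
    \<open>V * Y\<close> is \<open>V\<close> times the increment of \<open>J\<close>, and
    \<open>err\<close> is the discretisation error of this identity.\<close>
  define err where "err k i \<omega> = V (?r k (Suc i)) * Y (?r k (Suc i)) \<omega> - V (?r k i) * Y (?r k i) \<omega>
    - V (?r k i) * (J (?r k (Suc i)) \<omega> - J (?r k i) \<omega>)" for k i \<omega>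
  define S1 where "S1 k \<omega> = (\<Sum>i<Suc k. Z (?r k i) \<omega> * (\<theta> k i \<omega> - \<mu> k i))" for k \<omega>
  define S2 where "S2 k \<omega> = (\<Sum>i<Suc k. Z (?r k i) \<omega> * (\<mu> k i - 1) + err k i \<omega> * K (?r k (Suc i)) \<omega>)" for k \<omega>
  define S3 where "S3 k \<omega> = (\<Sum>i<Suc k. W (?r k i) \<omega> * R k i \<omega>)" for k \<omega>
  define S4 where "S4 k \<omega> = (\<Sum>i<Suc k. W (?r k i) \<omega> * R k i \<omega> * \<zeta> k i \<omega>)" for k \<omega>
  have W_eq: "W t \<omega> = V t * K t \<omega>" for t \<omega> by (simp add: W_def V_def K_def)
  have E_pos: "0 < E t \<omega>" for t \<omega> by (simp add: E_def)
  have K_step: "K (?r k (Suc i)) \<omega> = K (?r k i) \<omega> * (1 + \<zeta> k i \<omega>)" for k i \<omega>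
    unfolding K_def E_step[of "?r k (Suc i)" \<omega> "?r k i"] \<zeta>_def dB_def q_def
    by (simp add: inverse_mult_distrib flip: exp_minus)
  \<comment> \<open>With \<open>V * Y\<close> at the right end expressed through the left end, the
    new value of \<open>K\<close> is split as \<open>K * (1 + \<zeta>)\<close> except next to
    \<open>err\<close>, where a pathwise bound on \<open>K\<close> will do. The mean
    \<open>\<mu>\<close> is subtracted and added to centre \<open>\<theta>\<close>.\<close>
  have step: "Z (?r k (Suc i)) \<omega> - Z (?r k i) \<omega> = Z (?r k i) \<omega> * (\<theta> k i \<omega> - \<mu> k i)
      + (Z (?r k i) \<omega> * (\<mu> k i - 1) + err k i \<omega> * K (?r k (Suc i)) \<omega>)
      + W (?r k i) \<omega> * R k i \<omega> + W (?r k i) \<omega> * R k i \<omega> * \<zeta> k i \<omega>" for k i \<omega>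
  proof -
    have "V (?r k (Suc i)) * Y (?r k (Suc i)) \<omega>
        = V (?r k i) * (Y (?r k i) \<omega> * (1 + \<sigma> * dB k i \<omega>) + R k i \<omega>) + err k i \<omega>"
      by (simp add: err_def R_def algebra_simps)
    then have "Z (?r k (Suc i)) \<omega> = (V (?r k i) * (Y (?r k i) \<omega> * (1 + \<sigma> * dB k i \<omega>) + R k i \<omega>) + err k i \<omega>) * K (?r k (Suc i)) \<omega>"
      by (simp add: Z_def W_eq ac_simps)
    moreover have "\<theta> k i \<omega> = (1 + \<sigma> * dB k i \<omega>) * (1 + \<zeta> k i \<omega>)" by (simp add: \<theta>_def \<zeta>_def)
    ultimately show ?thesis
      unfolding K_step by (simp add: Z_def W_eq algebra_simps)
  qed
  have decomposition: "Z T \<omega> - Z 0 \<omega> = S1 k \<omega> + S2 k \<omega> + S3 k \<omega> + S4 k \<omega>" for k \<omega>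
  proof -
    have "Z T \<omega> - Z 0 \<omega> = (\<Sum>i<Suc k. Z (?r k (Suc i)) \<omega> - Z (?r k i) \<omega>)"
      by (subst sum_lessThan_telescope) (simp only: grid_0[OF T] grid_end[OF T])
    also have "\<dots> = S1 k \<omega> + S2 k \<omega> + S3 k \<omega> + S4 k \<omega>"
      unfolding step S1_def S2_def S3_def S4_def by (simp only: sum.distrib)
    finally show ?thesis .
  qed
  have Z: "adapted F Z" "continuous_paths M Z"
    using Y adapted_W continuous_W unfolding Z_def adapted_def continuous_paths_def
    by (auto intro!: borel_measurable_times continuous_on_mult)
  have H: "adapted F (\<lambda>u \<omega>. \<sigma> * Y u \<omega>)" "continuous_paths M (\<lambda>u \<omega>. \<sigma> * Y u \<omega>)"
    using Y by (auto simp: adapted_def continuous_paths_def intro!: continuous_intros)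
  have [measurable]: "Y (?r k i) \<in> borel_measurable M" "Z (?r k i) \<in> borel_measurable M"
    "W (?r k i) \<in> borel_measurable M" "J (?r k i) \<in> borel_measurable M" "E (?r k i) \<in> borel_measurable M"
    "B (?r k i) \<in> borel_measurable M" for k i
    by (rule adapted_measurable[OF _ r(1)] Y Z J adapted_W adapted_E measurable_brownian[OF r(1)])+
  have Z_M: "Z T \<in> borel_measurable M" "Z 0 \<in> borel_measurable M"
    using T by (auto intro: adapted_measurable[OF Z(1)])
  have S1: "null_in_probability M (\<lambda>k \<omega>. ennreal \<bar>S1 k \<omega>\<bar>)"
    unfolding S1_def \<theta>_def \<mu>_def dB_def q_def by (rule null_quotient_steps[OF T Z])
  have blocks: "(\<Sum>i\<in>{i\<in>{..<Suc k}. i = b}. W (?r k i) \<omega> * R k i \<omega>) = W (?r k b) \<omega> * R k b \<omega>"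
    if "b \<in> {..<Suc k}" for k b \<omega>
  proof -
    have "{i\<in>{..<Suc k}. i = b} = {b}" using that by auto
    then show ?thesis by simp
  qed
  have S3: "null_in_probability M (\<lambda>k \<omega>. ennreal \<bar>S3 k \<omega>\<bar>)"
  proof -
    have "L2_set (\<lambda>b. \<Sum>i\<in>{i\<in>{..<Suc k}. (0::nat) = b}. W (?r k i) \<omega> * R k i \<omega>) {0} = \<bar>S3 k \<omega>\<bar>" for k \<omega>
      by (simp add: L2_set_def S3_def lessThan_def del: sum.lessThan_Suc)
    then show ?thesis
      using null_ito_grid[OF ito H adapted_W continuous_W T(1), of "\<lambda>_ _. 0" "\<lambda>_. {0}"]
      by (simp only: R_def dB_def)
  qed
  \<comment> \<open>The factor \<open>\<zeta>\<close> depends on the increment inside the step and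
    cannot serve as a weight. Singleton blocks make the norm of the weighted remainders small in
    probability, and Cauchy-Schwarz pairs it with the tight norm of the
    \<open>\<zeta>\<close>.\<close>
  have S4: "null_in_probability M (\<lambda>k \<omega>. ennreal \<bar>S4 k \<omega>\<bar>)"
  proof -
    let ?x = "\<lambda>k \<omega>. L2_set (\<lambda>b. W (?r k b) \<omega> * R k b \<omega>) {..<Suc k}"
    let ?z = "\<lambda>k \<omega>. L2_set (\<lambda>i. \<zeta> k i \<omega>) {..<Suc k}"
    have "L2_set (\<lambda>b. \<Sum>i\<in>{i\<in>{..<Suc k}. i = b}. W (?r k i) \<omega> * R k i \<omega>) {..<Suc k} = ?x k \<omega>" for k \<omega>
      by (intro L2_set_cong refl blocks)
    then have "null_in_probability M (\<lambda>k \<omega>. ennreal (?x k \<omega>))"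
      using null_ito_grid[OF ito H adapted_W continuous_W T(1), of "\<lambda>_ i. i" "\<lambda>k. {..<Suc k}"]
      by (simp only: R_def dB_def)
    then have "null_in_probability M (\<lambda>k \<omega>. ennreal (?z k \<omega>) * ennreal (?x k \<omega>))"
    proof (rule null_in_probability_mult_tight)
      show "?z k \<in> borel_measurable M" for k
        unfolding L2_set_def \<zeta>_def dB_def by measurable
      show "\<exists>C>0. \<forall>k. \<P>(\<omega> in M. C < ?z k \<omega>) \<le> e" if "0 < e" for e
        unfolding \<zeta>_def dB_def q_def by (rule inverse_steps_tight[OF T that])
    qed
    then show ?thesis
    proof (rule null_in_probability_mono[OF _ _ AE_I2])
      show "(\<lambda>\<omega>. ennreal \<bar>S4 k \<omega>\<bar>) \<in> borel_measurable M" for k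
        unfolding S4_def R_def \<zeta>_def dB_def by measurable
      fix k \<omega>
      have "\<bar>S4 k \<omega>\<bar> \<le> (\<Sum>i<Suc k. \<bar>W (?r k i) \<omega> * R k i \<omega>\<bar> * \<bar>\<zeta> k i \<omega>\<bar>)"
        unfolding S4_def abs_mult[symmetric] by (rule sum_abs)
      also have "\<dots> \<le> ?x k \<omega> * ?z k \<omega>" by (rule L2_set_mult_ineq)
      finally have "ennreal \<bar>S4 k \<omega>\<bar> \<le> ennreal (?z k \<omega> * ?x k \<omega>)"
        by (intro ennreal_leI) (simp only: mult.commute)
      then show "ennreal \<bar>S4 k \<omega>\<bar> \<le> ennreal (?z k \<omega>) * ennreal (?x k \<omega>)"
        by (simp only: ennreal_mult[OF L2_set_nonneg L2_set_nonneg])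
    qed
  qed
  have S2: "null_in_probability M (\<lambda>k \<omega>. ennreal \<bar>S2 k \<omega>\<bar>)"
  proof (rule null_in_probability_real_AE)
    show "S2 k \<in> borel_measurable M" for k
      unfolding S2_def err_def K_def by measurable
    show "AE \<omega> in M. (\<lambda>k. S2 k \<omega>) \<longlonglongrightarrow> 0"
      using eq AE_space
    proof eventually_elim
      case (elim \<omega>)
      define A where "A t = x0 + (LINT u:{0..t}|lborel. m u * Y u \<omega>)" for t
      have Y_eq: "Y t \<omega> = A t + J t \<omega>" if "0 \<le> t" for t using elim(1) that by (simp add: A_def)
      have sub: "{0..T} \<subseteq> {0..}" by auto
      have contY: "continuous_on {0..} (\<lambda>t. Y t \<omega>)" and contJ: "continuous_on {0..} (\<lambda>t. J t \<omega>)"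
        and contZ: "continuous_on {0..} (\<lambda>t. Z t \<omega>)" and contE: "continuous_on {0..} (\<lambda>t. E t \<omega>)"
        using Y J Z continuous_E elim(2) by (simp_all add: continuous_paths_def)
      have A_deriv: "(A has_real_derivative m s * Y s \<omega>) (at s within {0..})" if "0 \<le> s" for s
      proof -
        have "continuous_on {0..} (\<lambda>u. m u * Y u \<omega>)" by (intro continuous_on_mult continuous_m contY)
        from DERIV_add[OF DERIV_const[of x0] has_real_derivative_set_integral[OF this that]]
        show ?thesis by (simp add: A_def[abs_def])
      qed
      have V_deriv: "(V has_real_derivative - (m s * V s)) (at s within {0..})" if "0 \<le> s" for s
        using DERIV_inverse'[OF g_deriv[OF that]] g_pos[OF that]
        unfolding V_def[abs_def] by (simp add: field_simps)
      have contV: "continuous_on {0..} V" by (rule DERIV_continuous_on[OF V_deriv]) simp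
      have "continuous_on {0..} (\<lambda>s. - (m s * V s))" by (intro continuous_intros continuous_m contV)
      then obtain L where "0 \<le> L" and L: "\<And>s. 0 \<le> s \<Longrightarrow> s \<le> T \<Longrightarrow> \<bar>- (m s * V s)\<bar> \<le> L"
        by (rule continuous_on_bounded_abs[where t = T]) blast
      have "(\<lambda>k. \<Sum>i<Suc k. \<bar>V (?r k (Suc i)) * J (?r k (Suc i)) \<omega> - V (?r k i) * J (?r k i) \<omega>
          - V (?r k i) * (J (?r k (Suc i)) \<omega> - J (?r k i) \<omega>)
          - (- (V (?r k (Suc i)) * A (?r k (Suc i))) - - (V (?r k i) * A (?r k i)))\<bar>) \<longlonglongrightarrow> 0"
      proof (rule grid_integration_by_parts[OF T])
        show "continuous_on {0..T} (\<lambda>t. J t \<omega>)" using contJ sub by (rule continuous_on_subset)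
        fix s assume s: "s \<in> {0..T}"
        then have "0 \<le> s" by simp
        show "(V has_real_derivative - (m s * V s)) (at s within {0..T})"
          by (rule DERIV_subset[OF V_deriv[OF \<open>0 \<le> s\<close>] sub])
        \<comment> \<open>Since \<open>Y = A + J\<close>, the product \<open>V * A\<close> has
          derivative \<open>- m * V * A + m * V * Y = m * V * J\<close>; its negative therefore has
          derivative \<open>V' * J\<close>, as integration by parts against \<open>J\<close>
          demands.\<close>
        have "((\<lambda>s. - (V s * A s)) has_real_derivative - (- (m s * V s) * A s + m s * Y s \<omega> * V s)) (at s within {0..T})"
          by (intro DERIV_minus DERIV_mult DERIV_subset[OF V_deriv[OF \<open>0 \<le> s\<close>] sub] DERIV_subset[OF A_deriv[OF \<open>0 \<le> s\<close>] sub])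
        then show "((\<lambda>s. - (V s * A s)) has_real_derivative - (m s * V s) * J s \<omega>) (at s within {0..T})"
          by (simp add: Y_eq[OF \<open>0 \<le> s\<close>] algebra_simps)
        show "\<bar>- (m s * V s)\<bar> \<le> L" using L s by simp
      qed
      moreover have "V (?r k (Suc i)) * J (?r k (Suc i)) \<omega> - V (?r k i) * J (?r k i) \<omega>
          - V (?r k i) * (J (?r k (Suc i)) \<omega> - J (?r k i) \<omega>)
          - (- (V (?r k (Suc i)) * A (?r k (Suc i))) - - (V (?r k i) * A (?r k i))) = err k i \<omega>" for k i
        unfolding err_def Y_eq[OF r(1)] by (simp add: algebra_simps)
      ultimately have err_lim: "(\<lambda>k. \<Sum>i<Suc k. \<bar>err k i \<omega>\<bar>) \<longlonglongrightarrow> 0" by (simp only:)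
      have "continuous_on {0..} (\<lambda>t. K t \<omega>)"
        unfolding K_def using E_pos by (intro continuous_intros contE) (auto simp: less_le)
      then obtain C' where "0 \<le> C'" and C': "\<And>s. 0 \<le> s \<Longrightarrow> s \<le> T \<Longrightarrow> \<bar>K s \<omega>\<bar> \<le> C'"
        by (rule continuous_on_bounded_abs[where t = T]) blast
      from contZ obtain C where "0 \<le> C" and C: "\<And>s. 0 \<le> s \<Longrightarrow> s \<le> T \<Longrightarrow> \<bar>Z s \<omega>\<bar> \<le> C"
        by (rule continuous_on_bounded_abs[where t = T]) blast
      define Q where "Q = exp (\<sigma>\<^sup>2 * T) * (\<sigma>\<^sup>2)\<^sup>2"
      have "0 \<le> Q" by (simp add: Q_def)
      have bound: "\<bar>S2 k \<omega>\<bar> \<le> C * Q * (T * (T / real (Suc k))) + C' * (\<Sum>i<Suc k. \<bar>err k i \<omega>\<bar>)" for k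
      proof -
        have summand: "\<bar>Z (?r k i) \<omega> * (\<mu> k i - 1) + err k i \<omega> * K (?r k (Suc i)) \<omega>\<bar>
            \<le> C * Q * (?r k (Suc i) - ?r k i)\<^sup>2 + C' * \<bar>err k i \<omega>\<bar>" for i
        proof -
          have "?r k (Suc i) - ?r k i \<le> T" using r(1)[of k i] r(2)[of k "Suc i"] by linarith
          then have "0 \<le> q k i" "q k i \<le> \<sigma>\<^sup>2 * T"
            using r(4)[of k i] unfolding q_def by (auto intro: mult_left_mono)
          from quotient_step_mean[OF this] have "\<bar>\<mu> k i - 1\<bar> \<le> Q * (?r k (Suc i) - ?r k i)\<^sup>2"
            unfolding \<mu>_def by (simp add: Q_def q_def power_mult_distrib mult.assoc abs_le_iff)
          then have "\<bar>Z (?r k i) \<omega>\<bar> * \<bar>\<mu> k i - 1\<bar> \<le> C * (Q * (?r k (Suc i) - ?r k i)\<^sup>2)"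
            using C r \<open>0 \<le> C\<close> by (intro mult_mono) auto
          moreover have "\<bar>err k i \<omega>\<bar> * \<bar>K (?r k (Suc i)) \<omega>\<bar> \<le> \<bar>err k i \<omega>\<bar> * C'"
            using C' r by (intro mult_left_mono) auto
          ultimately show ?thesis
            using abs_triangle_ineq[of "Z (?r k i) \<omega> * (\<mu> k i - 1)" "err k i \<omega> * K (?r k (Suc i)) \<omega>"]
            unfolding abs_mult by (simp add: mult.assoc mult.commute[of C'])
        qed
        have "\<bar>S2 k \<omega>\<bar> \<le> (\<Sum>i<Suc k. \<bar>Z (?r k i) \<omega> * (\<mu> k i - 1) + err k i \<omega> * K (?r k (Suc i)) \<omega>\<bar>)"
          unfolding S2_def by (rule sum_abs)
        also have "\<dots> \<le> (\<Sum>i<Suc k. C * Q * (?r k (Suc i) - ?r k i)\<^sup>2 + C' * \<bar>err k i \<omega>\<bar>)"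
          by (intro sum_mono summand)
        also have "\<dots> = C * Q * (\<Sum>i<Suc k. (?r k (Suc i) - ?r k i)\<^sup>2) + C' * (\<Sum>i<Suc k. \<bar>err k i \<omega>\<bar>)"
          by (simp only: sum.distrib sum_distrib_left)
        also have "\<dots> \<le> C * Q * (T * (T / real (Suc k))) + C' * (\<Sum>i<Suc k. \<bar>err k i \<omega>\<bar>)"
          using \<open>0 \<le> C\<close> \<open>0 \<le> Q\<close> by (intro add_right_mono mult_left_mono sum_grid_step_square[OF T]) auto
        finally show ?thesis .
      qed
      have "(\<lambda>k. C * Q * (T * (T / real (Suc k))) + C' * (\<Sum>i<Suc k. \<bar>err k i \<omega>\<bar>)) \<longlonglongrightarrow> C * Q * (T * 0) + C' * 0"
        by (intro tendsto_add tendsto_mult tendsto_const grid_step_tendsto[OF T] err_lim)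
      then have "(\<lambda>k. C * Q * (T * (T / real (Suc k))) + C' * (\<Sum>i<Suc k. \<bar>err k i \<omega>\<bar>)) \<longlonglongrightarrow> 0"
        by (simp only: mult_zero_right add_0_right)
      then show ?case
        by (rule Lim_null_comparison[OF always_eventually[OF allI], rotated]) (simp only: real_norm_def bound)
    qed
  qed
  have "null_in_probability M (\<lambda>k \<omega>. ennreal \<bar>Z T \<omega> - Z 0 \<omega>\<bar>)"
  proof (rule null_in_probability_mono[OF _ _ AE_I2])
    show "null_in_probability M (\<lambda>k \<omega>. ennreal \<bar>S1 k \<omega>\<bar> + ennreal \<bar>S2 k \<omega>\<bar> + ennreal \<bar>S3 k \<omega>\<bar> + ennreal \<bar>S4 k \<omega>\<bar>)"
      by (intro null_in_probability_add S1 S2 S3 S4)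
    show "(\<lambda>\<omega>. ennreal \<bar>Z T \<omega> - Z 0 \<omega>\<bar>) \<in> borel_measurable M" using Z_M by measurable
    fix k :: nat and \<omega>
    have "ennreal \<bar>Z T \<omega> - Z 0 \<omega>\<bar> \<le> ennreal (\<bar>S1 k \<omega>\<bar> + \<bar>S2 k \<omega>\<bar> + \<bar>S3 k \<omega>\<bar> + \<bar>S4 k \<omega>\<bar>)"
      unfolding decomposition[of \<omega> k] by (intro ennreal_leI) linarith
    then show "ennreal \<bar>Z T \<omega> - Z 0 \<omega>\<bar> \<le> ennreal \<bar>S1 k \<omega>\<bar> + ennreal \<bar>S2 k \<omega>\<bar> + ennreal \<bar>S3 k \<omega>\<bar> + ennreal \<bar>S4 k \<omega>\<bar>"
      by (simp add: ennreal_plus)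
  qed
  from null_in_probability_const_AE_0[OF this] Y_0 brownian_0
  show ?thesis
  proof eventually_elim
    case (elim \<omega>)
    \<comment> \<open>\<open>B 0 = 0\<close> and \<open>g 0 = 1\<close> give \<open>W 0 = 1\<close>,
      so the constant value of \<open>Z\<close> is the initial value of \<open>Y\<close>.\<close>
    then have "W T \<omega> * Y T \<omega> = x0" by (simp add: Z_def W_def E_def g_0)
    then show ?case
      using g_pos[OF \<open>0 \<le> T\<close>] E_pos[of T \<omega>] by (simp add: W_def X_def field_simps)
  qed
qed

text \<open>Equality at each fixed time has its own exceptional null set. Countably many times and
  path continuity yield a single one, that is, indistinguishability.\<close>

lemma unique_strong_solution_X: "unique_strong_solution M B (\<lambda>t x. m t * x) (\<lambda>t x. \<sigma> * x) x0 X"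
  unfolding unique_strong_solution_def
proof (intro conjI allI impI strong_solution_X)
  fix Y assume sol: "strong_solution M B (\<lambda>t x. m t * x) (\<lambda>t x. \<sigma> * x) x0 Y"
  have "AE \<omega> in M. \<forall>i k. Y (real i / real (Suc k)) \<omega> = X (real i / real (Suc k)) \<omega>"
    unfolding AE_all_countable by (intro allI solution_unique_at[OF sol]) simp
  then show "AE \<omega> in M. \<forall>t\<ge>0. Y t \<omega> = X t \<omega>"
    using AE_space
  proof eventually_elim
    case (elim \<omega>)
    have "continuous_on {0..} (\<lambda>t. Y t \<omega>)" "continuous_on {0..} (\<lambda>t. X t \<omega>)"
      using sol continuous_X elim(2) by (simp_all add: strong_solution_def continuous_paths_def)
    then show ?case using eq_on_nonneg_reals elim(1) by blast
  qed
qed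

end

theorem proposition2:
  fixes M :: "'a measure" and B :: "real \<Rightarrow> 'a \<Rightarrow> real" and q0 d0 \<sigma> b :: real
  assumes "q0 > 0" and "d0 > 0" and "\<sigma> > 0" and "0 < b" and "b \<le> 1"
    and "standard_brownian_motion M B"
  shows "unique_strong_solution M B
           (\<lambda>t x. - (d0 * x / (1 + b * d0 * t))) (\<lambda>t x. \<sigma> * x) q0
           (\<lambda>t \<omega>. q0 * (1 + b * d0 * t) powr (- 1 / b) * exp (- (1 / 2) * \<sigma>\<^sup>2 * t + \<sigma> * B t \<omega>))"
proof -
  have pos: "0 < 1 + b * d0 * t" if "0 \<le> t" for t
    using assms that by (intro add_pos_nonneg mult_nonneg_nonneg) auto
  have "prob_space M" using assms(6) by (simp add: standard_brownian_motion_def)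
  \<comment> \<open>The rate \<open>- d0 / (1 + b * d0 * t)\<close> has the primitive
    \<open>- ln (1 + b * d0 * t) / b\<close> vanishing at 0; its exponential is the power used for
    \<open>g\<close>.\<close>
  interpret linear_sde M B "\<lambda>t. - (d0 / (1 + b * d0 * t))" "\<lambda>t. (1 + b * d0 * t) powr (- 1 / b)" \<sigma> q0
  proof (intro linear_sde.intro brownian.intro brownian_axioms.intro linear_sde_axioms.intro)
    show "prob_space M" "standard_brownian_motion M B" by fact+
    show "continuous_on {0..} (\<lambda>t. - (d0 / (1 + b * d0 * t)))"
      using pos by (intro continuous_intros) (force simp: less_le)
    fix t :: real assume t: "0 \<le> t"
    show "0 < (1 + b * d0 * t) powr (- 1 / b)" using pos[OF t] by simp
    have "((\<lambda>t. 1 + b * d0 * t) has_real_derivative b * d0) (at t)"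
      by (auto intro!: derivative_eq_intros)
    from DERIV_powr[OF this pos[OF t] DERIV_const[of "- 1 / b"]]
    have "((\<lambda>t. (1 + b * d0 * t) powr (- 1 / b)) has_real_derivative
        - (d0 / (1 + b * d0 * t)) * (1 + b * d0 * t) powr (- 1 / b)) (at t)"
      using assms(4) by (simp add: mult.commute)
    then show "((\<lambda>t. (1 + b * d0 * t) powr (- 1 / b)) has_real_derivative
        - (d0 / (1 + b * d0 * t)) * (1 + b * d0 * t) powr (- 1 / b)) (at t within {0..})"
      by (rule has_field_derivative_at_within)
  qed simp
  have "(\<lambda>t x. - (d0 / (1 + b * d0 * t)) * x) = (\<lambda>t x. - (d0 * x / (1 + b * d0 * t)))"
    by (intro ext) simp
  moreover have "X = (\<lambda>t \<omega>. q0 * (1 + b * d0 * t) powr (- 1 / b) * exp (- (1 / 2) * \<sigma>\<^sup>2 * t + \<sigma> * B t \<omega>))"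
    unfolding X_def E_def by (intro ext) simp
  ultimately show ?thesis using unique_strong_solution_X by simp
qed

end
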